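(* Let $\mathcal{B}$ be Bring's curve $\{\sum_{i=1}^5 x_i=\sum_{i=1}^5x_i^2=\sum_{i=1}^5x_i^3=0\}\subset\mathbb{P}^4$ over $\mathbb{C}$, and let $\zeta=\exp(2\pi i/5)$. The face-centres of $\mathcal{B}$ are exactly the points fixed by an order-$5$ automorphism of the curve. They are given in the $\mathbb{P}^4$-model by the permutations of $[1:\zeta:\zeta^2:\zeta^3:\zeta^4]$. The corresponding points in the HC-model are the desingularizations of the double points $V_k$, together with $a,b,c,d$ (see context) and the following ten points $[X:Y:Z]$: 1. $[-2\zeta^3-2\zeta^2:\zeta^3+\zeta^2-1:1]=[\sqrt5+1:-\sqrt5/2-3/2:1]=[2j:j'-2:1]$, 2. $[-2\zeta^3-2:-2\zeta^3-\zeta-1:1]$, 3. $[-2\zeta^2-2\zeta:-\zeta^3+\zeta+1:1]$, 4. $[2\zeta^3+2\zeta^2+2\zeta:\zeta^3+2\zeta^2+2\zeta+1:1]$, 5. $[-2\zeta^2-2:\zeta^3-\zeta^2+\zeta:1]$, 6. $[2\zeta^3+2\zeta+2:\zeta^2-\zeta+1:1]$, 7. $[-2\zeta^3-2\zeta:2\zeta^3+\zeta^2+\zeta+2:1]$, 8. $[2\zeta^3+2\zeta^2+2:-\zeta^3-\zeta^2-2:1]=[-\sqrt5+1:\sqrt5/2-3/2:1]=[2j':j-2:1]$, 9. $[2\zeta^2+2\zeta+2:-\zeta^3-2\zeta^2-\zeta:1]$, 10. $[-2\zeta-2:-\zeta^2-2\zeta-1:1]$.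
   Context: $\mathrm{Aut}(\mathcal{B})=S_5$ acting by permutation of coordinates. Orbits of $\mathrm{Aut}(\mathcal{B})$ on $\mathcal{B}$ of size less than $120$ are exactly three, of sizes $24$, $30$, $60$; they are identified with the face-centres (24), vertices (30) and edge-centres (60) of the regular map $\{5,4\}_6$ on $\mathcal{B}$ (a tessellation by 24 pentagons, four meeting at each vertex, with orientation-preserving automorphism group $\mathrm{Aut}(\mathcal{B})$). So the face-centres form the orbit of size $24$. The HC-model is the plane curve $X(Y^5+Z^5)+(XYZ)^2-X^4YZ-2(YZ)^3=0$, birational to $\mathcal{B}$. Its only singular points are the double points $V_k=[\zeta^k:\zeta^{2k}:1]$, $k=0,\dots,4$, and $V_5=[1:0:0]$, each of which desingularizes to two points on the smooth model. The points $a,b,c,d$ have leading-order local expansions (in a local parameter $t$) $a=[0:0:1]\simeq[2t^3:t:1]$, $b=[0:1:0]\simeq[2t^2:1/t:1]$, $c=[1:0:0]_2\simeq[1:t:t^4]$, $d=[1:0:0]_1\simeq[1:t^4:t]$; in particular $c,d$ are the two points over $V_5$. Finally $j=-\zeta^3-\zeta^2=(1+\sqrt5)/2$ and $j'=\zeta^3+\zeta^2+1=(1-\sqrt5)/2$ are the roots of $j^2-j-1=0$. *)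

theory Defs
  imports
    "HOL-Analysis.Analysis"
    "HOL-Library.Landau_Symbols"
    "HOL-Algebra.Group_Action"
    "HOL-Algebra.Multiplicative_Group"
begin

text \<open>A point of projective space is the set of its homogeneous coordinate vectors. (The value at
  \<open>0\<close> is the junk class \<open>{0}\<close>, which is not the class of any nonzero vector.)\<close>

definition proj :: "complex^'n \<Rightarrow> (complex^'n) set" where
  "proj x = {c *s x | c. c \<noteq> 0}"

definition \<zeta> :: complex where
  "\<zeta> = exp (2 * of_real pi * \<i> / 5)"

definition golden :: complex where
  "golden = - (\<zeta>^3) - \<zeta>^2"

definition golden_conj :: complex where
  "golden_conj = \<zeta>^3 + \<zeta>^2 + 1"


section \<open>Bring's curve and its automorphism group\<close>

definition bring_cone :: "(complex^5) set" where
  "bring_cone = {x. (\<Sum>i\<in>UNIV. x $ i) = 0 \<and> (\<Sum>i\<in>UNIV. (x $ i)^2) = 0 \<and> (\<Sum>i\<in>UNIV. (x $ i)^3) = 0}"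

definition bring :: "(complex^5) set set" where
  "bring = {proj x | x. x \<noteq> 0 \<and> x \<in> bring_cone}"

definition permute_coords :: "(5 \<Rightarrow> 5) \<Rightarrow> complex^5 \<Rightarrow> complex^5" where
  "permute_coords \<sigma> x = (\<chi> i. x $ \<sigma> i)"

text \<open>\<open>Aut(B) = S\<^sub>5\<close> acting by permutation of coordinates, realised as a group of self-maps of the
  curve, so that orders and fixed points are those of the maps themselves.\<close>

definition bring_aut :: "((complex^5) set \<Rightarrow> (complex^5) set) monoid" where
  "bring_aut = (BijGroup bring)
     \<lparr>carrier := {\<lambda>P\<in>bring. permute_coords \<sigma> ` P | \<sigma>. bij \<sigma>}\<rparr>"

text \<open>The face-centres of the regular map \<open>{5,4}\<^sub>6\<close> form the orbit of size 24; the group has only one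
  orbit of that size.\<close>

definition face_centres :: "(complex^5) set set" where
  "face_centres = (THE S. S \<in> orbits bring_aut bring (\<lambda>g. g) \<and> card S = 24)"


section \<open>The smooth model of a plane curve\<close>

text \<open>The points of the smooth model of \<open>F = 0\<close> are its places: irreducible (that is, injectively
  parametrised) holomorphic branches modulo reparametrisation. Only the germ at \<open>0\<close> of a
  parametrisation matters, and only as a map into the projective plane.\<close>

definition analytic_germ :: "(complex \<Rightarrow> complex^'n) \<Rightarrow> bool" where
  "analytic_germ \<gamma> \<longleftrightarrow> (\<forall>i. (\<lambda>t. \<gamma> t $ i) analytic_on {0}) \<and> \<gamma> 0 \<noteq> 0"

definition branches :: "(complex^3 \<Rightarrow> complex) \<Rightarrow> (complex \<Rightarrow> complex^3) set" where
  "branches F = {\<gamma>. analytic_germ \<gamma> \<and> (\<forall>\<^sub>F t in nhds 0. F (\<gamma> t) = 0) \<and>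
                    (\<exists>r>0. inj_on (\<lambda>t. proj (\<gamma> t)) (ball 0 r))}"

definition same_place :: "(complex \<Rightarrow> complex^3) \<Rightarrow> (complex \<Rightarrow> complex^3) \<Rightarrow> bool" where
  "same_place \<gamma> \<delta> \<longleftrightarrow>
     (\<exists>\<tau>. \<tau> analytic_on {0} \<and> \<tau> 0 = 0 \<and> deriv \<tau> 0 \<noteq> 0 \<and>
          (\<forall>\<^sub>F t in nhds 0. proj (\<delta> t) = proj (\<gamma> (\<tau> t))))"

definition places :: "(complex^3 \<Rightarrow> complex) \<Rightarrow> (complex \<Rightarrow> complex^3) set set" where
  "places F = branches F // {(\<gamma>, \<delta>). \<gamma> \<in> branches F \<and> \<delta> \<in> branches F \<and> same_place \<gamma> \<delta>}"

definition places_over ::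
    "(complex^3 \<Rightarrow> complex) \<Rightarrow> (complex^3) set \<Rightarrow> (complex \<Rightarrow> complex^3) set set" where
  "places_over F q = {P \<in> places F. \<exists>\<gamma>\<in>P. proj (\<gamma> 0) = q}"

text \<open>\<open>has_expansion P e\<close>: in some local parameter \<open>t\<close> at \<open>P\<close> the homogeneous coordinates have the
  leading-order terms \<open>e t\<close>, up to a common factor \<open>h t\<close>.\<close>

definition has_expansion ::
    "(complex \<Rightarrow> complex^3) set \<Rightarrow> (complex \<Rightarrow> complex^3) \<Rightarrow> bool" where
  "has_expansion P e \<longleftrightarrow>
     (\<exists>\<gamma>\<in>P. \<exists>h. \<forall>i. (\<lambda>t. \<gamma> t $ i) \<sim>[at 0] (\<lambda>t. h t * e t $ i))"


section \<open>The HC-model and its birational map to Bring's curve\<close>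

definition hc :: "complex^3 \<Rightarrow> complex" where
  "hc v = (let X = v $ 1; Y = v $ 2; Z = v $ 3
           in X * (Y^5 + Z^5) + (X * Y * Z)^2 - X^4 * Y * Z - 2 * (Y * Z)^3)"

text \<open>The adjoint cubics, i.e. the cubics through the six double points, form a four-dimensional
  space and give the canonical embedding. The basis \<open>y\<^sub>1,\<dots>,y\<^sub>4\<close> below consists of eigenvectors of
  \<open>[X:Y:Z] \<mapsto> [\<zeta>X:\<zeta>\<^sup>2Y:Z]\<close>, scaled so that \<open>y\<^sub>1y\<^sub>4 + y\<^sub>2y\<^sub>3\<close> is the sextic itself and
  \<open>y\<^sub>1\<^sup>2y\<^sub>3 + y\<^sub>1y\<^sub>2\<^sup>2 + y\<^sub>2y\<^sub>4\<^sup>2 + y\<^sub>3\<^sup>2y\<^sub>4\<close> vanishes identically. These two forms are, up to constants,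
  the second and third power sums of the discrete Fourier coordinates \<open>x\<^sub>k = \<Sum>\<^sub>j y\<^sub>j \<zeta>\<^sup>j\<^sup>k\<close>. Any other
  birational map to Bring's curve differs from this one by an element of \<open>Aut(B)\<close>, so the
  correspondence of face-centres does not depend on the choice.\<close>

definition hc_adjoint :: "complex^3 \<Rightarrow> nat \<Rightarrow> complex" where
  "hc_adjoint v j = (let X = v $ 1; Y = v $ 2; Z = v $ 3
     in [0, Y * (Y * Z - X^2), X * Y^2 - Z^3, Y^3 - X * Z^2, Z * (X^2 - Y * Z)] ! j)"

definition hc_to_bring :: "complex^3 \<Rightarrow> complex^5" where
  "hc_to_bring v = vector (map (\<lambda>k. \<Sum>j=1..4. hc_adjoint v j * \<zeta>^(j * k)) [0..<5])"

text \<open>The induced map from the smooth model: divide out the common zero of the cubics along a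
  branch, then evaluate at the centre.\<close>

definition hc_place_to_bring :: "(complex \<Rightarrow> complex^3) set \<Rightarrow> (complex^5) set" where
  "hc_place_to_bring P =
     (THE p. \<exists>\<gamma>\<in>P. \<exists>\<xi>. analytic_germ \<xi> \<and> proj (\<xi> 0) = p \<and>
                (\<forall>\<^sub>F t in at 0. proj (\<xi> t) = proj (hc_to_bring (\<gamma> t))))"

lemma zeta_pow5: "\<zeta>^5 = 1"
proof -
  have "\<zeta>^5 = exp (of_nat 5 * (2 * of_real pi * \<i> / 5))"
    unfolding \<zeta>_def by (rule exp_of_nat_mult [symmetric])
  also have "\<dots> = exp (2 * of_real pi * \<i>)"
    by (rule arg_cong [where f = exp]) simp
  finally show ?thesis by (simp only: exp_two_pi_i)
qed

lemma zeta_ne_1: "\<zeta> \<noteq> 1"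
proof
  assume "\<zeta> = 1"
  then obtain n :: int where n: "Im (2 * of_real pi * \<i> / 5) = of_int (2 * n) * pi"
    unfolding \<zeta>_def exp_eq_1 by blast
  have "Im (2 * of_real pi * \<i> / 5) = 2 * pi / 5" by simp
  with n have "pi * (1 / 5) = pi * of_int n" by simp
  then have "(1 / 5 :: real) = of_int n" by (metis mult_left_cancel pi_neq_zero)
  then have "real_of_int (5 * n) = real_of_int 1" by simp
  then have "5 * n = 1" by (simp only: of_int_eq_iff)
  then show False by presburger
qed

lemma zeta_power_sum: "(\<Sum>k<5. \<zeta>^(m * k)) = (if 5 dvd m then 5 else 0)"
proof (cases "5 dvd m")
  case True
  then have "\<zeta>^m = 1" by (auto elim!: dvdE simp: power_mult zeta_pow5)
  then show ?thesis using True by (simp add: power_mult)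
next
  case False
  have "\<zeta>^m \<noteq> 1"
  proof
    assume m: "\<zeta>^m = 1"
    define r where "r = m mod 5"
    have "\<zeta>^m = \<zeta>^(5 * (m div 5) + r)" unfolding r_def by simp
    then have r1: "\<zeta>^r = 1" using m by (simp only: power_add power_mult zeta_pow5 power_one mult_1)
    have "r < 5" unfolding r_def by simp
    moreover have "r \<noteq> 0" using False unfolding r_def by (simp add: dvd_eq_mod_eq_0)
    ultimately have "r = 1 \<or> r = 2 \<or> r = 3 \<or> r = 4" by presburger
    then have "\<zeta> = 1"
    proof (elim disjE)
      assume "r = 1" then show ?thesis using r1 by simp
    next
      assume "r = 2" then have "\<zeta>^2 = 1" using r1 by simp
      moreover have "\<zeta>^5 = (\<zeta>^2)^2 * \<zeta>" by (simp add: eval_nat_numeral)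
      ultimately show ?thesis using zeta_pow5 by simp
    next
      assume "r = 3" then have "\<zeta>^3 = 1" using r1 by simp
      moreover have "(\<zeta>^3)^2 = \<zeta>^5 * \<zeta>" by (simp add: eval_nat_numeral)
      ultimately show ?thesis using zeta_pow5 by simp
    next
      assume "r = 4" then have "\<zeta>^4 = 1" using r1 by simp
      moreover have "\<zeta>^5 = \<zeta>^4 * \<zeta>" by (simp add: eval_nat_numeral)
      ultimately show ?thesis using zeta_pow5 by simp
    qed
    then show False using zeta_ne_1 by simp
  qed
  moreover have "(\<zeta>^m)^5 = 1" by (metis mult.commute power_mult power_one zeta_pow5)
  ultimately have "(\<Sum>k<5. (\<zeta>^m)^k) = 0" by (simp add: geometric_sum)
  then show ?thesis using False by (simp add: power_mult)
qed

lemma fourier_power_sums: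
  fixes y :: "nat \<Rightarrow> complex"
  defines "x \<equiv> \<lambda>k. \<Sum>j=1..4. y j * \<zeta>^(j * k)"
  shows "(\<Sum>k<5. x k) = 0"
    and "(\<Sum>k<5. (x k)^2) = 10 * (y 1 * y 4 + y 2 * y 3)"
    and "(\<Sum>k<5. (x k)^3) =
           15 * ((y 1)^2 * y 3 + y 1 * (y 2)^2 + y 2 * (y 4)^2 + (y 3)^2 * y 4)"
proof -
  have I: "{1..4} = {1, 2, 3, 4::nat}" by auto
  have "(\<Sum>k<5. x k) = (\<Sum>j=1..4. y j * (\<Sum>k<5. \<zeta>^(j * k)))"
    unfolding x_def by (subst sum.swap) (simp add: sum_distrib_left)
  then show "(\<Sum>k<5. x k) = 0"
    unfolding zeta_power_sum I by simp
  have "(\<Sum>k<5. (x k)^2) =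
          (\<Sum>k<5. \<Sum>i=1..4. \<Sum>j=1..4. y i * y j * \<zeta>^((i + j) * k))"
    unfolding x_def power2_eq_square sum_product
    by (intro sum.cong refl) (simp add: power_add algebra_simps)
  also have "\<dots> = (\<Sum>i=1..4. \<Sum>j=1..4. y i * y j * (\<Sum>k<5. \<zeta>^((i + j) * k)))"
    by (simp only: sum.swap [of _ _ "{..<5}"] sum_distrib_left)
  finally show "(\<Sum>k<5. (x k)^2) = 10 * (y 1 * y 4 + y 2 * y 3)"
    unfolding zeta_power_sum I by (simp del: One_nat_def)
  have "(\<Sum>k<5. (x k)^3) =
          (\<Sum>k<5. \<Sum>i=1..4. \<Sum>j=1..4. \<Sum>l=1..4. y i * y j * y l * \<zeta>^((i + j + l) * k))"
    unfolding x_def power3_eq_cube sum_product sum_distrib_left sum_distrib_right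
    by (intro sum.cong refl) (simp add: power_add algebra_simps)
  also have "\<dots> = (\<Sum>i=1..4. \<Sum>j=1..4. \<Sum>l=1..4. y i * y j * y l * (\<Sum>k<5. \<zeta>^((i + j + l) * k)))"
    by (simp only: sum.swap [of _ _ "{..<5}"] sum_distrib_left)
  finally show "(\<Sum>k<5. (x k)^3) =
           15 * ((y 1)^2 * y 3 + y 1 * (y 2)^2 + y 2 * (y 4)^2 + (y 3)^2 * y 4)"
    unfolding zeta_power_sum I by (simp add: power2_eq_square algebra_simps del: One_nat_def)
qed

lemma sum_UNIV_5: "(\<Sum>i\<in>(UNIV::5 set). f i) = f 1 + f 2 + f 3 + f 4 + (f 5 :: complex)"
proof -
  have U: "(UNIV :: 5 set) = {1, 2, 3, 4, 5}"
    by (rule card_subset_eq [symmetric]) simp_all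
  show ?thesis unfolding U by (simp add: add.assoc)
qed

lemma vector_5:
  "(vector [a, b, c, d, e] :: complex^5) $ 1 = a"
  "(vector [a, b, c, d, e] :: complex^5) $ 2 = b"
  "(vector [a, b, c, d, e] :: complex^5) $ 3 = c"
  "(vector [a, b, c, d, e] :: complex^5) $ 4 = d"
  "(vector [a, b, c, d, e] :: complex^5) $ 5 = e"
  unfolding vector_def by simp_all

lemma hc_adjoint_simps:
  "hc_adjoint v 1 = v $ 2 * (v $ 2 * v $ 3 - (v $ 1)^2)"
  "hc_adjoint v 2 = v $ 1 * (v $ 2)^2 - (v $ 3)^3"
  "hc_adjoint v 3 = (v $ 2)^3 - v $ 1 * (v $ 3)^2"
  "hc_adjoint v 4 = v $ 3 * ((v $ 1)^2 - v $ 2 * v $ 3)"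
  by (simp_all add: hc_adjoint_def numeral_eq_Suc Let_def)

lemma hc_to_bring_in_bring:
  assumes "hc v = 0"
  shows "hc_to_bring v \<in> bring_cone"
proof -
  define y where "y = hc_adjoint v"
  define x where "x k = (\<Sum>j=1..4. y j * \<zeta>^(j * k))" for k
  have v: "hc_to_bring v = vector [x 0, x 1, x 2, x 3, x 4]"
    unfolding hc_to_bring_def y_def [symmetric] x_def [symmetric]
    by (simp add: upt_rec numeral_eq_Suc)
  have S: "(\<Sum>i\<in>UNIV. f (hc_to_bring v $ i)) = (\<Sum>k<5. f (x k))" for f :: "complex \<Rightarrow> complex"
    unfolding sum_UNIV_5 v vector_5 by (simp add: eval_nat_numeral)
  have "y 1 * y 4 + y 2 * y 3 = hc v"
    unfolding y_def hc_adjoint_simps hc_def Let_def by (simp add: eval_nat_numeral algebra_simps)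
  moreover have "(y 1)^2 * y 3 + y 1 * (y 2)^2 + y 2 * (y 4)^2 + (y 3)^2 * y 4 = 0"
    unfolding y_def hc_adjoint_simps by (simp add: eval_nat_numeral algebra_simps)
  ultimately show ?thesis
    using assms S [of "\<lambda>z. z"] S [of "\<lambda>z. z^2"] S [of "\<lambda>z. z^3"] fourier_power_sums [of y]
    unfolding bring_cone_def x_def [symmetric] by simp
qed

text \<open>The rational inverse, in Fourier coordinates.\<close>

lemma hc_adjoint_inverse:
  fixes v :: "complex^3"
  defines "y \<equiv> hc_adjoint v"
  shows "vector [- ((y 1)^2 + y 3 * y 4), y 1 * y 2, - (y 2 * y 4)]
           = ((v $ 2 * v $ 3 - (v $ 1)^2) * y 2) *s v"
proof -
  have "- ((y 1)^2 + y 3 * y 4) = ((v $ 2 * v $ 3 - (v $ 1)^2) * y 2) * v $ 1"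
    "y 1 * y 2 = ((v $ 2 * v $ 3 - (v $ 1)^2) * y 2) * v $ 2"
    "- (y 2 * y 4) = ((v $ 2 * v $ 3 - (v $ 1)^2) * y 2) * v $ 3"
    unfolding y_def hc_adjoint_simps by (simp_all add: eval_nat_numeral algebra_simps)
  then show ?thesis by (simp add: vec_eq_iff forall_3)
qed

text \<open>The double points \<open>V\<^sub>0,\<dots>,V\<^sub>5\<close>.\<close>

definition hc_node :: "nat \<Rightarrow> complex^3" where
  "hc_node k = (if k < 5 then vector [\<zeta>^k, \<zeta>^(2*k), 1] else vector [1, 0, 0])"

definition hc_listed_points :: "(complex^3) list" where
  "hc_listed_points =
    [vector [- 2*\<zeta>^3 - 2*\<zeta>^2, \<zeta>^3 + \<zeta>^2 - 1, 1],
     vector [- 2*\<zeta>^3 - 2, - 2*\<zeta>^3 - \<zeta> - 1, 1],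
     vector [- 2*\<zeta>^2 - 2*\<zeta>, - (\<zeta>^3) + \<zeta> + 1, 1],
     vector [2*\<zeta>^3 + 2*\<zeta>^2 + 2*\<zeta>, \<zeta>^3 + 2*\<zeta>^2 + 2*\<zeta> + 1, 1],
     vector [- 2*\<zeta>^2 - 2, \<zeta>^3 - \<zeta>^2 + \<zeta>, 1],
     vector [2*\<zeta>^3 + 2*\<zeta> + 2, \<zeta>^2 - \<zeta> + 1, 1],
     vector [- 2*\<zeta>^3 - 2*\<zeta>, 2*\<zeta>^3 + \<zeta>^2 + \<zeta> + 2, 1],
     vector [2*\<zeta>^3 + 2*\<zeta>^2 + 2, - (\<zeta>^3) - \<zeta>^2 - 2, 1],
     vector [2*\<zeta>^2 + 2*\<zeta> + 2, - (\<zeta>^3) - 2*\<zeta>^2 - \<zeta>, 1],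
     vector [- 2*\<zeta> - 2, - (\<zeta>^2) - 2*\<zeta> - 1, 1]]"

end

theory Submission
  imports Defs
    "HOL-Complex_Analysis.Conformal_Mappings"
    "HOL-Number_Theory.Cong"
begin

text \<open>
  The proof has a group-theoretic and an analytic half, which meet in a count.

  Let \<open>x\<close> be a vector whose five coordinates are the fifth roots of unity in some order (a root
  vector). The points \<open>proj x\<close> lie on Bring's curve, and fixing one coordinate to be \<open>1\<close> shows that
  there are \<open>4! = 24\<close> of them; they form one orbit. The action of \<open>S\<^sub>5\<close> on the curve is faithful
  (it is already faithful on these points), so the group has order 120, and by the orbit-stabilizer theorem
  an orbit of size 24 has stabilizers of order 5. An element of order 5 is a five-cycle, and a vector
  that it scales has entries in geometric progression, with ratio a fifth root of unity; the ratio is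
  not \<open>1\<close> because the entries sum to zero. So fixed points of elements of order 5 are root vectors
  (\<open>five_cycle_fixed_point\<close>), which gives the unique orbit of size 24 and its two descriptions.

  On the plane sextic everything is local. Near each of the points in question the sextic is \<open>g(t, s) = 0\<close>
  in suitable analytic coordinates, where \<open>\<partial>g/\<partial>s \<noteq> 0\<close>: at a smooth point directly, at a double
  point after blowing up, once for each of the two tangent directions. The implicit function theorem
  then yields \<open>s = \<phi>(t)\<close>, and every branch through the point is this one up to a parameter change
  (locale \<open>hc_chart\<close>). Evaluating the adjoint cubics, divided by \<open>t\<close> at the double points, gives the
  Fourier coordinates \<open>(y\<^sub>1 : y\<^sub>2 : y\<^sub>3 : y\<^sub>4)\<close> of the image of the place. The expansions identify \<open>a, b, c, d\<close>.

  The rest is arithmetic in \<open>\<rat>(\<zeta>)\<close>. With \<open>j\<^sup>2 = j + 1\<close> and \<open>\<omega>\<^sup>5 = 1\<close>, the ten listed points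
  are \<open>[2j\<omega> : -j\<^sup>2\<omega>\<^sup>2 : 1]\<close>, with images \<open>(j\<^sup>2\<omega>\<^sup>4 : j : -j\<omega> : \<omega>\<^sup>2)\<close>; the two places over
  \<open>[\<omega> : \<omega>\<^sup>2 : 1]\<close> have images \<open>(j\<omega>\<^sup>4 : 1 : j\<^sup>2\<omega> : -j\<omega>\<^sup>2)\<close> for the two values of \<open>j\<close>; and
  \<open>a, b, c, d\<close> go to the four unit vectors. The \<open>k\<close>-th coordinate on Bring's curve is then
  proportional to \<open>\<zeta>\<^bsup>ik\<^esup>\<close> or to \<open>\<zeta>\<close> to a power that is cubic in \<open>k\<close>. Since cubing permutes the
  residues modulo 5, these are root vectors. The 24 images are distinct (\<open>face_point_inj\<close>), hence
  they exhaust the orbit of size 24.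
\<close>

section \<open>Projective points and fifth roots of unity\<close>

lemma proj_eq_iff: "proj x = proj y \<longleftrightarrow> (\<exists>c. c \<noteq> 0 \<and> y = c *s x)"
proof
  assume "proj x = proj y"
  moreover have "y \<in> proj y" unfolding proj_def by (auto intro: exI [of _ 1])
  ultimately show "\<exists>c. c \<noteq> 0 \<and> y = c *s x" unfolding proj_def by auto
next
  assume "\<exists>c. c \<noteq> 0 \<and> y = c *s x"
  then obtain c where c: "c \<noteq> 0" "y = c *s x" by blast
  show "proj x = proj y"
  proof (intro equalityI subsetI)
    fix z assume "z \<in> proj x"
    then obtain b where "b \<noteq> 0" "z = b *s x" unfolding proj_def by auto
    then have "z = (b / c) *s y" "b / c \<noteq> 0" using c by (auto simp: vector_smult_assoc)
    then show "z \<in> proj y" unfolding proj_def by blast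
  next
    fix z assume "z \<in> proj y"
    then obtain b where "b \<noteq> 0" "z = b *s y" unfolding proj_def by auto
    then have "z = (b * c) *s x" "b * c \<noteq> 0" using c by (auto simp: vector_smult_assoc)
    then show "z \<in> proj x" unfolding proj_def by blast
  qed
qed

lemma proj_smult: "c \<noteq> 0 \<Longrightarrow> proj (c *s x) = proj x"
  using proj_eq_iff by metis

lemma zeta_power_eq_1_iff: "\<zeta>^m = 1 \<longleftrightarrow> 5 dvd m"
proof
  assume "\<zeta>^m = 1"
  then have "(\<Sum>k<5. \<zeta>^(m * k)) = 5" by (simp add: power_mult)
  then show "5 dvd m" unfolding zeta_power_sum by (simp split: if_splits)
next
  assume "5 dvd m"
  then show "\<zeta>^m = 1" by (auto elim!: dvdE simp: power_mult zeta_pow5)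
qed

lemma zeta_nonzero [simp]: "\<zeta> \<noteq> 0"
  using zeta_pow5 by auto

lemma zeta_power_inj: "m < 5 \<Longrightarrow> n < 5 \<Longrightarrow> \<zeta>^m = \<zeta>^n \<longleftrightarrow> m = n"
proof (induction m n rule: linorder_wlog)
  case (le m n)
  have "\<zeta>^n = \<zeta>^m * \<zeta>^(n - m)" using le(1) by (simp flip: power_add)
  then have "\<zeta>^m = \<zeta>^n \<longleftrightarrow> \<zeta>^(n - m) = 1" by auto
  also have "\<dots> \<longleftrightarrow> 5 dvd n - m" by (rule zeta_power_eq_1_iff)
  also have "\<dots> \<longleftrightarrow> m = n" using le by (auto dest: dvd_imp_le)
  finally show ?case .
next
  case (sym m n)
  then show ?case by auto
qed

definition fifth_roots :: "complex set" where
  "fifth_roots = {z. z^5 = 1}"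

lemma fifth_roots_eq: "fifth_roots = (\<lambda>n. \<zeta>^n) ` {..<5}" and card_fifth_roots: "card fifth_roots = 5"
proof -
  have inj: "inj_on (\<lambda>n. \<zeta>^n) {..<5::nat}" by (auto simp: inj_on_def zeta_power_inj)
  have sub: "(\<lambda>n. \<zeta>^n) ` {..<5} \<subseteq> fifth_roots"
    unfolding fifth_roots_def
    by (auto simp: power_mult [symmetric] mult.commute [of _ 5]) (simp add: power_mult zeta_pow5)
  have fin: "finite fifth_roots" and le: "card fifth_roots \<le> 5"
    unfolding fifth_roots_def using finite_roots_unity [of 5] card_roots_unity [of 5] by auto
  have c: "card ((\<lambda>n. \<zeta>^n) ` {..<5::nat}) = 5" using inj by (simp add: card_image)
  show "fifth_roots = (\<lambda>n. \<zeta>^n) ` {..<5}"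
    using card_seteq [OF fin sub] le c by simp
  with c show "card fifth_roots = 5" by simp
qed

lemma finite_fifth_roots: "finite fifth_roots"
  using card_fifth_roots by (metis card.infinite zero_neq_numeral)

lemma fifth_rootE:
  assumes "z^5 = 1"
  obtains n where "n < 5" "z = \<zeta>^n"
  using assms fifth_roots_eq unfolding fifth_roots_def by blast

definition root_vectors :: "(complex^5) set" where
  "root_vectors = {x. inj (($) x) \<and> (\<forall>i. (x $ i)^5 = 1)}"

definition zeta_vector :: "complex^5" where
  "zeta_vector = vector [1, \<zeta>, \<zeta>^2, \<zeta>^3, \<zeta>^4]"

lemma UNIV_5: "(UNIV :: 5 set) = {1, 2, 3, 4, 5}"
  by (rule card_subset_eq [symmetric]) simp_all

lemma forall_5: "(\<forall>i::5. P i) \<longleftrightarrow> P 1 \<and> P 2 \<and> P 3 \<and> P 4 \<and> P 5"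
proof -
  have "(\<forall>i::5. P i) \<longleftrightarrow> (\<forall>i\<in>(UNIV::5 set). P i)" by blast
  then show ?thesis unfolding UNIV_5 by blast
qed

lemma zeta_vector_root: "zeta_vector \<in> root_vectors"
proof -
  have five: "{..<5} = {0, 1, 2, 3, 4::nat}" by auto
  have "range (($) zeta_vector) = fifth_roots"
    unfolding UNIV_5 fifth_roots_eq five by (simp add: zeta_vector_def vector_5)
  moreover from this have "inj (($) zeta_vector)"
    by (intro eq_card_imp_inj_on) (simp_all add: card_fifth_roots)
  ultimately show ?thesis unfolding root_vectors_def fifth_roots_def by auto
qed

lemma root_vector_range:
  assumes "x \<in> root_vectors"
  shows "range (($) x) = fifth_roots"
proof (rule card_seteq [OF finite_fifth_roots])
  show "range (($) x) \<subseteq> fifth_roots" using assms unfolding root_vectors_def fifth_roots_def by auto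
  have "card (range (($) x)) = 5" using assms unfolding root_vectors_def by (simp add: card_image)
  then show "card fifth_roots \<le> card (range (($) x))" by (simp add: card_fifth_roots)
qed

lemma root_vector_bij:
  assumes "x \<in> root_vectors"
  shows "bij_betw (($) x) UNIV fifth_roots"
  using assms root_vector_range unfolding bij_betw_def root_vectors_def by auto

lemma permute_coords_nth [simp]: "permute_coords \<sigma> x $ i = x $ \<sigma> i"
  by (simp add: permute_coords_def)

lemma permute_coords_compose: "permute_coords \<sigma> (permute_coords \<tau> x) = permute_coords (\<tau> \<circ> \<sigma>) x"
  by (simp add: vec_eq_iff)

lemma permute_coords_id: "permute_coords id x = x" "permute_coords (\<lambda>i. i) x = x"
  by (simp_all add: vec_eq_iff)

lemma permute_coords_smult: "permute_coords \<sigma> (c *s x) = c *s permute_coords \<sigma> x"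
  by (simp add: vec_eq_iff)

lemma permute_coords_proj: "permute_coords \<sigma> ` proj x = proj (permute_coords \<sigma> x)"
  unfolding proj_def by (auto simp: permute_coords_smult image_iff) (metis permute_coords_smult)

lemma permute_root_vector:
  assumes "x \<in> root_vectors" "bij \<sigma>"
  shows "permute_coords \<sigma> x \<in> root_vectors"
proof -
  have "inj (($) (permute_coords \<sigma> x))"
    using assms unfolding root_vectors_def bij_def inj_def by simp
  then show ?thesis using assms unfolding root_vectors_def by simp
qed

text \<open>The coordinates of a root vector are a bijection from the indices to the fifth roots of unity.\<close>

lemma root_vectors_permute:
  assumes "x \<in> root_vectors" "y \<in> root_vectors"
  obtains \<sigma> where "bij \<sigma>" "y = permute_coords \<sigma> x"
proof -
  have bx: "bij_betw (($) x) UNIV fifth_roots" and bb: "bij_betw (($) y) UNIV fifth_roots"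
    using assms root_vector_bij by auto
  define \<sigma> where "\<sigma> = inv_into UNIV (($) x) \<circ> ($) y"
  have "bij \<sigma>" unfolding \<sigma>_def
    by (rule bij_betw_trans [OF bb bij_betw_inv_into [OF bx]])
  moreover have "x $ \<sigma> i = y $ i" for i
    unfolding \<sigma>_def comp_def
    by (rule f_inv_into_f) (use root_vector_range assms in auto)
  then have "y = permute_coords \<sigma> x" by (simp add: vec_eq_iff)
  ultimately show thesis by (rule that)
qed

lemma root_vector_smult:
  assumes "x \<in> root_vectors" "c^5 = 1"
  shows "c *s x \<in> root_vectors"
proof -
  have "c \<noteq> 0" using assms(2) by auto
  then show ?thesis using assms unfolding root_vectors_def by (auto simp: inj_def power_mult_distrib)
qed

lemma root_vector_nz:
  assumes "x \<in> root_vectors"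
  shows "x $ i \<noteq> 0" "x \<noteq> 0"
proof -
  have "(x $ i)^5 = 1" for i using assms unfolding root_vectors_def by auto
  then show "x $ i \<noteq> 0" for i by (metis power_zero_numeral zero_neq_one)
  then show "x \<noteq> 0" by (metis zero_index)
qed

section \<open>The permutation action\<close>

lemma bring_cone_permute:
  assumes "bij \<sigma>"
  shows "permute_coords \<sigma> x \<in> bring_cone \<longleftrightarrow> x \<in> bring_cone"
proof -
  have "(\<Sum>i\<in>UNIV. f (x $ \<sigma> i)) = (\<Sum>i\<in>UNIV. f (x $ i))" for f :: "complex \<Rightarrow> complex"
    using sum.reindex_bij_betw [of \<sigma> UNIV UNIV "\<lambda>i. f (x $ i)"] assms by simp
  from this [of "\<lambda>z. z"] this [of "\<lambda>z. z^2"] this [of "\<lambda>z. z^3"]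
  show ?thesis unfolding bring_cone_def by simp
qed

lemma zeta_vector_cone: "zeta_vector \<in> bring_cone"
proof -
  have five: "{..<5} = {0, 1, 2, 3, 4::nat}" by auto
  have "(\<Sum>i\<in>UNIV. (zeta_vector $ i)^m) = (\<Sum>k<5. \<zeta>^(m * k))" for m
    unfolding sum_UNIV_5 zeta_vector_def vector_5 five
    by (simp add: power_mult mult.commute [of m] del: One_nat_def)
  from this [of 1] this [of 2] this [of 3] show ?thesis
    unfolding bring_cone_def zeta_power_sum by simp
qed

lemma root_vector_cone: "x \<in> root_vectors \<Longrightarrow> x \<in> bring_cone"
  by (metis root_vectors_permute zeta_vector_root zeta_vector_cone bring_cone_permute)

lemma smult_bring_cone: "c \<noteq> 0 \<Longrightarrow> c *s x \<in> bring_cone \<longleftrightarrow> x \<in> bring_cone"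
  unfolding bring_cone_def by (simp add: power_mult_distrib flip: sum_distrib_left)

lemma proj_in_bring_iff: "proj x \<in> bring \<longleftrightarrow> x \<noteq> 0 \<and> x \<in> bring_cone"
proof
  assume "proj x \<in> bring"
  then obtain y where y: "proj y = proj x" "y \<noteq> 0" "y \<in> bring_cone" unfolding bring_def by auto
  then obtain c where "c \<noteq> 0" "x = c *s y" using proj_eq_iff by metis
  then show "x \<noteq> 0 \<and> x \<in> bring_cone" using y by (auto simp: smult_bring_cone)
qed (auto simp: bring_def)

lemma bringE:
  assumes "P \<in> bring"
  obtains x where "P = proj x" "x \<noteq> 0" "x \<in> bring_cone"
  using assms unfolding bring_def by blast

definition act :: "(5 \<Rightarrow> 5) \<Rightarrow> (complex^5) set \<Rightarrow> (complex^5) set" where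
  "act \<sigma> = (\<lambda>P\<in>bring. permute_coords \<sigma> ` P)"

lemma act_proj: "proj x \<in> bring \<Longrightarrow> act \<sigma> (proj x) = proj (permute_coords \<sigma> x)"
  by (simp add: act_def permute_coords_proj)

lemma bij_inv_compose:
  assumes "bij \<sigma>"
  shows "bij (inv_into UNIV \<sigma>)" "\<sigma> \<circ> inv_into UNIV \<sigma> = id" "inv_into UNIV \<sigma> \<circ> \<sigma> = id"
  using assms by (auto simp: bij_imp_bij_inv bij_is_surj bij_is_inj surj_iff [symmetric] fun_eq_iff surj_f_inv_f)

lemma permute_coords_bring:
  assumes "bij \<sigma>" "proj x \<in> bring"
  shows "proj (permute_coords \<sigma> x) \<in> bring"
proof -
  have "permute_coords (inv_into UNIV \<sigma>) (permute_coords \<sigma> x) = x"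
    using assms(1) by (simp add: permute_coords_compose bij_inv_compose permute_coords_id)
  moreover have "permute_coords \<tau> 0 = 0" for \<tau> by (simp add: vec_eq_iff)
  ultimately have "permute_coords \<sigma> x \<noteq> 0" using assms(2) by (auto simp: proj_in_bring_iff)
  then show ?thesis using assms by (simp add: proj_in_bring_iff bring_cone_permute)
qed

lemma act_compose:
  assumes "bij \<sigma>" "bij \<tau>"
  shows "compose bring (act \<sigma>) (act \<tau>) = act (\<tau> \<circ> \<sigma>)"
proof
  fix P
  show "compose bring (act \<sigma>) (act \<tau>) P = act (\<tau> \<circ> \<sigma>) P"
  proof (cases "P \<in> bring")
    case True
    then obtain x where x: "P = proj x" by (rule bringE)
    show ?thesis using True assms unfolding x
      by (simp add: compose_eq act_proj permute_coords_bring permute_coords_compose)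
  next
    case False
    then show ?thesis by (simp add: act_def compose_def)
  qed
qed

lemma act_id: "act id = (\<lambda>P\<in>bring. P)"
proof
  fix P
  show "act id P = (\<lambda>P\<in>bring. P) P"
    using permute_coords_id(1) by (auto simp: act_def image_def)
qed

lemma act_Bij:
  assumes "bij \<sigma>"
  shows "act \<sigma> \<in> Bij bring"
proof -
  have into: "act \<sigma> P \<in> bring" if "bij \<sigma>" and "P \<in> bring" for \<sigma> P
  proof -
    obtain x where "P = proj x" using \<open>P \<in> bring\<close> by (rule bringE)
    then show ?thesis using that by (simp add: act_proj permute_coords_bring)
  qed
  have canc: "act \<sigma> (act \<tau> P) = P" if "bij \<sigma>" "bij \<tau>" "\<tau> \<circ> \<sigma> = id" "P \<in> bring" for \<sigma> \<tau> P
    using fun_cong [OF act_compose [of \<sigma> \<tau>], of P] that by (simp add: act_id compose_eq)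
  have "bij_betw (act \<sigma>) bring bring"
    by (rule bij_betwI [where g = "act (inv_into UNIV \<sigma>)"])
       (use assms bij_inv_compose [OF assms] in \<open>simp_all add: into canc\<close>)
  then show ?thesis unfolding Bij_def by (simp add: act_def)
qed

lemma carrier_bring_aut: "carrier bring_aut = act ` {\<sigma>. bij \<sigma>}"
  unfolding bring_aut_def act_def by auto

lemma mult_bring_aut:
  assumes "bij \<sigma>" "bij \<tau>"
  shows "act \<sigma> \<otimes>\<^bsub>bring_aut\<^esub> act \<tau> = act (\<tau> \<circ> \<sigma>)"
  using assms by (simp add: bring_aut_def BijGroup_def act_Bij act_compose)

lemma one_bring_aut: "\<one>\<^bsub>bring_aut\<^esub> = act id"
  by (simp add: bring_aut_def BijGroup_def act_id)

lemma bring_aut_subgroup: "subgroup (act ` {\<sigma>. bij \<sigma>}) (BijGroup bring)"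
proof (rule group.subgroupI [OF group_BijGroup])
  show "act ` {\<sigma>. bij \<sigma>} \<subseteq> carrier (BijGroup bring)" by (auto simp: BijGroup_def act_Bij)
  show "act ` {\<sigma>. bij \<sigma>} \<noteq> {}" using bij_id by blast
next
  fix f g assume "f \<in> act ` {\<sigma>. bij \<sigma>}" "g \<in> act ` {\<sigma>. bij \<sigma>}"
  then obtain \<sigma> \<tau> where "bij \<sigma>" "bij \<tau>" "f = act \<sigma>" "g = act \<tau>" by blast
  then show "f \<otimes>\<^bsub>BijGroup bring\<^esub> g \<in> act ` {\<sigma>. bij \<sigma>}"
    by (auto simp: BijGroup_def act_Bij act_compose bij_comp)
next
  fix f assume "f \<in> act ` {\<sigma>. bij \<sigma>}"
  then obtain \<sigma> where \<sigma>: "bij \<sigma>" "f = act \<sigma>" by blast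
  have "act (inv_into UNIV \<sigma>) \<otimes>\<^bsub>BijGroup bring\<^esub> act \<sigma> = \<one>\<^bsub>BijGroup bring\<^esub>"
    using \<sigma>(1) by (simp add: BijGroup_def act_Bij act_compose bij_inv_compose act_id)
  then have "inv\<^bsub>BijGroup bring\<^esub> f = act (inv_into UNIV \<sigma>)"
    unfolding \<sigma>(2) using \<sigma>(1)
    by (intro group.inv_equality [OF group_BijGroup]) (auto simp: BijGroup_def act_Bij bij_imp_bij_inv)
  then show "inv\<^bsub>BijGroup bring\<^esub> f \<in> act ` {\<sigma>. bij \<sigma>}" using \<sigma>(1) bij_imp_bij_inv by blast
qed

lemma bring_aut_eq: "bring_aut = (BijGroup bring)\<lparr>carrier := act ` {\<sigma>. bij \<sigma>}\<rparr>"
  unfolding bring_aut_def act_def by (rule arg_cong [where f = "\<lambda>C. (BijGroup bring)\<lparr>carrier := C\<rparr>"]) auto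

lemma group_bring_aut: "group bring_aut"
  unfolding bring_aut_eq by (rule subgroup.subgroup_is_group [OF bring_aut_subgroup group_BijGroup])

lemma group_action_bring: "group_action bring_aut bring (\<lambda>g. g)"
proof -
  have "(\<lambda>g. g) \<in> hom bring_aut (BijGroup bring)"
    using act_Bij by (auto simp: hom_def carrier_bring_aut BijGroup_def) (simp add: bring_aut_def BijGroup_def)
  then show ?thesis
    unfolding group_action_def group_hom_def group_hom_axioms_def
    using group_bring_aut group_BijGroup by blast
qed

section \<open>Faithfulness, and the orbit of size 24\<close>

lemma proj_permute_root_vectorD:
  assumes "proj (permute_coords \<sigma> x) = proj x"
  obtains c where "c \<noteq> 0" "\<And>i. x $ \<sigma> i = c * x $ i"
proof -
  obtain c where "c \<noteq> 0" "permute_coords \<sigma> x = c *s x"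
    using assms proj_eq_iff [of x "permute_coords \<sigma> x"] by auto
  then show thesis by (intro that [of c]) (auto simp: vec_eq_iff)
qed

text \<open>If \<open>\<sigma> \<noteq> id\<close> fixes the point of a root vector \<open>x\<close>, it multiplies \<open>x\<close> by some \<open>c \<noteq> 1\<close>. Exchanging
  the values of \<open>x\<close> at two indices on the same cycle of \<open>\<sigma>\<close> changes the ratio at one index but not at
  another, so the exchanged vector is not scaled by \<open>\<sigma>\<close>.\<close>

lemma fixes_root_vectors_imp_id:
  assumes fixed: "\<And>x. x \<in> root_vectors \<Longrightarrow> proj (permute_coords \<sigma> x) = proj x"
  shows "\<sigma> = id"
proof (rule ccontr)
  assume "\<sigma> \<noteq> id"
  then obtain i where i: "\<sigma> i \<noteq> i" by (auto simp: fun_eq_iff)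
  define x where "x = zeta_vector"
  have x: "x \<in> root_vectors" by (simp add: x_def zeta_vector_root)
  obtain c where c: "c \<noteq> 0" "\<And>i. x $ \<sigma> i = c * x $ i"
    using fixed [OF x] by (rule proj_permute_root_vectorD) blast
  have inj: "x $ k = x $ l \<longleftrightarrow> k = l" for k l using x unfolding root_vectors_def inj_def by auto
  have nz: "x $ k \<noteq> 0" for k using x by (rule root_vector_nz)
  have c1: "c \<noteq> 1" using i c(2) [of i] inj by auto
  have "(x $ k)^5 = 1" for k using x unfolding root_vectors_def by auto
  from this [of i] this [of "\<sigma> i"] have "(c * x $ i)^5 = 1" "(x $ i)^5 = 1" by (simp_all add: c(2))
  then have c5: "c^5 = 1" by (simp add: power_mult_distrib)
  \<comment> \<open>Two further indices on the cycle of \<open>i\<close>; they differ because \<open>c\<^sup>2 \<noteq> 1\<close>.\<close>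
  define u w where "u = \<sigma> i" and "w = \<sigma> u"
  have xu: "x $ u = c * x $ i" and xw: "x $ w = c^2 * x $ i"
    unfolding u_def w_def c(2) by (simp_all add: power2_eq_square)
  have "c^2 \<noteq> 1"
  proof
    assume "c^2 = 1"
    moreover have "c^5 = (c^2)^2 * c" by (simp add: eval_nat_numeral)
    ultimately show False using c5 c1 by simp
  qed
  then have wi: "w \<noteq> i" using xw nz [of i] by auto
  have wu: "w \<noteq> u" using xw xu nz [of i] c c1 by (auto simp: power2_eq_square)
  have ui: "u \<noteq> i" using i u_def by simp
  have "card {i, u, w} \<le> 3" by (simp add: card_insert_if)
  then have "card {i, u, w} < card (UNIV :: 5 set)" by simp
  then obtain k where k: "k \<notin> {i, u, w}" by (metis UNIV_eq_I less_irrefl)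
  define y where "y = permute_coords (Transposition.transpose u w) x"
  have "y \<in> root_vectors" unfolding y_def by (intro permute_root_vector x) simp
  then obtain d where d: "\<And>i. y $ \<sigma> i = d * y $ i"
    using fixed proj_permute_root_vectorD by metis
  have inj\<sigma>: "\<sigma> k = \<sigma> l \<longleftrightarrow> k = l" for k l
    using c(2) [of k] c(2) [of l] c(1) inj by (metis mult_cancel_left)
  have "\<sigma> k \<noteq> u" "\<sigma> k \<noteq> w" using k inj\<sigma> unfolding u_def w_def by auto
  then have "c * x $ k = d * x $ k"
    using d [of k] c(2) [of k] k unfolding y_def by (simp add: transpose_apply_other)
  then have "c = d" using nz by simp
  moreover have "x $ w = d * x $ i"
    using d [of i] ui wi unfolding y_def u_def [symmetric] by (simp add: transpose_apply_other)
  ultimately show False using xw c c1 nz [of i] by (simp add: power2_eq_square)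
qed

lemma inj_act: "inj_on act {\<sigma>. bij \<sigma>}"
proof (rule inj_onI)
  fix \<sigma> \<tau> :: "5 \<Rightarrow> 5" assume "\<sigma> \<in> {\<sigma>. bij \<sigma>}" "\<tau> \<in> {\<sigma>. bij \<sigma>}" and eq: "act \<sigma> = act \<tau>"
  then have b: "bij \<sigma>" "bij \<tau>" by auto
  let ?\<rho> = "inv_into UNIV \<tau> \<circ> \<sigma>"
  have "proj (permute_coords ?\<rho> x) = proj x" if "x \<in> root_vectors" for x
  proof -
    let ?y = "permute_coords (inv_into UNIV \<tau>) x"
    have y: "proj ?y \<in> bring"
      using that b by (simp add: proj_in_bring_iff root_vector_cone permute_root_vector bij_inv_compose root_vector_nz)
    have "proj (permute_coords ?\<rho> x) = act \<sigma> (proj ?y)" by (simp add: act_proj y permute_coords_compose)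
    also have "\<dots> = proj (permute_coords \<tau> ?y)" using eq by (simp add: act_proj y)
    also have "permute_coords \<tau> ?y = x"
      using b by (simp add: permute_coords_compose bij_inv_compose permute_coords_id)
    finally show ?thesis .
  qed
  then have "?\<rho> = id" by (rule fixes_root_vectors_imp_id)
  then have "\<tau> \<circ> ?\<rho> = \<tau>" by simp
  then show "\<sigma> = \<tau>" using b by (simp add: comp_assoc [symmetric] bij_inv_compose)
qed

lemma permutes_UNIV_iff_bij: "\<sigma> permutes UNIV \<longleftrightarrow> bij \<sigma>"
  by (auto simp: permutes_bij intro: bij_imp_permutes)

lemma order_bring_aut: "order bring_aut = 120"
proof -
  have "card {\<sigma> :: 5 \<Rightarrow> 5. bij \<sigma>} = fact 5"
    using card_permutations [of "UNIV :: 5 set" 5] by (simp add: permutes_UNIV_iff_bij)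
  also have "\<dots> = 120" by (simp add: eval_nat_numeral fact_Suc)
  finally show ?thesis by (simp add: order_def carrier_bring_aut card_image inj_act)
qed

lemma orbit_bring: "P \<in> bring \<Longrightarrow> orbit bring_aut (\<lambda>g. g) P = {act \<sigma> P | \<sigma>. bij \<sigma>}"
  unfolding orbit_def carrier_bring_aut by auto

definition zeta_orbit :: "(complex^5) set set" where
  "zeta_orbit = proj ` root_vectors"

lemma zeta_orbit_subset: "zeta_orbit \<subseteq> bring"
  by (auto simp: zeta_orbit_def proj_in_bring_iff root_vector_cone root_vector_nz)

lemma zeta_orbit_permutations: "zeta_orbit = {proj (permute_coords \<sigma> zeta_vector) | \<sigma>. bij \<sigma>}"
  unfolding zeta_orbit_def
  using permute_root_vector zeta_vector_root root_vectors_permute [OF zeta_vector_root] by (auto; metis)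

lemma zeta_orbit_is_orbit:
  assumes "P \<in> zeta_orbit"
  shows "orbit bring_aut (\<lambda>g. g) P = zeta_orbit"
proof -
  obtain x where x: "P = proj x" "x \<in> root_vectors" using assms unfolding zeta_orbit_def by blast
  have P: "P \<in> bring" using assms zeta_orbit_subset by blast
  have "{proj (permute_coords \<sigma> x) | \<sigma>. bij \<sigma>} = zeta_orbit"
    unfolding zeta_orbit_def using x(2) permute_root_vector root_vectors_permute [OF x(2)] by (auto; metis)
  moreover have "orbit bring_aut (\<lambda>g. g) P = {proj (permute_coords \<sigma> x) | \<sigma>. bij \<sigma>}"
    using P unfolding orbit_bring [OF P] unfolding x(1) by (simp add: act_proj)
  ultimately show ?thesis by simp
qed

text \<open>Each point has exactly one representative with first coordinate \<open>1\<close> among the root vectors, so the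
  points correspond to the permutations of the other four indices.\<close>

lemma card_zeta_orbit: "card zeta_orbit = 24"
proof -
  define S where "S = {\<sigma> :: 5 \<Rightarrow> 5. \<sigma> permutes (UNIV - {1})}"
  let ?f = "\<lambda>\<sigma>. proj (permute_coords \<sigma> zeta_vector)"
  have z1: "zeta_vector $ 1 = 1" by (simp add: zeta_vector_def vector_5)
  have inj: "zeta_vector $ k = zeta_vector $ l \<longleftrightarrow> k = l" for k l
    using zeta_vector_root unfolding root_vectors_def inj_def by auto
  have S1: "\<sigma> 1 = 1" "bij \<sigma>" if "\<sigma> \<in> S" for \<sigma>
  proof -
    have "\<sigma> permutes (UNIV - {1})" using that unfolding S_def by simp
    then show "\<sigma> 1 = 1" "bij \<sigma>" using permutes_not_in [of \<sigma> "UNIV - {1}" 1] permutes_bij by auto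
  qed
  have "inj_on ?f S"
  proof (rule inj_onI)
    fix \<sigma> \<tau> assume st: "\<sigma> \<in> S" "\<tau> \<in> S" and eq: "?f \<sigma> = ?f \<tau>"
    obtain c where c: "permute_coords \<tau> zeta_vector = c *s permute_coords \<sigma> zeta_vector"
      using eq proj_eq_iff by metis
    have "c = 1" using arg_cong [OF c, of "\<lambda>v. v $ 1"] S1(1) [OF st(1)] S1(1) [OF st(2)] z1 by simp
    then have "zeta_vector $ \<tau> i = zeta_vector $ \<sigma> i" for i
      using arg_cong [OF c, of "\<lambda>v. v $ i"] by simp
    then show "\<sigma> = \<tau>" using inj by auto
  qed
  moreover have "?f ` S = zeta_orbit"
  proof (intro equalityI subsetI)
    fix P assume "P \<in> ?f ` S"
    then show "P \<in> zeta_orbit" unfolding zeta_orbit_permutations using S1 by blast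
  next
    fix P assume "P \<in> zeta_orbit"
    then obtain x where x: "P = proj x" "x \<in> root_vectors" unfolding zeta_orbit_def by blast
    define y where "y = (1 / x $ 1) *s x"
    have "(x $ 1)^5 = 1" using x(2) unfolding root_vectors_def by auto
    then have y: "y \<in> root_vectors" unfolding y_def by (intro root_vector_smult x) (simp add: power_divide)
    have Py: "P = proj y"
      unfolding y_def x(1) using root_vector_nz [OF x(2)] by (intro proj_smult [symmetric]) simp
    obtain \<sigma> where \<sigma>: "bij \<sigma>" "y = permute_coords \<sigma> zeta_vector"
      using root_vectors_permute [OF zeta_vector_root y] by blast
    have "y $ 1 = 1" unfolding y_def using root_vector_nz [OF x(2)] by simp
    then have "\<sigma> 1 = 1" using inj [of "\<sigma> 1" 1] by (simp add: \<sigma>(2) z1)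
    then have "\<sigma> \<in> S" unfolding S_def using \<sigma>(1)
      by (auto intro: permutes_superset [of _ UNIV] simp: permutes_UNIV_iff_bij)
    then show "P \<in> ?f ` S" using Py \<sigma> by blast
  qed
  ultimately have "card zeta_orbit = card S" by (metis card_image)
  also have "card S = fact 4"
    unfolding S_def by (rule card_permutations) (simp_all add: card_Diff_singleton)
  finally show ?thesis by (simp add: eval_nat_numeral fact_Suc)
qed

text \<open>A permutation of order five is a five-cycle, so a vector that it scales has the entries
  \<open>c, \<alpha>c, \<dots>, \<alpha>\<^sup>4c\<close> with \<open>\<alpha>\<^sup>5 = 1\<close>, and \<open>\<alpha> \<noteq> 1\<close> because the entries sum to zero.\<close>

lemma five_cycle_fixed_point:
  assumes \<sigma>5: "\<sigma> ^^ 5 = id" and "\<sigma> \<noteq> id" and P: "proj x \<in> bring" and fixed: "proj (permute_coords \<sigma> x) = proj x"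
  shows "proj x \<in> zeta_orbit"
proof -
  obtain i where i: "\<sigma> i \<noteq> i" using assms(2) by (auto simp: fun_eq_iff)
  have s5: "\<sigma> (\<sigma> (\<sigma> (\<sigma> (\<sigma> j)))) = j" for j
    using fun_cong [OF \<sigma>5, of j] by (simp add: eval_nat_numeral)
  obtain c where c: "c \<noteq> 0" "\<And>i. x $ \<sigma> i = c * x $ i"
    using fixed by (rule proj_permute_root_vectorD) blast
  define f where "f n = (\<sigma> ^^ n) i" for n
  have f_inj: "f m \<noteq> f n" if "m < n" "n < 5" for m n
  proof
    assume eq: "f m = f n"
    have "(\<sigma> ^^ (5 - m + m)) i = (\<sigma> ^^ (5 - m + n)) i"
      using eq unfolding f_def funpow_add by simp
    moreover have "5 - m + m = 5" "5 - m + n = (n - m) + 5" using that by linarith+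
    ultimately have "(\<sigma> ^^ 5) i = (\<sigma> ^^ ((n - m) + 5)) i" by metis
    then have "i = (\<sigma> ^^ (n - m)) i" unfolding funpow_add \<sigma>5 by simp
    moreover have "n - m \<in> {1, 2, 3, 4}" using that by auto
    ultimately show False using i s5 [of i] by (auto simp: eval_nat_numeral)
  qed
  then have finj: "inj_on f {..<5}" by (auto simp: inj_on_def) (metis linorder_neqE_nat)
  then have "card (f ` {..<5}) = 5" by (simp add: card_image)
  then have surj: "f ` {..<5} = UNIV" by (intro card_subset_eq) auto
  have xf: "x $ f n = c^n * x $ i" for n
    unfolding f_def by (induction n) (simp_all add: c(2))
  have xi: "x $ i \<noteq> 0"
  proof
    assume "x $ i = 0"
    then have "x $ f n = 0" for n by (simp add: xf)
    then have "x = 0" using surj by (metis (no_types, lifting) UNIV_I image_iff vec_eq_iff zero_index)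
    then show False using P by (simp add: proj_in_bring_iff)
  qed
  have "f 5 = i" unfolding f_def \<sigma>5 by simp
  then have c5: "c^5 = 1" using xf [of 5] xi by simp
  have "(\<Sum>j\<in>UNIV. x $ j) = 0" using P by (auto simp: proj_in_bring_iff bring_cone_def)
  moreover have "(\<Sum>j\<in>UNIV. x $ j) = (\<Sum>n<5. x $ f n)"
    using sum.reindex [OF finj, of "($) x"] surj by simp
  ultimately have "(\<Sum>n<5. c^n * x $ i) = 0" by (simp add: xf)
  then have "c \<noteq> 1" using xi by auto
  obtain m where m: "m < 5" "c = \<zeta>^m" using c5 by (rule fifth_rootE)
  have m0: "\<not> 5 dvd m" using \<open>c \<noteq> 1\<close> m zeta_power_eq_1_iff by auto
  define y where "y = (1 / x $ i) *s x"
  have yf: "y $ f n = \<zeta>^(m * n)" for n using xi by (simp add: y_def xf m power_mult)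
  have ne: "\<zeta>^(m * k) \<noteq> \<zeta>^(m * l)" if "k < l" "l < 5" for k l
  proof
    assume "\<zeta>^(m * k) = \<zeta>^(m * l)"
    moreover have "\<zeta>^(m * l) = \<zeta>^(m * k) * \<zeta>^(m * (l - k))"
      using that by (simp flip: power_add distrib_left)
    ultimately have "\<zeta>^(m * (l - k)) = 1" by simp
    then have "5 dvd m * (l - k)" by (simp add: zeta_power_eq_1_iff)
    moreover have "prime (5::nat)" by simp
    ultimately have "5 dvd l - k" using m0 by (simp add: prime_dvd_mult_iff)
    then show False using that by (auto dest: dvd_imp_le)
  qed
  have "y \<in> root_vectors"
    unfolding root_vectors_def
  proof (intro CollectI conjI allI injI)
    fix j
    obtain n where "j = f n" using surj by blast
    then show "(y $ j)^5 = 1"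
      by (simp add: yf power_mult [symmetric] mult.commute [of _ 5]) (simp add: power_mult zeta_pow5)
  next
    fix j k assume "y $ j = y $ k"
    moreover obtain n l where "j = f n" "k = f l" "n < 5" "l < 5" using surj by (metis UNIV_I image_iff lessThan_iff)
    ultimately show "j = k" using ne [of n l] ne [of l n] by (auto simp: yf) (metis linorder_neqE_nat)
  qed
  moreover have "proj y = proj x" unfolding y_def using xi by (intro proj_smult) simp
  ultimately show ?thesis unfolding zeta_orbit_def by (metis imageI)
qed

lemma act_pow:
  assumes "bij \<sigma>"
  shows "act \<sigma> [^]\<^bsub>bring_aut\<^esub> (n::nat) = act (\<sigma> ^^ n)"
proof (induction n)
  case 0
  then show ?case by (simp add: one_bring_aut id_def)
next
  case (Suc n)
  then show ?case using assms
    by (simp add: mult_bring_aut bij_fn del: funpow.simps) (simp add: funpow_add comp_def)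
qed

lemma order_5_fixed_point:
  assumes "g \<in> carrier bring_aut" "group.ord bring_aut g = 5" "P \<in> bring" "g P = P"
  shows "P \<in> zeta_orbit"
proof -
  interpret group bring_aut by (rule group_bring_aut)
  obtain \<sigma> where \<sigma>: "bij \<sigma>" "g = act \<sigma>" using assms(1) unfolding carrier_bring_aut by blast
  obtain x where x: "P = proj x" using assms(3) by (rule bringE)
  have "g [^]\<^bsub>bring_aut\<^esub> (5::nat) = \<one>\<^bsub>bring_aut\<^esub>" using assms(1,2) pow_eq_id by simp
  then have "act (\<sigma> ^^ 5) = act id" using \<sigma> by (simp add: act_pow one_bring_aut)
  then have "\<sigma> ^^ 5 = id" using inj_act \<sigma> by (auto simp: inj_on_def bij_fn)
  moreover have "\<sigma> \<noteq> id" using assms(1,2) \<sigma>(2) ord_eq_1 [of g] by (auto simp: one_bring_aut)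
  ultimately show ?thesis
    using assms(3,4) five_cycle_fixed_point [of \<sigma> x] unfolding x \<sigma>(2) by (simp add: act_proj)
qed

text \<open>Multiplication by \<open>\<zeta>\<close> permutes the coordinates of a root vector cyclically.\<close>

lemma zeta_orbit_fixed:
  assumes "P \<in> zeta_orbit"
  shows "\<exists>g\<in>carrier bring_aut. group.ord bring_aut g = 5 \<and> g P = P"
proof -
  interpret group bring_aut by (rule group_bring_aut)
  obtain x where x: "P = proj x" "x \<in> root_vectors" using assms unfolding zeta_orbit_def by blast
  have P: "P \<in> bring" using assms zeta_orbit_subset by blast
  have "\<zeta> *s x \<in> root_vectors" using x(2) by (intro root_vector_smult) (simp_all add: zeta_pow5)
  then obtain \<sigma> where \<sigma>: "bij \<sigma>" "\<zeta> *s x = permute_coords \<sigma> x"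
    using root_vectors_permute [OF x(2)] by blast
  have x\<sigma>: "x $ \<sigma> i = \<zeta> * x $ i" for i using arg_cong [OF \<sigma>(2), of "\<lambda>v. v $ i"] by simp
  have "x $ (\<sigma> ^^ n) i = \<zeta>^n * x $ i" for n i by (induction n) (simp_all add: x\<sigma>)
  then have "x $ (\<sigma> ^^ 5) i = x $ i" for i by (simp add: zeta_pow5)
  then have "\<sigma> ^^ 5 = id" using x(2) unfolding root_vectors_def inj_def by (auto simp: fun_eq_iff)
  then have "act \<sigma> [^]\<^bsub>bring_aut\<^esub> (5::nat) = \<one>\<^bsub>bring_aut\<^esub>" using \<sigma>(1) by (simp add: act_pow one_bring_aut)
  moreover have g: "act \<sigma> \<in> carrier bring_aut" using \<sigma>(1) by (auto simp: carrier_bring_aut)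
  ultimately have "ord (act \<sigma>) dvd 5" by (simp add: pow_eq_id)
  moreover have "\<sigma> \<noteq> id"
    using x\<sigma> [of 1] zeta_ne_1 root_vector_nz(1) [OF x(2), of 1] by auto
  then have "act \<sigma> \<noteq> \<one>\<^bsub>bring_aut\<^esub>" using inj_act \<sigma>(1) by (auto simp: inj_on_def one_bring_aut)
  then have "ord (act \<sigma>) \<noteq> 1" using ord_eq_1 g by simp
  moreover have "prime (5::nat)" by simp
  ultimately have "ord (act \<sigma>) = 5" by (metis prime_nat_iff)
  moreover have "act \<sigma> P = P"
    using P unfolding x(1) by (simp add: act_proj \<sigma>(2) [symmetric] proj_smult)
  ultimately show ?thesis using g by blast
qed

text \<open>The stabilizer of a point of such an orbit has order \<open>120 / 24 = 5\<close>, so it contains an element of order 5.\<close>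

lemma orbit_card_24:
  assumes "S \<in> orbits bring_aut bring (\<lambda>g. g)" "card S = 24"
  shows "S = zeta_orbit"
proof -
  interpret group bring_aut by (rule group_bring_aut)
  interpret group_action bring_aut bring "\<lambda>g. g" by (rule group_action_bring)
  obtain P where P: "P \<in> bring" "S = orbit bring_aut (\<lambda>g. g) P" using assms(1) unfolding orbits_def by blast
  define H where "H = stabilizer bring_aut (\<lambda>g. g) P"
  have "24 * card H = 120"
    using orbit_stabilizer_theorem [OF P(1)] assms(2) P(2) order_bring_aut unfolding H_def by simp
  then have H5: "card H = 5" by simp
  have sub: "subgroup H bring_aut" unfolding H_def using P(1) by (rule stabilizer_subgroup)
  interpret H: group "bring_aut\<lparr>carrier := H\<rparr>" using sub group_bring_aut by (rule subgroup.subgroup_is_group)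
  have "finite H" using H5 by (metis card.infinite zero_neq_numeral)
  have "\<not> H \<subseteq> {\<one>\<^bsub>bring_aut\<^esub>}" using H5 card_mono [of "{\<one>\<^bsub>bring_aut\<^esub>}" H] by auto
  then obtain g where g: "g \<in> H" "g \<noteq> \<one>\<^bsub>bring_aut\<^esub>" by blast
  have gc: "g \<in> carrier bring_aut" using g(1) sub subgroup.subset by blast
  have "g [^]\<^bsub>bring_aut\<lparr>carrier := H\<rparr>\<^esub> order (bring_aut\<lparr>carrier := H\<rparr>) = \<one>\<^bsub>bring_aut\<lparr>carrier := H\<rparr>\<^esub>"
    using g(1) by (intro H.pow_order_eq_1) simp
  then have "g [^]\<^bsub>bring_aut\<^esub> (5::nat) = \<one>\<^bsub>bring_aut\<^esub>"
    using H5 by (simp add: order_def nat_pow_consistent [symmetric])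
  then have "ord g dvd 5" using gc by (simp add: pow_eq_id)
  moreover have "ord g \<noteq> 1" using ord_eq_1 gc g(2) by simp
  moreover have "prime (5::nat)" by simp
  ultimately have "ord g = 5" by (metis prime_nat_iff)
  moreover have "g P = P" using g(1) unfolding H_def stabilizer_def by simp
  ultimately have "P \<in> zeta_orbit" using order_5_fixed_point gc P(1) by blast
  then show ?thesis using P(2) zeta_orbit_is_orbit by simp
qed

lemma unique_orbit_24: "\<exists>!S. S \<in> orbits bring_aut bring (\<lambda>g. g) \<and> card S = 24"
  and face_centres_eq: "face_centres = zeta_orbit"
proof -
  have P: "proj zeta_vector \<in> zeta_orbit" unfolding zeta_orbit_def using zeta_vector_root by blast
  then have "zeta_orbit \<in> orbits bring_aut bring (\<lambda>g. g)"
    unfolding orbits_def using zeta_orbit_is_orbit [OF P] zeta_orbit_subset by blast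
  then have *: "S \<in> orbits bring_aut bring (\<lambda>g. g) \<and> card S = 24 \<longleftrightarrow> S = zeta_orbit" for S
    using orbit_card_24 card_zeta_orbit by blast
  then show "\<exists>!S. S \<in> orbits bring_aut bring (\<lambda>g. g) \<and> card S = 24" by blast
  show "face_centres = zeta_orbit" unfolding face_centres_def * by simp
qed

lemma face_centres_fixed_points:
  "face_centres = {P \<in> bring. \<exists>g \<in> carrier bring_aut. group.ord bring_aut g = 5 \<and> g P = P}"
proof (intro equalityI subsetI)
  fix P assume "P \<in> face_centres"
  then show "P \<in> {P \<in> bring. \<exists>g \<in> carrier bring_aut. group.ord bring_aut g = 5 \<and> g P = P}"
    unfolding face_centres_eq using zeta_orbit_fixed zeta_orbit_subset by auto
next
  fix P assume "P \<in> {P \<in> bring. \<exists>g \<in> carrier bring_aut. group.ord bring_aut g = 5 \<and> g P = P}"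
  then obtain g where "P \<in> bring" "g \<in> carrier bring_aut" "group.ord bring_aut g = 5" "g P = P" by auto
  then show "P \<in> face_centres" unfolding face_centres_eq by (intro order_5_fixed_point)
qed

section \<open>Places of a plane curve\<close>

lemma analytic_germ_isCont: "analytic_germ \<gamma> \<Longrightarrow> isCont (\<lambda>t. \<gamma> t $ i) 0"
  unfolding analytic_germ_def by (auto intro: analytic_at_imp_isCont)

text \<open>Equality of projective points is the vanishing of \<open>2 \<times> 2\<close> minors, a closed condition. Hence the value
  at \<open>0\<close> of a germ is determined by its values at nearby points.\<close>

lemma proj_at_0_cong:
  assumes "analytic_germ \<gamma>" "analytic_germ \<delta>"
    and ev: "\<forall>\<^sub>F t in at 0. proj (\<gamma> t) = proj (\<delta> t)"
  shows "proj (\<gamma> 0) = proj (\<delta> 0)"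
proof -
  have minor: "\<gamma> 0 $ i * \<delta> 0 $ j = \<gamma> 0 $ j * \<delta> 0 $ i" for i j
  proof -
    have "\<forall>\<^sub>F t in at 0. \<gamma> t $ i * \<delta> t $ j - \<gamma> t $ j * \<delta> t $ i = 0"
      using ev
    proof eventually_elim
      case (elim t)
      then obtain c where "\<delta> t = c *s \<gamma> t" using proj_eq_iff by metis
      then show ?case by simp
    qed
    then have "((\<lambda>t. \<gamma> t $ i * \<delta> t $ j - \<gamma> t $ j * \<delta> t $ i) \<longlongrightarrow> 0) (at 0)"
      by (rule tendsto_eventually)
    moreover have "isCont (\<lambda>t. \<gamma> t $ i * \<delta> t $ j - \<gamma> t $ j * \<delta> t $ i) 0"
      using assms by (intro continuous_intros analytic_germ_isCont)
    then have "((\<lambda>t. \<gamma> t $ i * \<delta> t $ j - \<gamma> t $ j * \<delta> t $ i) \<longlongrightarrow> \<gamma> 0 $ i * \<delta> 0 $ j - \<gamma> 0 $ j * \<delta> 0 $ i) (at 0)"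
      by (simp add: isCont_def)
    ultimately have "0 = \<gamma> 0 $ i * \<delta> 0 $ j - \<gamma> 0 $ j * \<delta> 0 $ i"
      by (rule tendsto_unique [OF at_neq_bot])
    then show ?thesis by simp
  qed
  have "\<gamma> 0 \<noteq> 0" "\<delta> 0 \<noteq> 0" using assms unfolding analytic_germ_def by auto
  then obtain i k where i: "\<gamma> 0 $ i \<noteq> 0" and k: "\<delta> 0 $ k \<noteq> 0" by (auto simp: vec_eq_iff)
  have di: "\<delta> 0 $ i \<noteq> 0" using minor [of i k] i k by auto
  have "\<delta> 0 = (\<delta> 0 $ i / \<gamma> 0 $ i) *s \<gamma> 0"
    using minor i by (auto simp: vec_eq_iff field_simps)
  then show ?thesis using i di proj_eq_iff by (metis divide_eq_0_iff)
qed

lemma filterlim_analytic_nhds: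
  assumes "u analytic_on {0}" "u 0 = (0::complex)"
  shows "filterlim u (nhds 0) (nhds 0)"
  using analytic_at_imp_isCont [OF assms(1)] assms(2)
  unfolding isCont_def tendsto_at_iff_tendsto_nhds by simp

lemma eventually_analytic_compose:
  assumes "u analytic_on {0}" "u 0 = (0::complex)" "\<forall>\<^sub>F t in nhds 0. P t"
  shows "\<forall>\<^sub>F t in nhds 0. P (u t)"
  using filterlim_analytic_nhds [OF assms(1,2)] assms(3) by (simp add: filterlim_iff)

lemma analytic_compose_at_0:
  assumes "u analytic_on {0}" "u 0 = (0::complex)" "f analytic_on {0}"
  shows "(\<lambda>t. f (u t)) analytic_on {0}"
  using analytic_on_compose [of u "{0}" f] assms by (simp add: comp_def)

lemma analytic_at_0_local_inverse:
  assumes "u analytic_on {0}" "u 0 = (0::complex)" "deriv u 0 \<noteq> 0"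
  obtains v where "v analytic_on {0}" "v 0 = 0" "deriv v 0 \<noteq> 0"
    "\<forall>\<^sub>F t in nhds 0. u (v t) = t" "\<forall>\<^sub>F t in nhds 0. v (u t) = t"
proof -
  obtain S where S: "open S" "0 \<in> S" "u holomorphic_on S" using assms(1) analytic_at by blast
  obtain r where r: "r > 0" "ball 0 r \<subseteq> S" "open (u ` ball 0 r)" "inj_on u (ball 0 r)"
    using has_complex_derivative_locally_invertible [OF S(3) S(2) S(1) assms(3)] by blast
  have hol: "u holomorphic_on ball 0 r" using S(3) r(2) holomorphic_on_subset by blast
  obtain v where v: "v holomorphic_on u ` ball 0 r"
    "\<And>z. z \<in> ball 0 r \<Longrightarrow> deriv u z * deriv v (u z) = 1"
    "\<And>z. z \<in> ball 0 r \<Longrightarrow> v (u z) = z"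
    using holomorphic_has_inverse [OF hol open_ball r(4)] by metis
  have 0: "0 \<in> ball 0 r" "0 \<in> u ` ball 0 r" using r(1) assms(2) by (auto intro: image_eqI [of _ _ 0])
  show thesis
  proof (rule that)
    show "v analytic_on {0}" using v(1) r(3) 0 holomorphic_on_imp_analytic_at by blast
    show "v 0 = 0" using v(3) [of 0] 0 assms(2) by simp
    show "deriv v 0 \<noteq> 0" using v(2) [of 0] 0 assms(2) by auto
    show "\<forall>\<^sub>F t in nhds 0. v (u t) = t"
      using eventually_nhds_in_open [of "ball 0 r" 0] 0(1) by (auto elim: eventually_mono simp: v(3))
    show "\<forall>\<^sub>F t in nhds 0. u (v t) = t"
      using eventually_nhds_in_open [OF r(3) 0(2)] by (rule eventually_mono) (auto simp: v(3))
  qed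
qed

lemma same_place_refl: "same_place \<gamma> \<gamma>"
  unfolding same_place_def by (rule exI [of _ "\<lambda>t. t"]) simp

lemma same_place_sym:
  assumes "same_place \<gamma> \<delta>"
  shows "same_place \<delta> \<gamma>"
proof -
  obtain \<tau> where \<tau>: "\<tau> analytic_on {0}" "\<tau> 0 = 0" "deriv \<tau> 0 \<noteq> 0"
    "\<forall>\<^sub>F t in nhds 0. proj (\<delta> t) = proj (\<gamma> (\<tau> t))"
    using assms unfolding same_place_def by blast
  obtain v where v: "v analytic_on {0}" "v 0 = 0" "deriv v 0 \<noteq> 0" "\<forall>\<^sub>F t in nhds 0. \<tau> (v t) = t"
    using analytic_at_0_local_inverse [OF \<tau>(1-3)] by blast
  have "\<forall>\<^sub>F t in nhds 0. proj (\<gamma> t) = proj (\<delta> (v t))"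
    using v(4) eventually_analytic_compose [OF v(1,2) \<tau>(4)] by eventually_elim simp
  then show ?thesis unfolding same_place_def using v by blast
qed

lemma same_place_trans:
  assumes "same_place \<alpha> \<beta>" "same_place \<beta> \<gamma>"
  shows "same_place \<alpha> \<gamma>"
proof -
  obtain \<tau> where \<tau>: "\<tau> analytic_on {0}" "\<tau> 0 = 0" "deriv \<tau> 0 \<noteq> 0"
    "\<forall>\<^sub>F t in nhds 0. proj (\<beta> t) = proj (\<alpha> (\<tau> t))"
    using assms unfolding same_place_def by blast
  obtain \<rho> where \<rho>: "\<rho> analytic_on {0}" "\<rho> 0 = 0" "deriv \<rho> 0 \<noteq> 0"
    "\<forall>\<^sub>F t in nhds 0. proj (\<gamma> t) = proj (\<beta> (\<rho> t))"
    using assms unfolding same_place_def by blast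
  have "\<forall>\<^sub>F t in nhds 0. proj (\<gamma> t) = proj (\<alpha> (\<tau> (\<rho> t)))"
    using \<rho>(4) eventually_analytic_compose [OF \<rho>(1,2) \<tau>(4)] by eventually_elim simp
  moreover have "deriv (\<lambda>t. \<tau> (\<rho> t)) 0 \<noteq> 0"
    using deriv_chain [of \<rho> 0 \<tau>] \<tau> \<rho> by (auto simp: analytic_on_imp_differentiable_at comp_def)
  moreover have "(\<lambda>t. \<tau> (\<rho> t)) analytic_on {0}" using \<rho>(1,2) \<tau>(1) by (rule analytic_compose_at_0)
  ultimately show ?thesis unfolding same_place_def using \<tau>(2) \<rho>(2)
    by (intro exI [of _ "\<lambda>t. \<tau> (\<rho> t)"]) simp
qed

definition place_of :: "(complex^3 \<Rightarrow> complex) \<Rightarrow> (complex \<Rightarrow> complex^3) \<Rightarrow> (complex \<Rightarrow> complex^3) set" where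
  "place_of F \<gamma> = {\<delta> \<in> branches F. same_place \<gamma> \<delta>}"

lemma place_of_in_places: "\<gamma> \<in> branches F \<Longrightarrow> place_of F \<gamma> \<in> places F"
  unfolding places_def place_of_def quotient_def by auto

lemma places_cases:
  assumes "P \<in> places F"
  obtains \<gamma> where "\<gamma> \<in> branches F" "P = place_of F \<gamma>"
  using assms unfolding places_def place_of_def quotient_def by auto

lemma mem_place_of_self: "\<gamma> \<in> branches F \<Longrightarrow> \<gamma> \<in> place_of F \<gamma>"
  unfolding place_of_def using same_place_refl by blast

lemma place_of_cong: "same_place \<gamma> \<delta> \<Longrightarrow> place_of F \<gamma> = place_of F \<delta>"
  unfolding place_of_def using same_place_sym same_place_trans by blast

lemma place_memD:
  assumes "P \<in> places F" "\<gamma> \<in> P"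
  shows "\<gamma> \<in> branches F" "P = place_of F \<gamma>"
proof -
  obtain \<delta> where "P = place_of F \<delta>" using assms(1) places_cases by metis
  then show "\<gamma> \<in> branches F" "P = place_of F \<gamma>"
    using assms(2) place_of_cong unfolding place_of_def by auto
qed

lemma place_of_in_places_over: "\<gamma> \<in> branches F \<Longrightarrow> place_of F \<gamma> \<in> places_over F (proj (\<gamma> 0))"
  unfolding places_over_def using place_of_in_places mem_place_of_self by blast

text \<open>Injectivity of a branch forces a parameter change into it to be a local coordinate: an
  injective holomorphic function has nonvanishing derivative.\<close>

lemma branch_factor_same_place:
  assumes \<gamma>: "\<gamma> \<in> branches F" and u: "u analytic_on {0}" "u 0 = 0"
    and ev: "\<forall>\<^sub>F t in nhds 0. proj (\<gamma> t) = proj (\<delta> (u t))"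
  shows "same_place \<delta> \<gamma>"
proof -
  obtain r where r: "r > 0" "inj_on (\<lambda>t. proj (\<gamma> t)) (ball 0 r)"
    using \<gamma> unfolding branches_def by blast
  obtain s where s: "s > 0" "\<And>t. t \<in> ball 0 s \<Longrightarrow> proj (\<gamma> t) = proj (\<delta> (u t))"
    using ev unfolding eventually_nhds_metric by (auto simp: dist_commute)
  obtain e where e: "e > 0" "u holomorphic_on ball 0 e" using u(1) analytic_at_ball by blast
  define d where "d = min r (min s e)"
  have d: "d > 0" "ball 0 d \<subseteq> ball 0 r" "ball 0 d \<subseteq> ball 0 s" "ball 0 d \<subseteq> ball (0::complex) e"
    unfolding d_def using r s e by (auto simp: ball_def)
  have "inj_on u (ball 0 d)"
  proof (rule inj_onI)
    fix x y assume xy: "x \<in> ball 0 d" "y \<in> ball 0 d" "u x = u y"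
    have "x \<in> ball 0 s" "y \<in> ball 0 s" using xy d(3) by blast+
    then have "proj (\<gamma> x) = proj (\<gamma> y)" using s(2) xy(3) by metis
    then show "x = y" using inj_onD [OF r(2)] xy d(2) by blast
  qed
  moreover have "u holomorphic_on ball 0 d" using e(2) d(4) holomorphic_on_subset by blast
  ultimately have "deriv u 0 \<noteq> 0" using d(1) by (intro holomorphic_injective_imp_regular [of u "ball 0 d"]) auto
  then show ?thesis unfolding same_place_def using u ev by blast
qed

lemma analytic_zero_order:
  assumes "f analytic_on {0}"
  shows "(\<forall>\<^sub>F t in nhds 0. f t = 0) \<or>
    (\<exists>n g. g analytic_on {0} \<and> g 0 \<noteq> (0::complex) \<and> (\<forall>\<^sub>F t in nhds 0. f t = t^n * g t))"
proof (cases "f 0 = 0")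
  case False
  then show ?thesis using assms by (intro disjI2 exI [of _ 0] exI [of _ f]) simp
next
  case True
  obtain e where e: "e > 0" "f holomorphic_on ball 0 e" using assms analytic_at_ball by blast
  show ?thesis
  proof (cases "f constant_on ball 0 e")
    case True
    then have "f t = 0" if "t \<in> ball 0 e" for t
      using that e(1) \<open>f 0 = 0\<close> unfolding constant_on_def by (metis centre_in_ball)
    moreover have "\<forall>\<^sub>F t in nhds 0. t \<in> ball 0 e"
      using e(1) by (intro eventually_nhds_in_open) auto
    ultimately show ?thesis by (auto elim: eventually_mono)
  next
    case False
    obtain g r n where g: "0 < r" "g holomorphic_on ball 0 r"
      "\<And>w. w \<in> ball 0 r \<Longrightarrow> f w = (w - 0)^n * g w" "\<And>w. w \<in> ball 0 r \<Longrightarrow> g w \<noteq> 0"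
      using holomorphic_factor_zero_nonconstant [OF e(2) open_ball _ _ True False] e(1)
      by (metis centre_in_ball connected_ball)
    have "\<forall>\<^sub>F t in nhds 0. t \<in> ball 0 r"
      using g(1) by (intro eventually_nhds_in_open) auto
    then have "\<forall>\<^sub>F t in nhds 0. f t = t^n * g t" by eventually_elim (simp add: g(3))
    moreover have "g analytic_on {0}" using g(1,2) analytic_at_ball by blast
    moreover have "g 0 \<noteq> 0" using g by simp
    ultimately show ?thesis by blast
  qed
qed

text \<open>The germ with the higher order of vanishing at \<open>0\<close> is the multiple. Since branches cannot be constant,
  this lets a branch through a double point be lifted to one of the two charts of the blow-up.\<close>

lemma analytic_multiple:
  assumes "x analytic_on {0}" "y analytic_on {0}"
  shows "(\<exists>s. s analytic_on {0} \<and> (\<forall>\<^sub>F t in nhds 0. y t = x t * s t)) \<or>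
         (\<exists>s. s analytic_on {0} \<and> (\<forall>\<^sub>F t in nhds 0. x t = y t * (s t :: complex)))"
proof -
  have main: "\<exists>s. s analytic_on {0} \<and> (\<forall>\<^sub>F t in nhds 0. y t = x t * s t)"
    if "g analytic_on {0}" "g 0 \<noteq> 0" "\<forall>\<^sub>F t in nhds 0. x t = t^n * g t"
      "h analytic_on {0}" "\<forall>\<^sub>F t in nhds 0. y t = t^m * h t" "n \<le> m" for x y g h :: "complex \<Rightarrow> complex" and n m
  proof -
    have "\<forall>\<^sub>F t in nhds 0. g t \<noteq> 0"
      using tendsto_imp_eventually_ne [of g "g 0" "nhds 0" 0] analytic_at_imp_isCont [OF that(1)] that(2)
      by (simp add: isCont_def tendsto_at_iff_tendsto_nhds)
    with that(3,5) have "\<forall>\<^sub>F t in nhds 0. y t = x t * (t^(m - n) * h t / g t)"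
    proof eventually_elim
      case (elim t)
      have "t^m = t^n * t^(m - n)" using that(6) by (simp flip: power_add)
      then show ?case using elim by simp
    qed
    moreover have "(\<lambda>t. t^(m - n) * h t / g t) analytic_on {0}"
      using that by (intro analytic_intros) auto
    ultimately show ?thesis by blast
  qed
  from analytic_zero_order [OF assms(1)] analytic_zero_order [OF assms(2)]
  consider "\<forall>\<^sub>F t in nhds 0. x t = 0" | "\<forall>\<^sub>F t in nhds 0. y t = 0"
    | n g m h where "g analytic_on {0}" "g 0 \<noteq> 0" "\<forall>\<^sub>F t in nhds 0. x t = t^n * g t"
      "h analytic_on {0}" "h 0 \<noteq> 0" "\<forall>\<^sub>F t in nhds 0. y t = t^m * h t" by blast
  then show ?thesis
  proof cases
    case 1
    then have "\<forall>\<^sub>F t in nhds 0. x t = y t * 0" by simp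
    then show ?thesis using analytic_on_const by blast
  next
    case 2
    then have "\<forall>\<^sub>F t in nhds 0. y t = x t * 0" by simp
    then show ?thesis using analytic_on_const by blast
  next
    case 3
    show ?thesis
    proof (cases "n \<le> m")
      case True
      then show ?thesis using main [OF 3(1-4) 3(6)] by blast
    next
      case False
      then show ?thesis using main [OF 3(4-6) 3(1) 3(3)] by auto
    qed
  qed
qed

section \<open>The holomorphic implicit function theorem in two variables\<close>

text \<open>The map \<open>(x, y) \<mapsto> (x, g(x, y))\<close> is locally invertible over the reals. Its derivative is complex
  linear, so the derivative of the inverse is complex linear too, which makes the second
  component of the inverse, restricted to \<open>(x, 0)\<close>, holomorphic.\<close>

lemma holomorphic_implicit_function:
  fixes g gx gy :: "complex \<times> complex \<Rightarrow> complex"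
  assumes deriv: "\<And>p. (g has_derivative (\<lambda>h. gx p * fst h + gy p * snd h)) (at p)"
    and cont: "continuous_on UNIV gx" "continuous_on UNIV gy"
    and zero: "g (0, s0) = 0" and regular: "gy (0, s0) \<noteq> 0"
  obtains \<phi> where "\<phi> analytic_on {0}" "\<phi> 0 = s0"
    "\<forall>\<^sub>F p in nhds (0, s0). g p = 0 \<longleftrightarrow> snd p = \<phi> (fst p)"
proof -
  define G where "G p = (fst p, g p)" for p
  define G' where "G' p = Blinfun (\<lambda>h. (fst h, gx p * fst h + gy p * snd h))" for p
  have bl: "bounded_linear (\<lambda>h. (fst h, gx p * fst h + gy p * snd h))" for p
    by (intro bounded_linear_intros)
  have G'_apply: "blinfun_apply (G' p) h = (fst h, gx p * fst h + gy p * snd h)" for p h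
    unfolding G'_def by (simp add: bounded_linear_Blinfun_apply [OF bl])
  have derG: "(G has_derivative blinfun_apply (G' p)) (at p)" for p
    unfolding G_def G'_apply [abs_def] by (auto intro!: derivative_eq_intros deriv)
  have contG': "continuous_on UNIV G'"
  proof (rule continuous_on_blinfun_componentwise)
    fix h :: "complex \<times> complex"
    show "continuous_on UNIV (\<lambda>p. blinfun_apply (G' p) h)"
      unfolding G'_apply using cont by (intro continuous_intros) auto
  qed
  define L where "L = Blinfun (\<lambda>h. (fst h, (snd h - gx (0, s0) * fst h) / gy (0, s0)))"
  have blL: "bounded_linear (\<lambda>h. (fst h, (snd h - gx (0, s0) * fst h) / gy (0, s0)))"
    unfolding divide_inverse by (intro bounded_linear_intros)
  have "L o\<^sub>L G' (0, s0) = id_blinfun"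
    by (rule blinfun_eqI) (simp add: L_def bounded_linear_Blinfun_apply [OF blL] G'_apply regular)
  then obtain U V H H' where U: "open U" "(0, s0) \<in> U" and V: "open V" "G (0, s0) \<in> V"
    and hom: "homeomorphism U V G H"
    and derH: "\<And>y. y \<in> V \<Longrightarrow> (H has_derivative (H' y)) (at y)"
    and H': "\<And>y. y \<in> V \<Longrightarrow> H' y = inv_into UNIV (blinfun_apply (G' (H y)))"
    and bijH: "\<And>y. y \<in> V \<Longrightarrow> bij (blinfun_apply (G' (H y)))"
    using inverse_function_theorem [OF open_UNIV derG contG' UNIV_I] by metis
  have G0: "G (0, s0) = (0, 0)" by (simp add: G_def zero)
  have V0: "(0, 0) \<in> V" using V(2) G0 by simp
  define \<phi> where "\<phi> x = snd (H (x, 0))" for x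
  have GH: "G (H p) = p" if "p \<in> V" for p using hom that by (simp add: homeomorphism_def)
  have HG: "H (G p) = p" if "p \<in> U" for p using hom that by (simp add: homeomorphism_def)
  have \<phi>0: "\<phi> 0 = s0" using HG [OF U(2)] unfolding \<phi>_def G0 by simp
  define W where "W = (\<lambda>x. (x, 0)) -` V"
  have W: "open W" "0 \<in> W" unfolding W_def using V0 V(1) by (auto intro!: open_vimage continuous_intros)
  have "\<phi> field_differentiable (at x)" if "x \<in> W" for x
  proof -
    have xV: "(x, 0) \<in> V" using that unfolding W_def by simp
    define p where "p = H (x, 0)"
    have inj: "inj (blinfun_apply (G' p))" and surj: "surj (blinfun_apply (G' p))"
      using bijH [OF xV] unfolding p_def bij_def by auto
    have gy: "gy p \<noteq> 0"
    proof
      assume "gy p = 0"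
      then have "blinfun_apply (G' p) (0, 1) = blinfun_apply (G' p) (0, 0)" unfolding G'_apply by simp
      then have "(0::complex, 1::complex) = (0, 0)" using inj by (rule injD [rotated])
      then show False by simp
    qed
    have inv: "H' (x, 0) (h, 0) = (h, - (gx p / gy p) * h)" for h
    proof -
      have "blinfun_apply (G' p) (h, - (gx p / gy p) * h) = (h, 0)"
        unfolding G'_apply using gy by simp
      then show ?thesis unfolding H' [OF xV] p_def [symmetric] using inj by (metis inv_f_f)
    qed
    have "((\<lambda>x. (x, 0)) has_derivative (\<lambda>h. (h, 0 :: complex))) (at x)"
      by (auto intro!: derivative_eq_intros)
    then have "((\<lambda>x. H (x, 0)) has_derivative (\<lambda>h. H' (x, 0) (h, 0))) (at x)"
      using derH [OF xV] by (rule has_derivative_compose)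
    then have "(\<phi> has_derivative (\<lambda>h. snd (H' (x, 0) (h, 0)))) (at x)"
      unfolding \<phi>_def by (rule has_derivative_snd)
    then have "(\<phi> has_field_derivative - (gx p / gy p)) (at x)"
      unfolding inv has_field_derivative_def by (simp only: snd_conv)
    then show ?thesis unfolding field_differentiable_def by blast
  qed
  then have "\<phi> holomorphic_on W" by (simp add: field_differentiable_at_within holomorphic_on_def)
  then have an: "\<phi> analytic_on {0}" using W holomorphic_on_imp_analytic_at by blast
  have "\<forall>\<^sub>F p in nhds (0, s0). p \<in> U" using U by (intro eventually_nhds_in_open)
  moreover have "\<forall>\<^sub>F p in nhds (0, s0). fst p \<in> W"
    using W open_vimage [OF W(1), of fst] eventually_nhds_in_open [of "fst -` W" "(0, s0)"]
    by (auto simp: continuous_on_fst)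
  moreover have "\<forall>\<^sub>F p in nhds (0, s0). (fst p, \<phi> (fst p)) \<in> U"
  proof -
    have "isCont (\<lambda>p. (fst p, \<phi> (fst p))) (0, s0)"
      using analytic_at_imp_isCont [OF an]
      by (intro continuous_intros isCont_o2 [of _ fst \<phi>]) auto
    then have "((\<lambda>p. (fst p, \<phi> (fst p))) \<longlongrightarrow> (0, s0)) (nhds (0, s0))"
      by (simp add: isCont_def tendsto_nhds_iff \<phi>0)
    then show ?thesis using U by (simp add: tendsto_def)
  qed
  ultimately have "\<forall>\<^sub>F p in nhds (0, s0). g p = 0 \<longleftrightarrow> snd p = \<phi> (fst p)"
  proof eventually_elim
    case (elim p)
    have xV: "(fst p, 0) \<in> V" using elim(2) unfolding W_def by simp
    have Hx: "H (fst p, 0) = (fst p, \<phi> (fst p))"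
      using GH [OF xV] unfolding \<phi>_def G_def by (metis fst_conv prod.collapse)
    show ?case
    proof
      assume "g p = 0"
      then have "G p = (fst p, 0)" by (simp add: G_def)
      then show "snd p = \<phi> (fst p)" using HG [OF elim(1)] Hx by (metis snd_conv)
    next
      assume "snd p = \<phi> (fst p)"
      then have "p = H (fst p, 0)" using Hx by (metis prod.collapse)
      then have "G p = (fst p, 0)" using GH [OF xV] by simp
      then show "g p = 0" by (simp add: G_def)
    qed
  qed
  with an \<phi>0 show thesis by (rule that)
qed

section \<open>Charts of the HC-model\<close>

lemma hc_smult: "hc (c *s v) = c^6 * hc v"
  by (simp add: hc_def Let_def eval_nat_numeral algebra_simps)

lemma branch_not_constant:
  assumes "\<gamma> \<in> branches F"
  shows "\<not> (\<forall>\<^sub>F t in nhds 0. proj (\<gamma> t) = q)"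
proof
  assume "\<forall>\<^sub>F t in nhds 0. proj (\<gamma> t) = q"
  then obtain s where s: "s > 0" "\<And>t. dist t 0 < s \<Longrightarrow> proj (\<gamma> t) = q"
    unfolding eventually_nhds_metric by blast
  obtain r where r: "r > 0" "inj_on (\<lambda>t. proj (\<gamma> t)) (ball 0 r)"
    using assms unfolding branches_def by blast
  define t :: complex where "t = of_real (min r s / 2)"
  have t: "t \<noteq> 0" "norm t < s" "norm t < r" unfolding t_def using r(1) s(1) by auto
  then have "t = 0" using inj_onD [OF r(2), of t 0] s r(1) by (simp add: dist_norm)
  then show False using t by simp
qed

lemma analytic_eventually_nonzero:
  assumes "x analytic_on {0}" "\<not> (\<forall>\<^sub>F t in nhds 0. x t = (0::complex))"
  shows "\<forall>\<^sub>F t in at 0. x t \<noteq> 0"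
proof -
  obtain n g where g: "g analytic_on {0}" "g 0 \<noteq> (0::complex)" "\<forall>\<^sub>F t in nhds 0. x t = t^n * g t"
    using analytic_zero_order [OF assms(1)] assms(2) by blast
  have "\<forall>\<^sub>F t in at 0. g t \<noteq> 0" using analytic_at_neq_imp_eventually_neq [OF g(1,2)] .
  moreover have "\<forall>\<^sub>F t in at 0. x t = t^n * g t" using g(3) by (simp add: eventually_nhds_conv_at)
  moreover have "\<forall>\<^sub>F t::complex in at 0. t \<noteq> 0" by (simp add: eventually_at_filter)
  ultimately show ?thesis by eventually_elim simp
qed

lemma eventually_at_zero_imp_nhds:
  assumes "isCont h 0" "\<forall>\<^sub>F t in at 0. h t = (0::complex)"
  shows "\<forall>\<^sub>F t in nhds (0::complex). h t = 0"
proof -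
  have "(h \<longlongrightarrow> 0) (at 0)" using assms(2) by (rule tendsto_eventually)
  moreover have "(h \<longlongrightarrow> h 0) (at 0)" using assms(1) by (simp add: isCont_def)
  ultimately have "h 0 = 0" using tendsto_unique [OF at_neq_bot] by blast
  then show ?thesis using assms(2) by (simp add: eventually_nhds_conv_at)
qed

lemma eventually_cancel_square:
  assumes "x analytic_on {0}" "\<not> (\<forall>\<^sub>F t in nhds 0. x t = (0::complex))" "isCont h 0"
    and "\<forall>\<^sub>F t in nhds 0. (x t)^2 * h t = 0"
  shows "\<forall>\<^sub>F t in nhds 0. h t = 0"
proof (rule eventually_at_zero_imp_nhds [OF assms(3)])
  have "\<forall>\<^sub>F t in at 0. (x t)^2 * h t = 0" using assms(4) by (simp add: eventually_nhds_conv_at)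
  then show "\<forall>\<^sub>F t in at 0. h t = 0"
    using analytic_eventually_nonzero [OF assms(1,2)] by eventually_elim simp
qed

text \<open>Dividing by the coordinate that does not vanish at the centre puts a branch into an affine chart.\<close>

lemma branch_affine_coordinates:
  assumes \<gamma>: "\<gamma> \<in> branches hc" and q: "proj (\<gamma> 0) = proj v" and m: "v $ m = 1"
  obtains c where "\<And>i. (\<lambda>t. c t $ i) analytic_on {0}" "c 0 = v"
    "\<forall>\<^sub>F t in nhds 0. c t $ m = 1 \<and> proj (\<gamma> t) = proj (c t) \<and> hc (c t) = 0"
proof -
  have an: "(\<lambda>t. \<gamma> t $ i) analytic_on {0}" for i
    using \<gamma> unfolding branches_def analytic_germ_def by blast
  have hc0: "\<forall>\<^sub>F t in nhds 0. hc (\<gamma> t) = 0" using \<gamma> unfolding branches_def by blast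
  obtain b where b: "b \<noteq> 0" "\<gamma> 0 = b *s v" using q proj_eq_iff by metis
  then have b_eq: "\<gamma> 0 $ m = b" using m by simp
  define c where "c t = (1 / \<gamma> t $ m) *s \<gamma> t" for t
  show thesis
  proof
    show "(\<lambda>t. c t $ i) analytic_on {0}" for i
      unfolding c_def using an b b_eq by (auto intro!: analytic_intros)
    show "c 0 = v" unfolding c_def b_eq using b by (simp add: vec_eq_iff)
    have "\<forall>\<^sub>F t in nhds 0. \<gamma> t $ m \<noteq> 0"
      using tendsto_imp_eventually_ne [of "\<lambda>t. \<gamma> t $ m" "\<gamma> 0 $ m" "nhds 0" 0]
        analytic_at_imp_isCont [OF an [of m]] b b_eq
      by (simp add: isCont_def tendsto_nhds_iff)
    with hc0 show "\<forall>\<^sub>F t in nhds 0. c t $ m = 1 \<and> proj (\<gamma> t) = proj (c t) \<and> hc (c t) = 0"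
      unfolding c_def by eventually_elim (simp add: hc_smult proj_smult)
  qed
qed

text \<open>In these coordinates the five-cycle acts diagonally, and the map to Bring's curve is the quadruple
  of adjoint cubics.\<close>

definition fourier :: "(nat \<Rightarrow> complex) \<Rightarrow> complex^5" where
  "fourier y = vector (map (\<lambda>k. \<Sum>j=1..4. y j * \<zeta>^(j * k)) [0..<5])"

lemma fourier_nth:
  "fourier y $ 1 = (\<Sum>j=1..4. y j * \<zeta>^(j * 0))"
  "fourier y $ 2 = (\<Sum>j=1..4. y j * \<zeta>^(j * 1))"
  "fourier y $ 3 = (\<Sum>j=1..4. y j * \<zeta>^(j * 2))"
  "fourier y $ 4 = (\<Sum>j=1..4. y j * \<zeta>^(j * 3))"
  "fourier y $ 5 = (\<Sum>j=1..4. y j * \<zeta>^(j * 4))"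
proof -
  have "fourier y = vector [\<Sum>j=1..4. y j * \<zeta>^(j * 0), \<Sum>j=1..4. y j * \<zeta>^(j * 1),
    \<Sum>j=1..4. y j * \<zeta>^(j * 2), \<Sum>j=1..4. y j * \<zeta>^(j * 3), \<Sum>j=1..4. y j * \<zeta>^(j * 4)]"
    unfolding fourier_def by (simp add: upt_rec numeral_eq_Suc)
  then show "fourier y $ 1 = (\<Sum>j=1..4. y j * \<zeta>^(j * 0))"
    "fourier y $ 2 = (\<Sum>j=1..4. y j * \<zeta>^(j * 1))" "fourier y $ 3 = (\<Sum>j=1..4. y j * \<zeta>^(j * 2))"
    "fourier y $ 4 = (\<Sum>j=1..4. y j * \<zeta>^(j * 3))" "fourier y $ 5 = (\<Sum>j=1..4. y j * \<zeta>^(j * 4))"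
    by (simp_all only: vector_5)
qed

lemma hc_to_bring_fourier: "hc_to_bring v = fourier (hc_adjoint v)"
  by (simp add: hc_to_bring_def fourier_def)

lemma fourier_cong: "(\<And>j. j \<in> {1..4} \<Longrightarrow> y j = z j) \<Longrightarrow> fourier y = fourier z"
  unfolding fourier_def by (intro arg_cong [where f = vector] map_cong sum.cong) auto

lemma fourier_smult: "fourier (\<lambda>j. c * y j) = c *s fourier y"
  unfolding vec_eq_iff forall_5 fourier_nth by (simp add: fourier_nth sum_distrib_left mult.assoc)

lemma fourier_inverse:
  assumes "i \<in> {1..4}"
  shows "(\<Sum>k<5. (\<Sum>j=1..4. y j * \<zeta>^(j * k)) * \<zeta>^((5 - i) * k)) = 5 * y i"
proof -
  have "(\<Sum>k<5. (\<Sum>j=1..4. y j * \<zeta>^(j * k)) * \<zeta>^((5 - i) * k)) = (\<Sum>k<5. \<Sum>j=1..4. y j * \<zeta>^((j + (5 - i)) * k))"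
    by (simp add: sum_distrib_right distrib_right power_add mult.assoc)
  also have "\<dots> = (\<Sum>j=1..4. y j * (\<Sum>k<5. \<zeta>^((j + (5 - i)) * k)))"
    by (subst sum.swap) (simp add: sum_distrib_left)
  also have "\<dots> = (\<Sum>j=1..4. y j * (if j = i then 5 else 0))"
  proof (intro sum.cong refl)
    fix j :: nat assume "j \<in> {1..4}"
    then have "5 dvd j + (5 - i) \<longleftrightarrow> j = i" using assms by (auto; presburger)
    then show "y j * (\<Sum>k<5. \<zeta>^((j + (5 - i)) * k)) = y j * (if j = i then 5 else 0)"
      unfolding zeta_power_sum by simp
  qed
  also have "\<dots> = 5 * y i" using assms by (subst sum.remove [of _ i]) (auto simp: mult.commute)
  finally show ?thesis .
qed

lemma fourier_inj:
  assumes "fourier y = c *s fourier z" "i \<in> {1..4}"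
  shows "y i = c * z i"
proof -
  have "fourier y = fourier (\<lambda>j. c * z j)" using assms(1) by (simp add: fourier_smult)
  then have "(\<Sum>j=1..4. y j * \<zeta>^(j * k)) = (\<Sum>j=1..4. c * z j * \<zeta>^(j * k))" if "k < 5" for k
    using that unfolding vec_eq_iff forall_5 fourier_nth
    by (auto simp: eval_nat_numeral less_Suc_eq)
  then have "(\<Sum>k<5. (\<Sum>j=1..4. y j * \<zeta>^(j * k)) * \<zeta>^((5 - i) * k)) =
    (\<Sum>k<5. (\<Sum>j=1..4. c * z j * \<zeta>^(j * k)) * \<zeta>^((5 - i) * k))"
    by (intro sum.cong) auto
  then show ?thesis unfolding fourier_inverse [OF assms(2)] by simp
qed

lemma fourier_analytic:
  assumes "\<And>j. j \<in> {1..4} \<Longrightarrow> (\<lambda>t. y t j) analytic_on S"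
  shows "(\<lambda>t. fourier (y t) $ i) analytic_on S"
proof -
  have "\<forall>i. (\<lambda>t. fourier (y t) $ i) analytic_on S"
    unfolding forall_5 fourier_nth using assms by (auto intro!: analytic_intros)
  then show ?thesis by blast
qed

lemma hc_adjoint_smult: "j \<in> {1..4} \<Longrightarrow> hc_adjoint (c *s v) j = c^3 * hc_adjoint v j"
proof -
  assume "j \<in> {1..4}"
  then have "j = 1 \<or> j = 2 \<or> j = 3 \<or> j = 4" by auto
  then show ?thesis
    by (auto simp: hc_adjoint_simps hc_adjoint_simps(1) [unfolded One_nat_def] eval_nat_numeral(1) power2_eq_square power3_eq_cube algebra_simps)
qed

lemma hc_to_bring_smult: "hc_to_bring (c *s v) = c^3 *s hc_to_bring v"
  unfolding hc_to_bring_fourier fourier_smult [symmetric] by (rule fourier_cong) (rule hc_adjoint_smult)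

text \<open>Polynomial coordinates \<open>(t, s)\<close> of the plane, or of a blow-up of the plane, in which the curve
  (or its proper transform) is \<open>g = 0\<close>, smooth at \<open>(0, s0)\<close> and transverse to \<open>t = 0\<close> there. That \<open>t\<close> can be
  recovered from the point makes the resulting parametrization injective.\<close>

locale hc_chart =
  fixes E :: "complex \<Rightarrow> complex \<Rightarrow> complex^3" and g gx gy :: "complex \<times> complex \<Rightarrow> complex" and s0 :: complex
  assumes deriv: "\<And>p. (g has_derivative (\<lambda>h. gx p * fst h + gy p * snd h)) (at p)"
    and cont: "continuous_on UNIV gx" "continuous_on UNIV gy"
    and zero: "g (0, s0) = 0" and regular: "gy (0, s0) \<noteq> 0"
    and E_analytic: "\<And>u s i. u analytic_on {0} \<Longrightarrow> s analytic_on {0} \<Longrightarrow> (\<lambda>t. E (u t) (s t) $ i) analytic_on {0}"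
    and E_nonzero: "\<And>t s. E t s \<noteq> 0"
    and E_inj: "\<And>t s t' s'. proj (E t s) = proj (E t' s') \<Longrightarrow> t = t'"
    and E_curve: "\<And>t s. g (t, s) = 0 \<Longrightarrow> hc (E t s) = 0"
begin

definition \<phi> :: "complex \<Rightarrow> complex" where
  "\<phi> = (SOME \<phi>. \<phi> analytic_on {0} \<and> \<phi> 0 = s0 \<and>
    (\<forall>\<^sub>F p in nhds (0, s0). g p = 0 \<longleftrightarrow> snd p = \<phi> (fst p)))"

lemma \<phi>: "\<phi> analytic_on {0}" "\<phi> 0 = s0" "\<forall>\<^sub>F p in nhds (0, s0). g p = 0 \<longleftrightarrow> snd p = \<phi> (fst p)"
proof -
  have "\<exists>\<phi>. \<phi> analytic_on {0} \<and> \<phi> 0 = s0 \<and> (\<forall>\<^sub>F p in nhds (0, s0). g p = 0 \<longleftrightarrow> snd p = \<phi> (fst p))"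
    using holomorphic_implicit_function [OF deriv cont zero regular] by metis
  from someI_ex [OF this] show "\<phi> analytic_on {0}" "\<phi> 0 = s0"
    "\<forall>\<^sub>F p in nhds (0, s0). g p = 0 \<longleftrightarrow> snd p = \<phi> (fst p)" unfolding \<phi>_def by blast+
qed

definition branch :: "complex \<Rightarrow> complex^3" where
  "branch t = E t (\<phi> t)"

lemma solution_unique:
  assumes "u analytic_on {0}" "u 0 = 0" "s analytic_on {0}" "s 0 = s0"
  shows "\<forall>\<^sub>F t in nhds 0. g (u t, s t) = 0 \<longleftrightarrow> s t = \<phi> (u t)"
proof -
  have "isCont (\<lambda>t. (u t, s t)) 0"
    using assms by (intro continuous_intros analytic_at_imp_isCont)
  then have "((\<lambda>t. (u t, s t)) \<longlongrightarrow> (0, s0)) (nhds 0)"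
    unfolding isCont_def using assms tendsto_at_iff_tendsto_nhds [of "\<lambda>t. (u t, s t)" 0] by simp
  then have "\<forall>\<^sub>F t in nhds 0. g (u t, s t) = 0 \<longleftrightarrow> snd (u t, s t) = \<phi> (fst (u t, s t))"
    using \<phi>(3) unfolding filterlim_iff by blast
  then show ?thesis by simp
qed

lemma \<phi>_solves: "\<forall>\<^sub>F t in nhds 0. g (t, \<phi> t) = 0"
  using solution_unique [of "\<lambda>t. t" \<phi>] \<phi> by simp

lemma branch_at_0: "branch 0 = E 0 s0"
  by (simp add: branch_def \<phi>)

lemma branch_in_branches: "branch \<in> branches hc"
  unfolding branches_def analytic_germ_def
proof (intro CollectI conjI allI)
  show "(\<lambda>t. branch t $ i) analytic_on {0}" for i
    unfolding branch_def by (intro E_analytic \<phi>) simp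
  show "branch 0 \<noteq> 0" unfolding branch_def by (rule E_nonzero)
  show "\<forall>\<^sub>F t in nhds 0. hc (branch t) = 0"
    using \<phi>_solves unfolding branch_def by (rule eventually_mono) (rule E_curve)
  show "\<exists>r>0. inj_on (\<lambda>t. proj (branch t)) (ball 0 r)"
    unfolding branch_def inj_on_def using E_inj by (intro exI [of _ 1]) auto
qed

definition place :: "(complex \<Rightarrow> complex^3) set" where
  "place = place_of hc branch"

lemma place_in_places: "place \<in> places hc"
  unfolding place_def by (rule place_of_in_places) (rule branch_in_branches)

lemma place_in_places_over: "place \<in> places_over hc (proj (E 0 s0))"
  using place_of_in_places_over [OF branch_in_branches] by (simp add: place_def branch_at_0)

lemma branch_in_place: "branch \<in> place"
  unfolding place_def by (rule mem_place_of_self) (rule branch_in_branches)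

lemma placeE:
  assumes "\<gamma> \<in> place"
  obtains \<tau> where "\<tau> analytic_on {0}" "\<tau> 0 = 0" "deriv \<tau> 0 \<noteq> 0"
    "\<forall>\<^sub>F t in nhds 0. proj (\<gamma> t) = proj (E (\<tau> t) (\<phi> (\<tau> t)))"
  using assms unfolding place_def place_of_def same_place_def branch_def by blast

text \<open>Uniqueness of the place: a branch that has analytic chart coordinates tending to \<open>(0, s0)\<close> lies on
  the graph of \<open>\<phi>\<close>, so it factors through \<open>branch\<close>.\<close>

lemma capture:
  assumes \<gamma>: "\<gamma> \<in> branches hc" and u: "u analytic_on {0}" "u 0 = 0" and s: "s analytic_on {0}" "s 0 = s0"
    and ev: "\<forall>\<^sub>F t in nhds 0. proj (\<gamma> t) = proj (E (u t) (s t))" "\<forall>\<^sub>F t in nhds 0. g (u t, s t) = 0"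
  shows "place_of hc \<gamma> = place"
proof -
  have "\<forall>\<^sub>F t in nhds 0. proj (\<gamma> t) = proj (branch (u t))"
    using ev solution_unique [OF u s] unfolding branch_def
  proof eventually_elim
    case (elim t)
    then have "s t = \<phi> (u t)" by simp
    with elim(1) show ?case by (simp only:)
  qed
  then have "same_place branch \<gamma>" by (rule branch_factor_same_place [OF \<gamma> u])
  then show ?thesis unfolding place_def using place_of_cong by metis
qed

text \<open>The factor \<open>\<kappa>\<close> is the common zero of the adjoint cubics along the branch. Once it is divided out, the
  image is the value at \<open>t = 0\<close>, for every branch of the place, since a parameter change does not
  vanish near \<open>0\<close> except at \<open>0\<close>.\<close>

lemma place_to_bring:
  assumes \<kappa>: "\<And>t s. hc_to_bring (E t s) = \<kappa> t *s fourier (\<eta> t s)" "\<And>t. t \<noteq> 0 \<Longrightarrow> \<kappa> t \<noteq> 0"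
    and an: "\<And>u s j. j \<in> {1..4} \<Longrightarrow> u analytic_on {0} \<Longrightarrow> s analytic_on {0} \<Longrightarrow> (\<lambda>t. \<eta> (u t) (s t) j) analytic_on {0}"
    and nz: "j \<in> {1..4}" "\<eta> 0 s0 j \<noteq> 0"
  shows "hc_place_to_bring place = proj (fourier (\<eta> 0 s0))"
proof -
  have f0: "fourier (\<eta> 0 s0) \<noteq> 0"
    using fourier_inj [of "\<eta> 0 s0" 0 "\<lambda>_. 0" j] nz by auto
  have germ: "analytic_germ (\<lambda>t. fourier (\<eta> (\<tau> t) (\<phi> (\<tau> t))))" if "\<tau> analytic_on {0}" "\<tau> 0 = 0" for \<tau>
    unfolding analytic_germ_def
  proof (intro conjI allI)
    show "(\<lambda>t. fourier (\<eta> (\<tau> t) (\<phi> (\<tau> t))) $ i) analytic_on {0}" for i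
      by (rule fourier_analytic, rule an) (simp_all add: that \<phi> analytic_compose_at_0)
    show "fourier (\<eta> (\<tau> 0) (\<phi> (\<tau> 0))) \<noteq> 0" using f0 by (simp add: that \<phi>)
  qed
  have key: "\<forall>\<^sub>F t in at 0. proj (hc_to_bring (\<gamma> t)) = proj (fourier (\<eta> (\<tau> t) (\<phi> (\<tau> t))))"
    if \<tau>: "\<tau> analytic_on {0}" "\<tau> 0 = 0" "deriv \<tau> 0 \<noteq> 0"
      "\<forall>\<^sub>F t in nhds 0. proj (\<gamma> t) = proj (E (\<tau> t) (\<phi> (\<tau> t)))" for \<gamma> \<tau>
  proof -
    obtain v where v: "v 0 = 0" "\<forall>\<^sub>F t in nhds 0. v (\<tau> t) = t"
      using analytic_at_0_local_inverse [OF \<tau>(1-3)] by metis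
    have "\<forall>\<^sub>F t in at 0. v (\<tau> t) = t" "\<forall>\<^sub>F t in at 0. proj (\<gamma> t) = proj (E (\<tau> t) (\<phi> (\<tau> t)))"
      using v(2) \<tau>(4) by (simp_all add: eventually_nhds_conv_at)
    moreover have "\<forall>\<^sub>F t::complex in at 0. t \<noteq> 0" by (simp add: eventually_at_filter)
    ultimately show ?thesis
    proof eventually_elim
      case (elim t)
      obtain c where c: "c \<noteq> 0" "E (\<tau> t) (\<phi> (\<tau> t)) = c *s \<gamma> t" using elim(2) proj_eq_iff by metis
      have "\<tau> t \<noteq> 0" using elim(1,3) v(1) by auto
      have "proj (hc_to_bring (\<gamma> t)) = proj (c^3 *s hc_to_bring (\<gamma> t))"
        using c(1) by (simp add: proj_smult)
      also have "\<dots> = proj (\<kappa> (\<tau> t) *s fourier (\<eta> (\<tau> t) (\<phi> (\<tau> t))))"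
        by (simp add: hc_to_bring_smult [symmetric] c(2) [symmetric] \<kappa>(1))
      also have "\<dots> = proj (fourier (\<eta> (\<tau> t) (\<phi> (\<tau> t))))"
        using \<kappa>(2) \<open>\<tau> t \<noteq> 0\<close> by (simp add: proj_smult)
      finally show ?case .
    qed
  qed
  show ?thesis
    unfolding hc_place_to_bring_def
  proof (rule the_equality)
    have "\<forall>\<^sub>F t in at 0. proj (fourier (\<eta> t (\<phi> t))) = proj (hc_to_bring (branch t))"
      using key [of "\<lambda>t. t" branch] by (simp add: branch_def eq_commute)
    then show "\<exists>\<gamma>\<in>place. \<exists>\<xi>. analytic_germ \<xi> \<and> proj (\<xi> 0) = proj (fourier (\<eta> 0 s0)) \<and>
        (\<forall>\<^sub>F t in at 0. proj (\<xi> t) = proj (hc_to_bring (\<gamma> t)))"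
      using germ [of "\<lambda>t. t"] branch_in_place \<phi>(2)
      by (intro bexI [of _ branch] exI [of _ "\<lambda>t. fourier (\<eta> t (\<phi> t))"]) auto
  next
    fix p
    assume "\<exists>\<gamma>\<in>place. \<exists>\<xi>. analytic_germ \<xi> \<and> proj (\<xi> 0) = p \<and>
        (\<forall>\<^sub>F t in at 0. proj (\<xi> t) = proj (hc_to_bring (\<gamma> t)))"
    then obtain \<gamma> \<xi> where \<gamma>: "\<gamma> \<in> place" and \<xi>: "analytic_germ \<xi>" "proj (\<xi> 0) = p"
      "\<forall>\<^sub>F t in at 0. proj (\<xi> t) = proj (hc_to_bring (\<gamma> t))" by blast
    obtain \<tau> where \<tau>: "\<tau> analytic_on {0}" "\<tau> 0 = 0" "deriv \<tau> 0 \<noteq> 0"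
      "\<forall>\<^sub>F t in nhds 0. proj (\<gamma> t) = proj (E (\<tau> t) (\<phi> (\<tau> t)))" using \<gamma> by (rule placeE)
    have "\<forall>\<^sub>F t in at 0. proj (\<xi> t) = proj (fourier (\<eta> (\<tau> t) (\<phi> (\<tau> t))))"
      using \<xi>(3) key [OF \<tau>] by eventually_elim simp
    then have "proj (\<xi> 0) = proj (fourier (\<eta> (\<tau> 0) (\<phi> (\<tau> 0))))"
      by (rule proj_at_0_cong [OF \<xi>(1) germ [OF \<tau>(1,2)]])
    then show "p = proj (fourier (\<eta> 0 s0))" using \<xi>(2) \<tau>(2) \<phi>(2) by simp
  qed
qed

end

lemma places_overE:
  assumes "P \<in> places_over F q"
  obtains \<gamma> where "\<gamma> \<in> branches F" "proj (\<gamma> 0) = q" "P = place_of F \<gamma>"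
proof -
  obtain \<gamma> where "P \<in> places F" "\<gamma> \<in> P" "proj (\<gamma> 0) = q" using assms unfolding places_over_def by blast
  then show thesis using that place_memD by blast
qed

section \<open>The twenty-four places\<close>

lemma vector_3_analytic:
  assumes "a analytic_on S" "b analytic_on S" "c analytic_on S"
  shows "(\<lambda>t. (vector [a t, b t, c t] :: complex^3) $ i) analytic_on S"
proof -
  have "\<forall>i::3. (\<lambda>t. (vector [a t, b t, c t] :: complex^3) $ i) analytic_on S"
    unfolding forall_3 using assms by simp
  then show ?thesis by blast
qed

lemma vector_3_nonzero:
  "a \<noteq> 0 \<or> b \<noteq> 0 \<or> c \<noteq> 0 \<Longrightarrow> (vector [a, b, c] :: complex^3) \<noteq> 0"
  by (auto simp: vec_eq_iff forall_3)

lemma proj_vector_3_eq_iff: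
  "proj (vector [a, b, c] :: complex^3) = proj (vector [a', b', c']) \<longleftrightarrow>
    (\<exists>k. k \<noteq> 0 \<and> a' = k * a \<and> b' = k * b \<and> c' = k * c)"
  unfolding proj_eq_iff by (simp add: vec_eq_iff forall_3)

definition quad :: "complex \<Rightarrow> complex \<Rightarrow> complex \<Rightarrow> complex \<Rightarrow> nat \<Rightarrow> complex" where
  "quad a b c d j = (if j = 1 then a else if j = 2 then b else if j = 3 then c else d)"

lemma quad_simps [simp]:
  "quad a b c d (Suc 0) = a" "quad a b c d 2 = b" "quad a b c d 3 = c" "quad a b c d 4 = d"
  by (simp_all add: quad_def)

lemma fourier_quad_eqI:
  assumes "y 1 = a" "y 2 = b" "y 3 = c" "y 4 = d"
  shows "fourier y = fourier (quad a b c d)"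
proof (rule fourier_cong)
  fix j :: nat assume "j \<in> {1..4}"
  then have "j = 1 \<or> j = 2 \<or> j = 3 \<or> j = 4" by auto
  then show "y j = quad a b c d j" using assms by auto
qed

lemma fourier_quad_cong:
  assumes "a = a'" "b = b'" "c = c'" "d = d'"
  shows "fourier (quad a b c d) = fourier (quad a' b' c' d')"
  using assms by simp

lemma quad_analytic:
  assumes "a analytic_on S" "b analytic_on S" "c analytic_on S" "d analytic_on S"
  shows "(\<lambda>t. quad (a t) (b t) (c t) (d t) j) analytic_on S"
  unfolding quad_def using assms by (cases "j = 1"; cases "j = 2"; cases "j = 3") simp_all

lemma hc_to_bring_vector:
  "hc_to_bring (vector [a, b, c]) =
    fourier (quad (b * (b * c - a^2)) (a * b^2 - c^3) (b^3 - a * c^2) (c * (a^2 - b * c)))"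
  unfolding hc_to_bring_fourier
  by (rule fourier_quad_eqI) (simp_all only: hc_adjoint_simps vector_3)

lemma smult_quad: "c *s fourier (quad a1 a2 a3 a4) = fourier (quad (c * a1) (c * a2) (c * a3) (c * a4))"
  unfolding fourier_smult [symmetric] by (rule fourier_quad_eqI) simp_all

lemma hc_vector: "hc (vector [X, Y, Z]) = X * (Y^5 + Z^5) + (X * Y * Z)^2 - X^4 * Y * Z - 2 * (Y * Z)^3"
  by (simp add: hc_def Let_def)

text \<open>The symmetry of order 5 of the sextic; it reduces computations at the points of an orbit to one of them.\<close>

lemma hc_rotate:
  assumes "\<omega>^5 = 1"
  shows "hc (vector [\<omega> * X, \<omega>^2 * Y, Z]) = \<omega> * hc (vector [X, Y, Z])"
proof -
  have "\<omega> * X * ((\<omega>^2 * Y)^5 + Z^5) + (\<omega> * X * (\<omega>^2 * Y) * Z)^2 - (\<omega> * X)^4 * (\<omega>^2 * Y) * Z - 2 * (\<omega>^2 * Y * Z)^3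
    = \<omega> * (X * ((\<omega>^5)^2 * Y^5 + Z^5) + \<omega>^5 * (X * Y * Z)^2 - \<omega>^5 * (X^4 * Y * Z) - 2 * \<omega>^5 * (Y * Z)^3)"
    by (simp add: eval_nat_numeral algebra_simps)
  then show ?thesis unfolding hc_vector assms by simp
qed

lemma hc_to_bring_rotate:
  assumes "\<omega>^5 = 1"
  shows "hc_to_bring (vector [\<omega> * a, \<omega>^2 * b, 1]) =
    fourier (quad (\<omega>^4 * (b * (b - a^2))) (a * b^2 - 1) (\<omega> * (b^3 - a)) (\<omega>^2 * (a^2 - b)))"
proof -
  have "\<omega> * a * (\<omega>^2 * b)^2 = \<omega>^5 * (a * b^2)" "(\<omega>^2 * b)^3 - \<omega> * a * 1^2 = \<omega> * (\<omega>^5 * b^3 - a)"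
    by (simp_all add: eval_nat_numeral algebra_simps)
  then have "\<omega> * a * (\<omega>^2 * b)^2 - 1^3 = a * b^2 - 1" "(\<omega>^2 * b)^3 - \<omega> * a * 1^2 = \<omega> * (b^3 - a)"
    unfolding assms by simp_all
  moreover have "\<omega>^2 * b * (\<omega>^2 * b * 1 - (\<omega> * a)^2) = \<omega>^4 * (b * (b - a^2))"
    "1 * ((\<omega> * a)^2 - \<omega>^2 * b * 1) = \<omega>^2 * (a^2 - b)"
    by (simp_all add: eval_nat_numeral algebra_simps)
  ultimately show ?thesis unfolding hc_to_bring_vector by (simp only:)
qed

subsection \<open>The corners \<open>[0:0:1]\<close> and \<open>[0:1:0]\<close>\<close>

text \<open>Some coordinate of \<open>\<gamma>\<close> does not vanish at \<open>0\<close>, so the common factor \<open>h\<close>, an arbitrary function, has no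
  zeros near \<open>0\<close>; hence the ratios of the coordinates have the same limits as those of \<open>e\<close>.\<close>

lemma expansion_centre:
  assumes \<gamma>: "analytic_germ \<gamma>" and exp: "\<And>i. (\<lambda>t. \<gamma> t $ i) \<sim>[at 0] (\<lambda>t. h t * e t $ i)"
    and em: "\<forall>\<^sub>F t in at 0. e t $ m \<noteq> 0" and lim: "\<And>i. ((\<lambda>t. e t $ i / e t $ m) \<longlongrightarrow> v $ i) (at 0)"
  shows "\<forall>\<^sub>F t in at 0. h t \<noteq> 0" "\<forall>\<^sub>F t in at 0. \<gamma> t $ m \<noteq> 0" "proj (\<gamma> 0) = proj v"
proof -
  have \<gamma>0: "\<gamma> 0 \<noteq> 0" using \<gamma> by (simp add: analytic_germ_def)
  then obtain l where l: "\<gamma> 0 $ l \<noteq> 0" by (auto simp: vec_eq_iff)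
  have tend: "((\<lambda>t. \<gamma> t $ i) \<longlongrightarrow> \<gamma> 0 $ i) (at 0)" for i
    using analytic_germ_isCont [OF \<gamma>] by (simp add: isCont_def)
  have zeros: "\<forall>\<^sub>F t in at 0. \<gamma> t $ i = 0 \<longleftrightarrow> h t * e t $ i = 0" for i
    using asymp_equiv_eventually_zeros [OF exp [of i]] .
  have "\<forall>\<^sub>F t in at 0. \<gamma> t $ l \<noteq> 0" using tend l by (rule tendsto_imp_eventually_ne)
  with zeros [of l] show h: "\<forall>\<^sub>F t in at 0. h t \<noteq> 0" by eventually_elim auto
  with zeros [of m] em show gm: "\<forall>\<^sub>F t in at 0. \<gamma> t $ m \<noteq> 0" by eventually_elim auto
  have ratio: "((\<lambda>t. \<gamma> t $ i / \<gamma> t $ m) \<longlongrightarrow> v $ i) (at 0)" for i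
  proof -
    have "(\<lambda>t. \<gamma> t $ i / \<gamma> t $ m) \<sim>[at 0] (\<lambda>t. (h t * e t $ i) / (h t * e t $ m))"
      by (intro asymp_equiv_divide exp)
    moreover have "((\<lambda>t. (h t * e t $ i) / (h t * e t $ m)) \<longlongrightarrow> v $ i) (at 0)"
      using lim [of i] by (rule Lim_transform_eventually) (use h in eventually_elim, simp)
    ultimately show ?thesis using tendsto_asymp_equiv_cong by blast
  qed
  have eq: "\<gamma> 0 $ i = \<gamma> 0 $ m * v $ i" for i
  proof -
    have "((\<lambda>t. \<gamma> t $ m * (\<gamma> t $ i / \<gamma> t $ m)) \<longlongrightarrow> \<gamma> 0 $ m * v $ i) (at 0)"
      by (intro tendsto_mult tend ratio)
    then have "((\<lambda>t. \<gamma> t $ i) \<longlongrightarrow> \<gamma> 0 $ m * v $ i) (at 0)"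
      by (rule Lim_transform_eventually) (use gm in eventually_elim, simp)
    then show ?thesis using tend tendsto_unique [OF at_neq_bot] by blast
  qed
  then have "\<gamma> 0 = (\<gamma> 0 $ m) *s v" unfolding vec_eq_iff by (metis vector_smult_component)
  moreover have "\<gamma> 0 $ m \<noteq> 0" using eq [of l] l by auto
  ultimately show "proj (\<gamma> 0) = proj v" using proj_smult by metis
qed

text \<open>Both points are smooth, and the exchange of \<open>Y\<close> and \<open>Z\<close> interchanges them, so one function \<open>g\<close> serves
  both. On the branch \<open>X (1 + \<dots>) = 2 t\<^sup>3\<close>, which gives the expansions.\<close>

lemma corner_places:
  obtains a b where
    "places_over hc (proj (vector [0, 0, 1])) = {a}" "hc_place_to_bring a = proj (fourier (quad 0 (-1) 0 0))"
    "{P \<in> places hc. has_expansion P (\<lambda>t. vector [2 * t^3, t, 1])} = {a}"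
    "places_over hc (proj (vector [0, 1, 0])) = {b}" "hc_place_to_bring b = proj (fourier (quad 0 0 1 0))"
    "{P \<in> places hc. has_expansion P (\<lambda>t. vector [2 * t^2, 1 / t, 1])} = {b}"
proof -
  define g where "g = (\<lambda>(t, s). s * (t^5 + 1) + (s * t)^2 - s^4 * t - 2 * t^3 :: complex)"
  define gx where "gx = (\<lambda>(t, s). 5 * s * t^4 + 2 * s^2 * t - s^4 - 6 * t^2 :: complex)"
  define gy where "gy = (\<lambda>(t, s). t^5 + 1 + 2 * s * t^2 - 4 * s^3 * t :: complex)"
  have der: "(g has_derivative (\<lambda>h. gx p * fst h + gy p * snd h)) (at p)" for p
    unfolding g_def gx_def gy_def case_prod_unfold
    by (auto intro!: derivative_eq_intros ext simp: eval_nat_numeral algebra_simps)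
  have cont: "continuous_on UNIV gx" "continuous_on UNIV gy"
    unfolding gx_def gy_def case_prod_unfold by (intro continuous_intros)+
  interpret a: hc_chart "\<lambda>t s. vector [s, t, 1]" g gx gy 0
  proof (unfold_locales)
    show "t = t'" if "proj (vector [s, t, 1] :: complex^3) = proj (vector [s', t', 1])" for t s t' s'
      using that by (auto simp: proj_vector_3_eq_iff)
    show "hc (vector [s, t, 1]) = 0" if "g (t, s) = 0" for t s
      using that by (simp add: g_def hc_vector)
    show "(\<lambda>t. (vector [s t, u t, 1] :: complex^3) $ i) analytic_on {0}"
      if "u analytic_on {0}" "s analytic_on {0}" for u s i
      by (intro vector_3_analytic that analytic_on_const)
  qed (rule der cont | simp add: g_def gy_def vector_3_nonzero)+
  interpret b: hc_chart "\<lambda>t s. vector [s, 1, t]" g gx gy 0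
  proof (unfold_locales)
    show "t = t'" if "proj (vector [s, 1, t] :: complex^3) = proj (vector [s', 1, t'])" for t s t' s'
      using that by (auto simp: proj_vector_3_eq_iff)
    show "hc (vector [s, 1, t]) = 0" if "g (t, s) = 0" for t s
      using that by (simp add: g_def hc_vector algebra_simps)
    show "(\<lambda>t. (vector [s t, 1, u t] :: complex^3) $ i) analytic_on {0}"
      if "u analytic_on {0}" "s analytic_on {0}" for u s i
      by (intro vector_3_analytic that analytic_on_const)
  qed (rule der cont | simp add: g_def gy_def vector_3_nonzero)+
  have asym: "f \<sim>[at 0] (\<lambda>t. 2 * t^3)" if f: "f analytic_on {0}" "f 0 = 0" "\<forall>\<^sub>F t in nhds 0. g (t, f t) = 0" for f
  proof -
    define D where "D t = t^5 + 1 + f t * t^2 - f t^3 * t" for t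
    have "isCont D 0" unfolding D_def using analytic_at_imp_isCont [OF f(1)] by (intro continuous_intros)
    then have D: "(D \<longlongrightarrow> 1) (at 0)" by (simp add: isCont_def D_def f(2))
    then have "((\<lambda>t. 1 / D t) \<longlongrightarrow> 1 / 1) (at 0)" by (intro tendsto_divide tendsto_const) auto
    moreover have "\<forall>\<^sub>F t in at 0. 1 / D t = f t / (2 * t^3)"
    proof -
      have "\<forall>\<^sub>F t in at 0. D t \<noteq> 0" using D by (rule tendsto_imp_eventually_ne) simp
      moreover have "\<forall>\<^sub>F t in at 0. g (t, f t) = 0" using f(3) by (simp add: eventually_nhds_conv_at)
      moreover have "\<forall>\<^sub>F t::complex in at 0. t \<noteq> 0" by (simp add: eventually_at_filter)
      ultimately show ?thesis
      proof eventually_elim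
        case (elim t)
        have "f t * D t = 2 * t^3" using elim(2) by (simp add: g_def D_def eval_nat_numeral algebra_simps)
        then show ?case using elim(1,3) by (simp add: field_simps)
      qed
    qed
    ultimately have "((\<lambda>t. f t / (2 * t^3)) \<longlongrightarrow> 1) (at 0)"
      using Lim_transform_eventually by fastforce
    then show ?thesis by (rule asymp_equivI')
  qed
  have a_over: "places_over hc (proj (vector [0, 0, 1])) = {a.place}"
  proof (intro equalityI subsetI)
    fix P assume "P \<in> places_over hc (proj (vector [0, 0, 1]))"
    then obtain \<gamma> where \<gamma>: "\<gamma> \<in> branches hc" "proj (\<gamma> 0) = proj (vector [0, 0, 1])" "P = place_of hc \<gamma>"
      by (rule places_overE)
    obtain c where c: "\<And>i. (\<lambda>t. c t $ i) analytic_on {0}" "c 0 = vector [0, 0, 1]"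
      "\<forall>\<^sub>F t in nhds 0. c t $ 3 = 1 \<and> proj (\<gamma> t) = proj (c t) \<and> hc (c t) = 0"
      by (rule branch_affine_coordinates [OF \<gamma>(1,2), of 3]) (simp, blast)
    have ev: "\<forall>\<^sub>F t in nhds 0. c t = vector [c t $ 1, c t $ 2, 1]"
      using c(3) by (rule eventually_mono) (simp add: vec_eq_iff forall_3)
    have "\<forall>\<^sub>F t in nhds 0. g (c t $ 2, c t $ 1) = 0"
      using c(3) by (rule eventually_mono) (auto simp: hc_def g_def Let_def)
    moreover have "\<forall>\<^sub>F t in nhds 0. proj (\<gamma> t) = proj (vector [c t $ 1, c t $ 2, 1])"
      using c(3) ev by eventually_elim metis
    ultimately have "place_of hc \<gamma> = a.place"
      using a.capture [OF \<gamma>(1) c(1) _ c(1), of 2 1] by (simp add: c(2))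
    then show "P \<in> {a.place}" using \<gamma>(3) by simp
  qed (use a.place_in_places_over in auto)
  have b_over: "places_over hc (proj (vector [0, 1, 0])) = {b.place}"
  proof (intro equalityI subsetI)
    fix P assume "P \<in> places_over hc (proj (vector [0, 1, 0]))"
    then obtain \<gamma> where \<gamma>: "\<gamma> \<in> branches hc" "proj (\<gamma> 0) = proj (vector [0, 1, 0])" "P = place_of hc \<gamma>"
      by (rule places_overE)
    obtain c where c: "\<And>i. (\<lambda>t. c t $ i) analytic_on {0}" "c 0 = vector [0, 1, 0]"
      "\<forall>\<^sub>F t in nhds 0. c t $ 2 = 1 \<and> proj (\<gamma> t) = proj (c t) \<and> hc (c t) = 0"
      by (rule branch_affine_coordinates [OF \<gamma>(1,2), of 2]) (simp, blast)
    have ev: "\<forall>\<^sub>F t in nhds 0. c t = vector [c t $ 1, 1, c t $ 3]"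
      using c(3) by (rule eventually_mono) (simp add: vec_eq_iff forall_3)
    have "\<forall>\<^sub>F t in nhds 0. g (c t $ 3, c t $ 1) = 0"
      using c(3) by (rule eventually_mono) (auto simp: hc_def g_def Let_def algebra_simps)
    moreover have "\<forall>\<^sub>F t in nhds 0. proj (\<gamma> t) = proj (vector [c t $ 1, 1, c t $ 3])"
      using c(3) ev by eventually_elim metis
    ultimately have "place_of hc \<gamma> = b.place"
      using b.capture [OF \<gamma>(1) c(1) _ c(1), of 3 1] by (simp add: c(2))
    then show "P \<in> {b.place}" using \<gamma>(3) by simp
  qed (use b.place_in_places_over in auto)
  have poly_lim: "((\<lambda>t::complex. 2 * t^3) \<longlongrightarrow> 0) (at 0)" "((\<lambda>t::complex. t) \<longlongrightarrow> 0) (at 0)"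
    by (auto intro!: tendsto_eq_intros)
  have a_exp: "{P \<in> places hc. has_expansion P (\<lambda>t. vector [2 * t^3, t, 1])} = {a.place}"
  proof (intro equalityI subsetI)
    fix P assume "P \<in> {P \<in> places hc. has_expansion P (\<lambda>t. vector [2 * t^3, t, 1])}"
    then obtain \<gamma> h where P: "P \<in> places hc" and \<gamma>: "\<gamma> \<in> P"
      "\<And>i. (\<lambda>t. \<gamma> t $ i) \<sim>[at 0] (\<lambda>t. h t * vector [2 * t^3, t, 1] $ i)"
      unfolding has_expansion_def by blast
    have "analytic_germ \<gamma>" using place_memD(1) [OF P \<gamma>(1)] by (simp add: branches_def)
    moreover have "((\<lambda>t::complex. (vector [2 * t^3, t, 1] :: complex^3) $ i / (vector [2 * t^3, t, 1] :: complex^3) $ 3)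
        \<longlongrightarrow> (vector [0, 0, 1] :: complex^3) $ i) (at 0)" for i
      using poly_lim exhaust_3 [of i] by auto
    ultimately have "proj (\<gamma> 0) = proj (vector [0, 0, 1])"
      by (intro expansion_centre(3) [where m = 3, OF _ \<gamma>(2)]) simp_all
    then show "P \<in> {a.place}" using P \<gamma>(1) a_over unfolding places_over_def by blast
  next
    have "has_expansion a.place (\<lambda>t. vector [2 * t^3, t, 1])"
      unfolding has_expansion_def
    proof (intro bexI [OF _ a.branch_in_place] exI [of _ "\<lambda>_. 1"] allI)
      show "(\<lambda>t. a.branch t $ i) \<sim>[at 0] (\<lambda>t. 1 * (vector [2 * t^3, t, 1] :: complex^3) $ i)" for i
        using asym [OF a.\<phi>(1,2) a.\<phi>_solves] exhaust_3 [of i] unfolding a.branch_def by auto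
    qed
    then show "P \<in> {P \<in> places hc. has_expansion P (\<lambda>t. vector [2 * t^3, t, 1])}" if "P \<in> {a.place}" for P
      using a.place_in_places that by blast
  qed
  have b_exp: "{P \<in> places hc. has_expansion P (\<lambda>t. vector [2 * t^2, 1 / t, 1])} = {b.place}"
  proof (intro equalityI subsetI)
    fix P assume "P \<in> {P \<in> places hc. has_expansion P (\<lambda>t. vector [2 * t^2, 1 / t, 1])}"
    then obtain \<gamma> h where P: "P \<in> places hc" and \<gamma>: "\<gamma> \<in> P"
      "\<And>i. (\<lambda>t. \<gamma> t $ i) \<sim>[at 0] (\<lambda>t. h t * vector [2 * t^2, 1 / t, 1] $ i)"
      unfolding has_expansion_def by blast
    have nz: "\<forall>\<^sub>F t::complex in at 0. t \<noteq> 0" by (simp add: eventually_at_filter)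
    have "analytic_germ \<gamma>" using place_memD(1) [OF P \<gamma>(1)] by (simp add: branches_def)
    moreover have "((\<lambda>t::complex. (vector [2 * t^2, 1 / t, 1] :: complex^3) $ i / (vector [2 * t^2, 1 / t, 1] :: complex^3) $ 2)
        \<longlongrightarrow> (vector [0, 1, 0] :: complex^3) $ i) (at 0)" for i
    proof -
      have "((\<lambda>t::complex. 2 * t^2 / (1 / t)) \<longlongrightarrow> 0) (at 0)"
        using poly_lim(1) by (rule Lim_transform_eventually) (simp add: power3_eq_cube power2_eq_square)
      moreover have "((\<lambda>t::complex. (1 / t) / (1 / t)) \<longlongrightarrow> 1) (at 0)"
        using nz by (intro tendsto_eventually) (auto elim: eventually_mono)
      ultimately show ?thesis using poly_lim(2) exhaust_3 [of i] by auto
    qed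
    moreover have "\<forall>\<^sub>F t::complex in at 0. (vector [2 * t^2, 1 / t, 1] :: complex^3) $ 2 \<noteq> 0"
      using nz by eventually_elim simp
    ultimately have "proj (\<gamma> 0) = proj (vector [0, 1, 0])"
      by (intro expansion_centre(3) [where m = 2, OF _ \<gamma>(2)])
    then show "P \<in> {b.place}" using P \<gamma>(1) b_over unfolding places_over_def by blast
  next
    have "has_expansion b.place (\<lambda>t. vector [2 * t^2, 1 / t, 1])"
      unfolding has_expansion_def
    proof (intro bexI [OF _ b.branch_in_place] exI [of _ "\<lambda>t. t"] allI)
      have "(\<lambda>t::complex. 1) \<sim>[at 0] (\<lambda>t. t * (1 / t))"
        by (rule asymp_equiv_refl_ev) (auto simp: eventually_at_filter)
      then show "(\<lambda>t. b.branch t $ i) \<sim>[at 0] (\<lambda>t. t * (vector [2 * t^2, 1 / t, 1] :: complex^3) $ i)" for i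
        using asym [OF b.\<phi>(1,2) b.\<phi>_solves] exhaust_3 [of i] unfolding b.branch_def
        by (auto simp: power2_eq_square power3_eq_cube mult_ac)
    qed
    then show "P \<in> {P \<in> places hc. has_expansion P (\<lambda>t. vector [2 * t^2, 1 / t, 1])}" if "P \<in> {b.place}" for P
      using b.place_in_places that by blast
  qed
  have "hc_place_to_bring a.place = proj (fourier
      (quad (0 * (0 * 1 - 0^2)) (0 * 0^2 - 1^3) (0^3 - 0 * 1^2) (1 * (0^2 - 0 * 1))))"
    by (rule a.place_to_bring [where \<kappa> = "\<lambda>_. 1" and j = 2 and
          \<eta> = "\<lambda>t s. quad (t * (t * 1 - s^2)) (s * t^2 - 1^3) (t^3 - s * 1^2) (1 * (s^2 - t * 1))"])
       (auto simp: hc_to_bring_vector intro!: quad_analytic analytic_intros)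
  then have a_img: "hc_place_to_bring a.place = proj (fourier (quad 0 (-1) 0 0))" by simp
  have "hc_place_to_bring b.place = proj (fourier
      (quad (1 * (1 * 0 - 0^2)) (0 * 1^2 - 0^3) (1^3 - 0 * 0^2) (0 * (0^2 - 1 * 0))))"
    by (rule b.place_to_bring [where \<kappa> = "\<lambda>_. 1" and j = 3 and
          \<eta> = "\<lambda>t s. quad (1 * (1 * t - s^2)) (s * 1^2 - t^3) (1^3 - s * t^2) (t * (s^2 - 1 * t))"])
       (auto simp: hc_to_bring_vector intro!: quad_analytic analytic_intros)
  then have b_img: "hc_place_to_bring b.place = proj (fourier (quad 0 0 1 0))" by simp
  show thesis by (rule that [OF a_over a_img a_exp b_over b_img b_exp])
qed

subsection \<open>The node \<open>[1:0:0]\<close>\<close>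

text \<open>A local parameter has a simple zero, so it cannot be equivalent to \<open>t\<^sup>4\<close>. This separates the two
  branches at \<open>[1:0:0]\<close>: on each of them the coordinate that is of order 4 on the other is a parameter.\<close>

lemma parameter_not_quartic:
  assumes \<gamma>: "analytic_germ \<gamma>" and \<tau>: "\<tau> analytic_on {0}" "\<tau> 0 = 0" "deriv \<tau> 0 \<noteq> 0"
    and exp: "\<And>i. (\<lambda>t. \<gamma> t $ i) \<sim>[at 0] (\<lambda>t. h t * e t $ i)"
    and em: "\<forall>\<^sub>F t in at 0. e t $ m \<noteq> 0" and lim: "\<And>i. ((\<lambda>t. e t $ i / e t $ m) \<longlongrightarrow> v $ i) (at 0)"
    and quartic: "\<forall>\<^sub>F t in at 0. e t $ l = t^4 * e t $ m"
    and par: "\<forall>\<^sub>F t in at 0. \<gamma> t $ l = \<tau> t * \<gamma> t $ m"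
  shows False
proof -
  have h: "\<forall>\<^sub>F t in at 0. h t \<noteq> 0" and gm: "\<forall>\<^sub>F t in at 0. \<gamma> t $ m \<noteq> 0"
    using expansion_centre [OF \<gamma> exp em lim] by blast+
  have "(\<lambda>t. \<gamma> t $ l / \<gamma> t $ m) \<sim>[at 0] (\<lambda>t. (h t * e t $ l) / (h t * e t $ m))"
    by (intro asymp_equiv_divide exp)
  moreover have "\<forall>\<^sub>F t in at 0. \<gamma> t $ l / \<gamma> t $ m = \<tau> t" using gm par by eventually_elim simp
  moreover have "\<forall>\<^sub>F t in at 0. (h t * e t $ l) / (h t * e t $ m) = t^4"
    using h em quartic by eventually_elim simp
  ultimately have "\<tau> \<sim>[at 0] (\<lambda>t. t^4)" using asymp_equiv_cong by fast
  then have "(\<lambda>t. \<tau> t / t) \<sim>[at 0] (\<lambda>t. t^4 / t)" by (intro asymp_equiv_divide asymp_equiv_refl)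
  moreover have "((\<lambda>t::complex. t^4 / t) \<longlongrightarrow> 0) (at 0)"
  proof (rule Lim_transform_eventually)
    show "((\<lambda>t::complex. t^3) \<longlongrightarrow> 0) (at 0)" by (auto intro!: tendsto_eq_intros)
    show "\<forall>\<^sub>F t::complex in at 0. t^3 = t^4 / t"
      by (auto simp: eventually_at_filter eval_nat_numeral)
  qed
  ultimately have "((\<lambda>t. \<tau> t / t) \<longlongrightarrow> 0) (at 0)" using tendsto_asymp_equiv_cong by blast
  moreover have "(\<tau> has_field_derivative deriv \<tau> 0) (at 0)"
    using \<tau>(1) analytic_on_imp_differentiable_at by (auto simp: DERIV_deriv_iff_field_differentiable)
  then have "((\<lambda>t. \<tau> t / t) \<longlongrightarrow> deriv \<tau> 0) (at 0)"
    by (simp add: has_field_derivative_iff \<tau>(2))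
  ultimately show False using \<tau>(3) tendsto_unique [OF at_neq_bot] by blast
qed

text \<open>At \<open>[1:0:0]\<close> the tangent cone is \<open>YZ = 0\<close>. The two branches are separated by the blow-ups \<open>Z = Ys\<close>
  and \<open>Y = Zs\<close>, whose proper transforms have the same equation \<open>g\<close>, in which \<open>s \<sim> t\<^sup>3\<close>.
  Any other branch is excluded because one of its two coordinates is an analytic multiple of the other.\<close>

lemma node_at_infinity_places:
  obtains c d where
    "places_over hc (proj (vector [1, 0, 0])) = {c, d}"
    "hc_place_to_bring c = proj (fourier (quad (-1) 0 0 0))"
    "hc_place_to_bring d = proj (fourier (quad 0 0 0 1))"
    "{P \<in> places hc. has_expansion P (\<lambda>t. vector [1, t, t^4])} = {c}"
    "{P \<in> places hc. has_expansion P (\<lambda>t. vector [1, t^4, t])} = {d}"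
proof -
  define g where "g = (\<lambda>(t, s). t^3 + t^3 * s^5 + t^2 * s^2 - s - 2 * t^4 * s^3 :: complex)"
  define gx where "gx = (\<lambda>(t, s). 3 * t^2 + 3 * t^2 * s^5 + 2 * t * s^2 - 8 * t^3 * s^3 :: complex)"
  define gy where "gy = (\<lambda>(t, s). 5 * t^3 * s^4 + 2 * t^2 * s - 1 - 6 * t^4 * s^2 :: complex)"
  have der: "(g has_derivative (\<lambda>h. gx p * fst h + gy p * snd h)) (at p)" for p
    unfolding g_def gx_def gy_def case_prod_unfold
    by (auto intro!: derivative_eq_intros ext simp: eval_nat_numeral algebra_simps)
  have cont: "continuous_on UNIV gx" "continuous_on UNIV gy"
    unfolding gx_def gy_def case_prod_unfold by (intro continuous_intros)+
  have hcg: "hc (vector [1, t, t * s]) = t^2 * g (t, s)" "hc (vector [1, t * s, t]) = t^2 * g (t, s)" for t s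
    by (simp_all add: g_def hc_vector eval_nat_numeral algebra_simps)
  interpret c: hc_chart "\<lambda>t s. vector [1, t, t * s]" g gx gy 0
  proof (unfold_locales)
    show "t = t'" if "proj (vector [1, t, t * s] :: complex^3) = proj (vector [1, t', t' * s'])" for t s t' s'
      using that by (auto simp: proj_vector_3_eq_iff)
    show "hc (vector [1, t, t * s]) = 0" if "g (t, s) = 0" for t s
      using that by (simp add: hcg)
    show "(\<lambda>t. (vector [1, u t, u t * s t] :: complex^3) $ i) analytic_on {0}"
      if "u analytic_on {0}" "s analytic_on {0}" for u s i
      by (intro vector_3_analytic analytic_on_mult that analytic_on_const)
  qed (rule der cont | simp add: g_def gy_def vector_3_nonzero)+
  interpret d: hc_chart "\<lambda>t s. vector [1, t * s, t]" g gx gy 0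
  proof (unfold_locales)
    show "t = t'" if "proj (vector [1, t * s, t] :: complex^3) = proj (vector [1, t' * s', t'])" for t s t' s'
      using that by (auto simp: proj_vector_3_eq_iff)
    show "hc (vector [1, t * s, t]) = 0" if "g (t, s) = 0" for t s
      using that by (simp add: hcg)
    show "(\<lambda>t. (vector [1, u t * s t, u t] :: complex^3) $ i) analytic_on {0}"
      if "u analytic_on {0}" "s analytic_on {0}" for u s i
      by (intro vector_3_analytic analytic_on_mult that analytic_on_const)
  qed (rule der cont | simp add: g_def gy_def vector_3_nonzero)+
  have asym: "(\<lambda>t. t * f t) \<sim>[at 0] (\<lambda>t. t^4)"
    if f: "f analytic_on {0}" "f 0 = 0" "\<forall>\<^sub>F t in nhds 0. g (t, f t) = 0" for f
  proof -
    define D where "D t = 1 + 2 * t^4 * f t^2 - t^2 * f t - t^3 * f t^4" for t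
    have "isCont D 0" unfolding D_def using analytic_at_imp_isCont [OF f(1)] by (intro continuous_intros)
    then have D: "(D \<longlongrightarrow> 1) (at 0)" by (simp add: isCont_def D_def f(2))
    then have "((\<lambda>t. 1 / D t) \<longlongrightarrow> 1 / 1) (at 0)" by (intro tendsto_divide tendsto_const) auto
    moreover have "\<forall>\<^sub>F t in at 0. 1 / D t = (t * f t) / t^4"
    proof -
      have "\<forall>\<^sub>F t in at 0. D t \<noteq> 0" using D by (rule tendsto_imp_eventually_ne) simp
      moreover have "\<forall>\<^sub>F t in at 0. g (t, f t) = 0" using f(3) by (simp add: eventually_nhds_conv_at)
      moreover have "\<forall>\<^sub>F t::complex in at 0. t \<noteq> 0" by (simp add: eventually_at_filter)
      ultimately show ?thesis
      proof eventually_elim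
        case (elim t)
        have "f t * D t = t^3 - g (t, f t)" by (simp add: g_def D_def eval_nat_numeral algebra_simps)
        then have "f t * D t = t^3" using elim(2) by simp
        then show ?case using elim(1,3) by (simp add: field_simps eval_nat_numeral)
      qed
    qed
    ultimately have "((\<lambda>t. (t * f t) / t^4) \<longlongrightarrow> 1) (at 0)"
      using Lim_transform_eventually by fastforce
    then show ?thesis by (rule asymp_equivI')
  qed
  have over_sub: "places_over hc (proj (vector [1, 0, 0])) \<subseteq> {c.place, d.place}"
  proof
    fix P assume "P \<in> places_over hc (proj (vector [1, 0, 0]))"
    then obtain \<gamma> where \<gamma>: "\<gamma> \<in> branches hc" "proj (\<gamma> 0) = proj (vector [1, 0, 0])" "P = place_of hc \<gamma>"
      by (rule places_overE)
    obtain w where w: "\<And>i. (\<lambda>t. w t $ i) analytic_on {0}" "w 0 = vector [1, 0, 0]"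
      "\<forall>\<^sub>F t in nhds 0. w t $ 1 = 1 \<and> proj (\<gamma> t) = proj (w t) \<and> hc (w t) = 0"
      by (rule branch_affine_coordinates [OF \<gamma>(1,2), of 1]) (simp, blast)
    define y z where "y t = w t $ 2" and "z t = w t $ 3" for t
    have an: "y analytic_on {0}" "z analytic_on {0}" unfolding y_def z_def by (rule w(1))+
    have yz0: "y 0 = 0" "z 0 = 0" by (simp_all add: y_def z_def w(2))
    have vec: "\<forall>\<^sub>F t in nhds 0. w t = vector [1, y t, z t]"
      using w(3) by (rule eventually_mono) (simp add: vec_eq_iff forall_3 y_def z_def)
    have curve: "\<forall>\<^sub>F t in nhds 0. hc (vector [1, y t, z t]) = 0 \<and> proj (\<gamma> t) = proj (vector [1, y t, z t])"
      using w(3) vec by eventually_elim metis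
    have nontriv: "\<not> (\<forall>\<^sub>F t in nhds 0. y t = 0 \<and> z t = 0)"
    proof
      assume "\<forall>\<^sub>F t in nhds 0. y t = 0 \<and> z t = 0"
      with curve have "\<forall>\<^sub>F t in nhds 0. proj (\<gamma> t) = proj (vector [1, 0, 0])"
        by eventually_elim simp
      then show False using branch_not_constant [OF \<gamma>(1)] by blast
    qed
    \<comment> \<open>The proper transform meets the exceptional curve \<open>t = 0\<close> of the chart only at \<open>s = 0\<close>.\<close>
    have slope: "s 0 = 0 \<and> (\<forall>\<^sub>F t in nhds 0. g (u t, s t) = 0)"
      if u: "u analytic_on {0}" "u 0 = 0" "\<not> (\<forall>\<^sub>F t in nhds 0. u t = 0)" and s: "s analytic_on {0}"
        and ev: "\<forall>\<^sub>F t in nhds 0. (u t)^2 * g (u t, s t) = 0" for u s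
    proof -
      have "isCont (\<lambda>t. g (u t, s t)) 0"
        unfolding g_def case_prod_conv
        using analytic_at_imp_isCont [OF u(1)] analytic_at_imp_isCont [OF s] by (intro continuous_intros)
      then have "\<forall>\<^sub>F t in nhds 0. g (u t, s t) = 0"
        using eventually_cancel_square [OF u(1,3) _ ev] by blast
      moreover from this have "g (u 0, s 0) = 0" by (rule eventually_nhds_x_imp_x)
      then have "s 0 = 0" by (simp add: g_def u(2))
      ultimately show ?thesis by blast
    qed
    from analytic_multiple [OF an]
    show "P \<in> {c.place, d.place}"
    proof (elim disjE exE conjE)
      fix s assume s: "s analytic_on {0}" and ev: "\<forall>\<^sub>F t in nhds 0. z t = y t * s t"
      have nz: "\<not> (\<forall>\<^sub>F t in nhds 0. y t = 0)"
      proof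
        assume "\<forall>\<^sub>F t in nhds 0. y t = 0"
        with ev have "\<forall>\<^sub>F t in nhds 0. y t = 0 \<and> z t = 0" by eventually_elim simp
        then show False using nontriv by blast
      qed
      have "\<forall>\<^sub>F t in nhds 0. (y t)^2 * g (y t, s t) = 0"
        using curve ev by eventually_elim (simp flip: hcg(1))
      from slope [OF an(1) yz0(1) nz s this]
      have s0: "s 0 = 0" and gz: "\<forall>\<^sub>F t in nhds 0. g (y t, s t) = 0" by auto
      have "\<forall>\<^sub>F t in nhds 0. proj (\<gamma> t) = proj (vector [1, y t, y t * s t])"
        using curve ev by eventually_elim metis
      then have "place_of hc \<gamma> = c.place" by (rule c.capture [OF \<gamma>(1) an(1) yz0(1) s s0 _ gz])
      then show ?thesis using \<gamma>(3) by simp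
    next
      fix s assume s: "s analytic_on {0}" and ev: "\<forall>\<^sub>F t in nhds 0. y t = z t * s t"
      have nz: "\<not> (\<forall>\<^sub>F t in nhds 0. z t = 0)"
      proof
        assume "\<forall>\<^sub>F t in nhds 0. z t = 0"
        with ev have "\<forall>\<^sub>F t in nhds 0. y t = 0 \<and> z t = 0" by eventually_elim simp
        then show False using nontriv by blast
      qed
      have "\<forall>\<^sub>F t in nhds 0. (z t)^2 * g (z t, s t) = 0"
        using curve ev by eventually_elim (simp flip: hcg(2))
      from slope [OF an(2) yz0(2) nz s this]
      have s0: "s 0 = 0" and gz: "\<forall>\<^sub>F t in nhds 0. g (z t, s t) = 0" by auto
      have "\<forall>\<^sub>F t in nhds 0. proj (\<gamma> t) = proj (vector [1, z t * s t, z t])"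
        using curve ev by eventually_elim metis
      then have "place_of hc \<gamma> = d.place" by (rule d.capture [OF \<gamma>(1) an(2) yz0(2) s s0 _ gz])
      then show ?thesis using \<gamma>(3) by simp
    qed
  qed
  have over: "places_over hc (proj (vector [1, 0, 0])) = {c.place, d.place}"
    using over_sub c.place_in_places_over d.place_in_places_over by auto
  have lims: "((\<lambda>t::complex. t^4) \<longlongrightarrow> 0) (at 0)" "((\<lambda>t::complex. t) \<longlongrightarrow> 0) (at 0)"
    by (auto intro!: tendsto_eq_intros)
  have c_lim: "((\<lambda>t::complex. (vector [1, t, t^4] :: complex^3) $ i / (vector [1, t, t^4] :: complex^3) $ 1)
      \<longlongrightarrow> (vector [1, 0, 0] :: complex^3) $ i) (at 0)" for i
    using lims exhaust_3 [of i] by auto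
  have d_lim: "((\<lambda>t::complex. (vector [1, t^4, t] :: complex^3) $ i / (vector [1, t^4, t] :: complex^3) $ 1)
      \<longlongrightarrow> (vector [1, 0, 0] :: complex^3) $ i) (at 0)" for i
    using lims exhaust_3 [of i] by auto
  have c_exp: "{P \<in> places hc. has_expansion P (\<lambda>t. vector [1, t, t^4])} = {c.place}"
  proof (intro equalityI subsetI)
    fix P assume "P \<in> {P \<in> places hc. has_expansion P (\<lambda>t. vector [1, t, t^4])}"
    then obtain \<gamma> h where P: "P \<in> places hc" and \<gamma>: "\<gamma> \<in> P"
      "\<And>i. (\<lambda>t. \<gamma> t $ i) \<sim>[at 0] (\<lambda>t. h t * vector [1, t, t^4] $ i)"
      unfolding has_expansion_def by blast
    have germ: "analytic_germ \<gamma>" using place_memD(1) [OF P \<gamma>(1)] by (simp add: branches_def)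
    have "proj (\<gamma> 0) = proj (vector [1, 0, 0])"
      by (rule expansion_centre(3) [where m = 1, OF germ \<gamma>(2) _ c_lim]) simp
    then have "P = c.place \<or> P = d.place" using P \<gamma>(1) over unfolding places_over_def by blast
    moreover have "P \<noteq> d.place"
    proof
      assume "P = d.place"
      then have "\<gamma> \<in> d.place" using \<gamma>(1) by simp
      then obtain \<tau> where \<tau>: "\<tau> analytic_on {0}" "\<tau> 0 = 0" "deriv \<tau> 0 \<noteq> 0"
        "\<forall>\<^sub>F t in nhds 0. proj (\<gamma> t) = proj (vector [1, \<tau> t * d.\<phi> (\<tau> t), \<tau> t])"
        by (rule d.placeE)
      have par: "\<forall>\<^sub>F t in nhds 0. \<gamma> t $ 3 = \<tau> t * \<gamma> t $ 1"
        using \<tau>(4)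
      proof (rule eventually_mono)
        fix t assume "proj (\<gamma> t) = proj (vector [1, \<tau> t * d.\<phi> (\<tau> t), \<tau> t])"
        then obtain k where "\<gamma> t = k *s vector [1, \<tau> t * d.\<phi> (\<tau> t), \<tau> t]" using proj_eq_iff by metis
        then show "\<gamma> t $ 3 = \<tau> t * \<gamma> t $ 1" by simp
      qed
      show False
      proof (rule parameter_not_quartic [where m = 1 and l = 3, OF germ \<tau>(1-3) \<gamma>(2) _ c_lim])
        show "\<forall>\<^sub>F t in at 0. \<gamma> t $ 3 = \<tau> t * \<gamma> t $ 1"
          using par by (simp only: eventually_nhds_conv_at)
      qed simp_all
    qed
    ultimately show "P \<in> {c.place}" by simp
  next
    have "has_expansion c.place (\<lambda>t. vector [1, t, t^4])"
      unfolding has_expansion_def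
    proof (intro bexI [OF _ c.branch_in_place] exI [of _ "\<lambda>_. 1"] allI)
      show "(\<lambda>t. c.branch t $ i) \<sim>[at 0] (\<lambda>t. 1 * (vector [1, t, t^4] :: complex^3) $ i)" for i
        using asym [OF c.\<phi>(1,2) c.\<phi>_solves] exhaust_3 [of i] unfolding c.branch_def by auto
    qed
    then show "P \<in> {P \<in> places hc. has_expansion P (\<lambda>t. vector [1, t, t^4])}" if "P \<in> {c.place}" for P
      using c.place_in_places that by blast
  qed
  have d_exp: "{P \<in> places hc. has_expansion P (\<lambda>t. vector [1, t^4, t])} = {d.place}"
  proof (intro equalityI subsetI)
    fix P assume "P \<in> {P \<in> places hc. has_expansion P (\<lambda>t. vector [1, t^4, t])}"
    then obtain \<gamma> h where P: "P \<in> places hc" and \<gamma>: "\<gamma> \<in> P"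
      "\<And>i. (\<lambda>t. \<gamma> t $ i) \<sim>[at 0] (\<lambda>t. h t * vector [1, t^4, t] $ i)"
      unfolding has_expansion_def by blast
    have germ: "analytic_germ \<gamma>" using place_memD(1) [OF P \<gamma>(1)] by (simp add: branches_def)
    have "proj (\<gamma> 0) = proj (vector [1, 0, 0])"
      by (rule expansion_centre(3) [where m = 1, OF germ \<gamma>(2) _ d_lim]) simp
    then have "P = c.place \<or> P = d.place" using P \<gamma>(1) over unfolding places_over_def by blast
    moreover have "P \<noteq> c.place"
    proof
      assume "P = c.place"
      then have "\<gamma> \<in> c.place" using \<gamma>(1) by simp
      then obtain \<tau> where \<tau>: "\<tau> analytic_on {0}" "\<tau> 0 = 0" "deriv \<tau> 0 \<noteq> 0"
        "\<forall>\<^sub>F t in nhds 0. proj (\<gamma> t) = proj (vector [1, \<tau> t, \<tau> t * c.\<phi> (\<tau> t)])"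
        by (rule c.placeE)
      have par: "\<forall>\<^sub>F t in nhds 0. \<gamma> t $ 2 = \<tau> t * \<gamma> t $ 1"
        using \<tau>(4)
      proof (rule eventually_mono)
        fix t assume "proj (\<gamma> t) = proj (vector [1, \<tau> t, \<tau> t * c.\<phi> (\<tau> t)])"
        then obtain k where "\<gamma> t = k *s vector [1, \<tau> t, \<tau> t * c.\<phi> (\<tau> t)]" using proj_eq_iff by metis
        then show "\<gamma> t $ 2 = \<tau> t * \<gamma> t $ 1" by simp
      qed
      show False
      proof (rule parameter_not_quartic [where m = 1 and l = 2, OF germ \<tau>(1-3) \<gamma>(2) _ d_lim])
        show "\<forall>\<^sub>F t in at 0. \<gamma> t $ 2 = \<tau> t * \<gamma> t $ 1"
          using par by (simp only: eventually_nhds_conv_at)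
      qed simp_all
    qed
    ultimately show "P \<in> {d.place}" by simp
  next
    have "has_expansion d.place (\<lambda>t. vector [1, t^4, t])"
      unfolding has_expansion_def
    proof (intro bexI [OF _ d.branch_in_place] exI [of _ "\<lambda>_. 1"] allI)
      show "(\<lambda>t. d.branch t $ i) \<sim>[at 0] (\<lambda>t. 1 * (vector [1, t^4, t] :: complex^3) $ i)" for i
        using asym [OF d.\<phi>(1,2) d.\<phi>_solves] exhaust_3 [of i] unfolding d.branch_def by auto
    qed
    then show "P \<in> {P \<in> places hc. has_expansion P (\<lambda>t. vector [1, t^4, t])}" if "P \<in> {d.place}" for P
      using d.place_in_places that by blast
  qed
  have c_eq: "hc_to_bring (vector [1, t, t * s]) =
      t *s fourier (quad (t^2 * s - 1) (t - t^2 * s^3) (t^2 - t * s^2) (s - t^2 * s^2))" for t s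
    unfolding hc_to_bring_vector smult_quad
    by (rule fourier_quad_cong) (simp_all add: eval_nat_numeral algebra_simps)
  have "hc_place_to_bring c.place = proj (fourier
      (quad (0^2 * 0 - 1) (0 - 0^2 * 0^3) (0^2 - 0 * 0^2) (0 - 0^2 * 0^2)))"
    by (rule c.place_to_bring [where \<kappa> = "\<lambda>t. t" and j = 1 and
          \<eta> = "\<lambda>t s. quad (t^2 * s - 1) (t - t^2 * s^3) (t^2 - t * s^2) (s - t^2 * s^2)"])
       (auto simp: c_eq intro!: quad_analytic analytic_intros)
  then have c_img: "hc_place_to_bring c.place = proj (fourier (quad (-1) 0 0 0))" by simp
  have d_eq: "hc_to_bring (vector [1, t * s, t]) =
      t *s fourier (quad (s * (t^2 * s - 1)) (t * s^2 - t^2) (t^2 * s^3 - t) (1 - t^2 * s))" for t s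
    unfolding hc_to_bring_vector smult_quad
    by (rule fourier_quad_cong) (simp_all add: eval_nat_numeral algebra_simps)
  have "hc_place_to_bring d.place = proj (fourier
      (quad (0 * (0^2 * 0 - 1)) (0 * 0^2 - 0^2) (0^2 * 0^3 - 0) (1 - 0^2 * 0)))"
    by (rule d.place_to_bring [where \<kappa> = "\<lambda>t. t" and j = 4 and
          \<eta> = "\<lambda>t s. quad (s * (t^2 * s - 1)) (t * s^2 - t^2) (t^2 * s^3 - t) (1 - t^2 * s)"])
       (auto simp: d_eq intro!: quad_analytic analytic_intros)
  then have d_img: "hc_place_to_bring d.place = proj (fourier (quad 0 0 0 1))" by simp
  show thesis by (rule that [OF over c_img d_img c_exp d_exp])
qed

subsection \<open>The smooth points outside the coordinate triangle\<close>

text \<open>The derivative in the direction of \<open>X\<close> is \<open>25 (5 j + 3) = 25 j\<^sup>5 \<noteq> 0\<close>, so \<open>Y\<close> is a local parameter.\<close>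

lemma hc_listed_place:
  assumes \<omega>: "\<omega>^5 = 1" and j: "j^2 = j + 1"
  obtains P where "places_over hc (proj (vector [2 * j * \<omega>, - (j^2 * \<omega>^2), 1])) = {P}"
    "hc_place_to_bring P = proj (fourier (quad (j^2 * \<omega>^4) j (- (j * \<omega>)) (\<omega>^2)))"
proof -
  have \<omega>0: "\<omega> \<noteq> 0" using \<omega> by auto
  have j0: "j \<noteq> 0" using j by auto
  define E where "E t s = (vector [\<omega> * (2 * j + s), \<omega>^2 * (t - j^2), 1] :: complex^3)" for t s
  define g where "g = (\<lambda>(t, s). (2 * j + s) * ((t - j^2)^5 + 1) + ((2 * j + s) * (t - j^2))^2
    - (2 * j + s)^4 * (t - j^2) - 2 * (t - j^2)^3)"
  define gx where "gx = (\<lambda>(t, s). 5 * (2 * j + s) * (t - j^2)^4 + 2 * (2 * j + s)^2 * (t - j^2)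
    - (2 * j + s)^4 - 6 * (t - j^2)^2)"
  define gy where "gy = (\<lambda>(t, s). (t - j^2)^5 + 1 + 2 * (2 * j + s) * (t - j^2)^2 - 4 * (2 * j + s)^3 * (t - j^2))"
  have der: "(g has_derivative (\<lambda>h. gx p * fst h + gy p * snd h)) (at p)" for p
  proof -
    define a b where "a = 2 * j + snd p" and "b = fst p - j^2"
    show ?thesis
      unfolding g_def gx_def gy_def case_prod_unfold
      by (rule derivative_eq_intros refl ext | unfold a_def [symmetric] b_def [symmetric])+
         (simp add: eval_nat_numeral algebra_simps)
  qed
  have cont: "continuous_on UNIV gx" "continuous_on UNIV gy"
    unfolding gx_def gy_def case_prod_unfold by (intro continuous_intros)+
  have hcE: "hc (E t s) = \<omega> * g (t, s)" for t s
    unfolding E_def hc_rotate [OF \<omega>] by (simp add: g_def hc_vector)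
  have z: "g (0, 0) = 0" unfolding g_def using j by simp Groebner_Basis.algebra
  have "gy (0, 0) = 25 * (5 * j + 3)" unfolding gy_def using j by simp Groebner_Basis.algebra
  moreover have "5 * j + 3 \<noteq> 0"
  proof
    assume "5 * j + 3 = 0"
    then have "(1::complex) = 0" using j by Groebner_Basis.algebra
    then show False by simp
  qed
  ultimately have reg: "gy (0, 0) \<noteq> 0" by (metis mult_eq_0_iff zero_neq_numeral)
  interpret hc_chart E g gx gy 0
  proof (unfold_locales)
    show "t = t'" if "proj (E t s) = proj (E t' s')" for t s t' s'
      using that \<omega>0 unfolding E_def by (auto simp: proj_vector_3_eq_iff)
    show "hc (E t s) = 0" if "g (t, s) = 0" for t s using that by (simp add: hcE)
    show "(\<lambda>t. E (u t) (s t) $ i) analytic_on {0}"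
      if "u analytic_on {0}" "s analytic_on {0}" for u s i
      unfolding E_def by (intro vector_3_analytic analytic_intros that)
    show "E t s \<noteq> 0" for t s unfolding E_def by (simp add: vector_3_nonzero)
  qed (rule der cont z reg)+
  have E0: "E 0 0 = vector [2 * j * \<omega>, - (j^2 * \<omega>^2), 1]" by (simp add: E_def mult_ac)
  have over: "places_over hc (proj (vector [2 * j * \<omega>, - (j^2 * \<omega>^2), 1])) = {place}"
  proof (intro equalityI subsetI)
    fix P assume "P \<in> places_over hc (proj (vector [2 * j * \<omega>, - (j^2 * \<omega>^2), 1]))"
    then obtain \<gamma> where \<gamma>: "\<gamma> \<in> branches hc" "proj (\<gamma> 0) = proj (vector [2 * j * \<omega>, - (j^2 * \<omega>^2), 1])" "P = place_of hc \<gamma>"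
      by (rule places_overE)
    obtain w where w: "\<And>i. (\<lambda>t. w t $ i) analytic_on {0}" "w 0 = vector [2 * j * \<omega>, - (j^2 * \<omega>^2), 1]"
      "\<forall>\<^sub>F t in nhds 0. w t $ 3 = 1 \<and> proj (\<gamma> t) = proj (w t) \<and> hc (w t) = 0"
      by (rule branch_affine_coordinates [OF \<gamma>(1,2), of 3]) (simp, blast)
    define u s where "u t = w t $ 2 / \<omega>^2 + j^2" and "s t = w t $ 1 / \<omega> - 2 * j" for t
    have an: "u analytic_on {0}" "s analytic_on {0}"
      unfolding u_def s_def using \<omega>0 by (auto intro!: analytic_intros w(1))
    have us0: "u 0 = 0" "s 0 = 0" unfolding u_def s_def w(2) using \<omega>0 by auto
    have wE: "\<forall>\<^sub>F t in nhds 0. w t = E (u t) (s t)"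
      using w(3) by (rule eventually_mono) (use \<omega>0 in \<open>simp add: E_def u_def s_def vec_eq_iff forall_3\<close>)
    have "\<forall>\<^sub>F t in nhds 0. proj (\<gamma> t) = proj (E (u t) (s t))"
      using w(3) wE by eventually_elim metis
    moreover have "\<forall>\<^sub>F t in nhds 0. g (u t, s t) = 0"
      using w(3) wE
    proof eventually_elim
      case (elim t)
      then have "\<omega> * g (u t, s t) = 0" by (simp flip: hcE)
      then show ?case using \<omega>0 by simp
    qed
    ultimately have "place_of hc \<gamma> = place" by (rule capture [OF \<gamma>(1) an(1) us0(1) an(2) us0(2)])
    then show "P \<in> {place}" using \<gamma>(3) by simp
  next
    show "P \<in> places_over hc (proj (vector [2 * j * \<omega>, - (j^2 * \<omega>^2), 1]))" if "P \<in> {place}" for P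
      using that place_in_places_over unfolding E0 by simp
  qed
  define a b where "a s = 2 * j + s" and "b t = t - j^2" for s t :: complex
  have toE: "hc_to_bring (E t s) = fourier (quad (\<omega>^4 * (b t * (b t - a s^2))) (a s * b t^2 - 1)
      (\<omega> * (b t^3 - a s)) (\<omega>^2 * (a s^2 - b t)))" for t s
    unfolding E_def a_def b_def by (rule hc_to_bring_rotate [OF \<omega>])
  have val: "b 0 * (b 0 - a 0^2) = 5 * j^2 * j^2" "a 0 * b 0^2 - 1 = 5 * j^2 * j"
    "b 0^3 - a 0 = - (5 * j^2 * j)" "a 0^2 - b 0 = 5 * j^2"
    unfolding a_def b_def using j by (simp_all, Groebner_Basis.algebra+)
  have "hc_place_to_bring place = proj (fourier (quad (\<omega>^4 * (b 0 * (b 0 - a 0^2))) (a 0 * b 0^2 - 1)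
      (\<omega> * (b 0^3 - a 0)) (\<omega>^2 * (a 0^2 - b 0))))"
  proof (rule place_to_bring [where \<kappa> = "\<lambda>_. 1" and j = 2 and
          \<eta> = "\<lambda>t s. quad (\<omega>^4 * (b t * (b t - a s^2))) (a s * b t^2 - 1) (\<omega> * (b t^3 - a s)) (\<omega>^2 * (a s^2 - b t))"])
    show "(\<lambda>t. quad (\<omega>^4 * (b (u t) * (b (u t) - a (s t)^2))) (a (s t) * b (u t)^2 - 1) (\<omega> * (b (u t)^3 - a (s t)))
        (\<omega>^2 * (a (s t)^2 - b (u t))) i) analytic_on {0}"
      if "u analytic_on {0}" "s analytic_on {0}" for u s i
      unfolding a_def b_def by (intro quad_analytic analytic_intros that)
    show "quad (\<omega>^4 * (b 0 * (b 0 - a 0^2))) (a 0 * b 0^2 - 1) (\<omega> * (b 0^3 - a 0)) (\<omega>^2 * (a 0^2 - b 0)) 2 \<noteq> 0"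
      unfolding quad_simps val using j0 by simp
  qed (simp_all add: toE)
  also have "\<dots> = proj ((5 * j^2) *s fourier (quad (j^2 * \<omega>^4) j (- (j * \<omega>)) (\<omega>^2)))"
    unfolding val smult_quad by (simp add: mult_ac)
  also have "\<dots> = proj (fourier (quad (j^2 * \<omega>^4) j (- (j * \<omega>)) (\<omega>^2)))"
    using j0 by (intro proj_smult) simp
  finally show thesis using that over by blast
qed

subsection \<open>The nodes on the torus\<close>

text \<open>At the node \<open>[\<omega>:\<omega>\<^sup>2:1]\<close> the tangent slopes \<open>s\<close>, in the coordinates \<open>[\<omega>(1+x):\<omega>\<^sup>2(1+xs):1]\<close>,
  are the roots \<open>-j\<close> and \<open>-(1 - j)\<close> of \<open>s\<^sup>2 + s - 1\<close>. They are simple, because \<open>(1 - 2j)\<^sup>2 = 5\<close>, and so the proper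
  transform \<open>g\<close> is smooth at both.\<close>

lemma hc_node_places:
  assumes \<omega>: "\<omega>^5 = 1" and j: "j^2 = j + 1"
  obtains P Q where "places_over hc (proj (vector [\<omega>, \<omega>^2, 1])) = {P, Q}"
    "hc_place_to_bring P = proj (fourier (quad (j * \<omega>^4) 1 (j^2 * \<omega>) (- (j * \<omega>^2))))"
    "hc_place_to_bring Q = proj (fourier (quad ((1 - j) * \<omega>^4) 1 ((1 - j)^2 * \<omega>) (- ((1 - j) * \<omega>^2))))"
proof -
  have \<omega>0: "\<omega> \<noteq> 0" using \<omega> by auto
  have j': "(1 - j)^2 = (1 - j) + 1" using j by Groebner_Basis.algebra
  define E where "E t s = (vector [\<omega> * (1 + t), \<omega>^2 * (1 + t * s), 1] :: complex^3)" for t s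
  \<comment> \<open>Up to powers of \<open>\<omega>\<close>, the adjoint cubics on \<open>E t s\<close> are \<open>-tAB\<close>, \<open>tC\<close>, \<open>tD\<close> and \<open>tB\<close>.\<close>
  define A B C D where "A t s = 1 + t * s" and "B t s = 2 + t - s"
    and "C t s = 1 + 2 * s + t * s^2 + 2 * t * s + t^2 * s^2"
    and "D t s = 3 * s + 3 * t * s^2 + t^2 * s^3 - 1" for t s :: complex
  note ABCD = A_def B_def C_def D_def
  define g where "g = (\<lambda>(t, s). C t s * D t s - A t s * (B t s)^2)"
  define gx where "gx = (\<lambda>(t, s). (s^2 + 2 * s + 2 * t * s^2) * D t s + C t s * (3 * s^2 + 2 * t * s^3)
    - (s * (B t s)^2 + A t s * (2 * B t s)))"
  define gy where "gy = (\<lambda>(t, s). (2 + 2 * t * s + 2 * t + 2 * t^2 * s) * D t s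
    + C t s * (3 + 6 * t * s + 3 * t^2 * s^2) - (t * (B t s)^2 - 2 * A t s * B t s))"
  have der: "(g has_derivative (\<lambda>h. gx p * fst h + gy p * snd h)) (at p)" for p
    unfolding g_def gx_def gy_def case_prod_unfold ABCD
    by (auto intro!: derivative_eq_intros ext simp: eval_nat_numeral algebra_simps)
  have cont: "continuous_on UNIV gx" "continuous_on UNIV gy"
    unfolding gx_def gy_def case_prod_unfold ABCD by (intro continuous_intros)+
  have hcE: "hc (E t s) = \<omega> * (t^2 * g (t, s))" for t s
    unfolding E_def hc_rotate [OF \<omega>] by (simp add: g_def hc_vector ABCD eval_nat_numeral algebra_simps)
  have g0: "g (0, s) = 5 * (s^2 + s - 1)" for s
    by (simp add: g_def ABCD eval_nat_numeral algebra_simps)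
  have gy0: "gy (0, - k) = 5 * (1 - 2 * k)" for k
    by (simp add: gy_def ABCD eval_nat_numeral algebra_simps)
  have ne: "1 - 2 * k \<noteq> 0" if "k^2 = k + 1" for k :: complex
  proof
    assume "1 - 2 * k = 0"
    then have "(5::complex) = 0" using that by Groebner_Basis.algebra
    then show False by simp
  qed
  have chart: "hc_chart E g gx gy (- k)" if k: "k^2 = k + 1" for k
  proof (unfold_locales)
    show "t = t'" if "proj (E t s) = proj (E t' s')" for t s t' s'
      using that \<omega>0 unfolding E_def by (auto simp: proj_vector_3_eq_iff)
    show "hc (E t s) = 0" if "g (t, s) = 0" for t s using that by (simp add: hcE)
    show "(\<lambda>t. E (u t) (s t) $ i) analytic_on {0}"
      if "u analytic_on {0}" "s analytic_on {0}" for u s i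
      unfolding E_def by (intro vector_3_analytic analytic_intros that)
    show "E t s \<noteq> 0" for t s unfolding E_def by (simp add: vector_3_nonzero)
    show "g (0, - k) = 0" unfolding g0 using k by simp
    show "gy (0, - k) \<noteq> 0" unfolding gy0 using ne [OF k] by simp
  qed (rule der cont)+
  interpret P: hc_chart E g gx gy "- j" by (rule chart [OF j])
  interpret Q: hc_chart E g gx gy "- (1 - j)" by (rule chart [OF j'])
  have E0: "E 0 s = vector [\<omega>, \<omega>^2, 1]" for s by (simp add: E_def)
  have toE: "hc_to_bring (E t s) = t *s fourier (quad (\<omega>^4 * (A t s * (- B t s))) (C t s) (\<omega> * D t s) (\<omega>^2 * B t s))" for t s
    unfolding E_def hc_to_bring_rotate [OF \<omega>] smult_quad
    by (rule fourier_quad_cong) (simp_all add: ABCD eval_nat_numeral algebra_simps)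
  have img: "hc_place_to_bring (hc_chart.place E g (- k)) = proj (fourier (quad (k * \<omega>^4) 1 (k^2 * \<omega>) (- (k * \<omega>^2))))"
    if k: "k^2 = k + 1" for k
  proof -
    interpret K: hc_chart E g gx gy "- k" by (rule chart [OF k])
    have val: "A 0 (- k) * (- B 0 (- k)) = (1 - 2 * k) * k" "C 0 (- k) = 1 - 2 * k"
      "D 0 (- k) = (1 - 2 * k) * k^2" "B 0 (- k) = (1 - 2 * k) * (- k)"
      unfolding ABCD using k by (simp_all, Groebner_Basis.algebra+)
    have "hc_place_to_bring K.place = proj (fourier (quad (\<omega>^4 * (A 0 (- k) * (- B 0 (- k)))) (C 0 (- k)) (\<omega> * D 0 (- k)) (\<omega>^2 * B 0 (- k))))"
    proof (rule K.place_to_bring [where \<kappa> = "\<lambda>t. t" and j = 2 and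
          \<eta> = "\<lambda>t s. quad (\<omega>^4 * (A t s * (- B t s))) (C t s) (\<omega> * D t s) (\<omega>^2 * B t s)"])
      show "(\<lambda>t. quad (\<omega>^4 * (A (u t) (s t) * (- B (u t) (s t)))) (C (u t) (s t)) (\<omega> * D (u t) (s t)) (\<omega>^2 * B (u t) (s t)) i)
          analytic_on {0}"
        if "u analytic_on {0}" "s analytic_on {0}" for u s i
        unfolding ABCD by (intro quad_analytic analytic_intros that)
      show "quad (\<omega>^4 * (A 0 (- k) * (- B 0 (- k)))) (C 0 (- k)) (\<omega> * D 0 (- k)) (\<omega>^2 * B 0 (- k)) 2 \<noteq> 0"
        unfolding quad_simps val using ne [OF k] by simp
    qed (simp_all add: toE)
    also have "\<dots> = proj ((1 - 2 * k) *s fourier (quad (k * \<omega>^4) 1 (k^2 * \<omega>) (- (k * \<omega>^2))))"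
      unfolding val(1) unfolding val(2-4) smult_quad by (simp add: mult_ac)
    also have "\<dots> = proj (fourier (quad (k * \<omega>^4) 1 (k^2 * \<omega>) (- (k * \<omega>^2))))"
      using ne [OF k] by (intro proj_smult) simp
    finally show ?thesis .
  qed
  have "places_over hc (proj (vector [\<omega>, \<omega>^2, 1])) \<subseteq> {P.place, Q.place}"
  proof
    fix R assume "R \<in> places_over hc (proj (vector [\<omega>, \<omega>^2, 1]))"
    then obtain \<gamma> where \<gamma>: "\<gamma> \<in> branches hc" "proj (\<gamma> 0) = proj (vector [\<omega>, \<omega>^2, 1])" "R = place_of hc \<gamma>"
      by (rule places_overE)
    obtain w where w: "\<And>i. (\<lambda>t. w t $ i) analytic_on {0}" "w 0 = vector [\<omega>, \<omega>^2, 1]"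
      "\<forall>\<^sub>F t in nhds 0. w t $ 3 = 1 \<and> proj (\<gamma> t) = proj (w t) \<and> hc (w t) = 0"
      by (rule branch_affine_coordinates [OF \<gamma>(1,2), of 3]) (simp, blast)
    define x y where "x t = w t $ 1 / \<omega> - 1" and "y t = w t $ 2 / \<omega>^2 - 1" for t
    have an: "x analytic_on {0}" "y analytic_on {0}"
      unfolding x_def y_def using \<omega>0 by (auto intro!: analytic_intros w(1))
    have xy0: "x 0 = 0" "y 0 = 0" unfolding x_def y_def w(2) using \<omega>0 by auto
    have vec: "\<forall>\<^sub>F t in nhds 0. w t = vector [\<omega> * (1 + x t), \<omega>^2 * (1 + y t), 1]"
      using w(3) by (rule eventually_mono) (use \<omega>0 in \<open>simp add: x_def y_def vec_eq_iff forall_3\<close>)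
    have curve: "\<forall>\<^sub>F t in nhds 0. hc (vector [\<omega> * (1 + x t), \<omega>^2 * (1 + y t), 1]) = 0 \<and>
        proj (\<gamma> t) = proj (vector [\<omega> * (1 + x t), \<omega>^2 * (1 + y t), 1])"
      using w(3) vec by eventually_elim metis
    have nontriv: "\<not> (\<forall>\<^sub>F t in nhds 0. x t = 0 \<and> y t = 0)"
    proof
      assume "\<forall>\<^sub>F t in nhds 0. x t = 0 \<and> y t = 0"
      with curve have "\<forall>\<^sub>F t in nhds 0. proj (\<gamma> t) = proj (vector [\<omega>, \<omega>^2, 1])"
        by eventually_elim simp
      then show False using branch_not_constant [OF \<gamma>(1)] by blast
    qed
    have main: "R \<in> {P.place, Q.place}"
      if s: "s analytic_on {0}" and ev: "\<forall>\<^sub>F t in nhds 0. y t = x t * s t" for s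
    proof -
      have nz: "\<not> (\<forall>\<^sub>F t in nhds 0. x t = 0)"
      proof
        assume "\<forall>\<^sub>F t in nhds 0. x t = 0"
        with ev have "\<forall>\<^sub>F t in nhds 0. x t = 0 \<and> y t = 0" by eventually_elim simp
        then show False using nontriv by blast
      qed
      have E_ev: "\<forall>\<^sub>F t in nhds 0. proj (\<gamma> t) = proj (E (x t) (s t)) \<and> hc (E (x t) (s t)) = 0"
        using curve ev unfolding E_def by eventually_elim metis
      have "isCont (\<lambda>t. g (x t, s t)) 0"
        unfolding g_def case_prod_conv ABCD
        using analytic_at_imp_isCont [OF an(1)] analytic_at_imp_isCont [OF s] by (intro continuous_intros)
      moreover have "\<forall>\<^sub>F t in nhds 0. (x t)^2 * g (x t, s t) = 0"
        using E_ev by (rule eventually_mono) (use \<omega>0 in \<open>auto simp: hcE\<close>)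
      ultimately have gz: "\<forall>\<^sub>F t in nhds 0. g (x t, s t) = 0"
        by (rule eventually_cancel_square [OF an(1) nz])
      then have "g (x 0, s 0) = 0" by (rule eventually_nhds_x_imp_x)
      then have "5 * ((s 0)^2 + s 0 - 1) = 0" unfolding xy0 g0 .
      then have "(s 0)^2 + s 0 - 1 = 0" by (metis mult_eq_0_iff zero_neq_numeral)
      then have "(s 0 + j) * (s 0 + (1 - j)) = 0" using j by Groebner_Basis.algebra
      then have "s 0 = - j \<or> s 0 = - (1 - j)" by (auto simp: add_eq_0_iff2)
      moreover have ev': "\<forall>\<^sub>F t in nhds 0. proj (\<gamma> t) = proj (E (x t) (s t))"
        using E_ev by (rule eventually_mono) blast
      ultimately have "place_of hc \<gamma> = P.place \<or> place_of hc \<gamma> = Q.place"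
        using P.capture [OF \<gamma>(1) an(1) xy0(1) s _ ev' gz] Q.capture [OF \<gamma>(1) an(1) xy0(1) s _ ev' gz] by blast
      then show ?thesis using \<gamma>(3) by simp
    qed
    from analytic_multiple [OF an]
    show "R \<in> {P.place, Q.place}"
    proof (elim disjE exE conjE)
      fix s assume "s analytic_on {0}" "\<forall>\<^sub>F t in nhds 0. y t = x t * s t"
      then show ?thesis by (rule main)
    next
      fix s assume s: "s analytic_on {0}" and ev: "\<forall>\<^sub>F t in nhds 0. x t = y t * s t"
      have nz: "\<not> (\<forall>\<^sub>F t in nhds 0. y t = 0)"
      proof
        assume "\<forall>\<^sub>F t in nhds 0. y t = 0"
        with ev have "\<forall>\<^sub>F t in nhds 0. x t = 0 \<and> y t = 0" by eventually_elim simp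
        then show False using nontriv by blast
      qed
      \<comment> \<open>The equation of the proper transform in the other blow-up; \<open>G 0 0 = 5\<close> shows that no branch
        is tangent to \<open>x = 0\<close>, so the slope is invertible.\<close>
      define G where "G y s = (s + 2 + y + 2 * y * s + y^2 * s) * (3 + 3 * y + y^2 - s)
        - (1 + y) * (1 - 2 * s - y * s^2)^2" for y s :: complex
      have hcG: "hc (vector [\<omega> * (1 + v * s), \<omega>^2 * (1 + v), 1]) = \<omega> * (v^2 * G v s)" for v s
        unfolding hc_rotate [OF \<omega>] by (simp add: G_def hc_vector eval_nat_numeral algebra_simps)
      have "isCont (\<lambda>t. G (y t) (s t)) 0"
        unfolding G_def using analytic_at_imp_isCont [OF an(2)] analytic_at_imp_isCont [OF s] by (intro continuous_intros)
      moreover have "\<forall>\<^sub>F t in nhds 0. (y t)^2 * G (y t) (s t) = 0"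
        using curve ev by eventually_elim (use \<omega>0 in \<open>auto simp: hcG\<close>)
      ultimately have "\<forall>\<^sub>F t in nhds 0. G (y t) (s t) = 0"
        by (rule eventually_cancel_square [OF an(2) nz])
      then have "G (y 0) (s 0) = 0" by (rule eventually_nhds_x_imp_x)
      then have s0: "s 0 \<noteq> 0" unfolding xy0 G_def by auto
      have "\<forall>\<^sub>F t in nhds 0. s t \<noteq> 0"
        using tendsto_imp_eventually_ne [of s "s 0" "nhds 0" 0] analytic_at_imp_isCont [OF s] s0
        by (simp add: isCont_def tendsto_nhds_iff)
      with ev have "\<forall>\<^sub>F t in nhds 0. y t = x t * (1 / s t)" by eventually_elim simp
      moreover have "(\<lambda>t. 1 / s t) analytic_on {0}" using s s0 by (intro analytic_intros) auto
      ultimately show ?thesis by (intro main)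
    qed
  qed
  moreover have "P.place \<in> places_over hc (proj (vector [\<omega>, \<omega>^2, 1]))"
    "Q.place \<in> places_over hc (proj (vector [\<omega>, \<omega>^2, 1]))"
    using P.place_in_places_over Q.place_in_places_over unfolding E0 by auto
  ultimately have "places_over hc (proj (vector [\<omega>, \<omega>^2, 1])) = {P.place, Q.place}" by auto
  then show thesis using that img [OF j] img [OF j'] by blast
qed

section \<open>The images of the twenty-four places\<close>

lemma zeta_cyclotomic: "1 + \<zeta> + \<zeta>^2 + \<zeta>^3 + \<zeta>^4 = 0"
  using zeta_power_sum [of 1] by (simp add: eval_nat_numeral)

lemma golden_square: "golden^2 = golden + 1"
  unfolding golden_def using zeta_cyclotomic by Groebner_Basis.algebra

lemma golden_conj_eq: "golden_conj = 1 - golden"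
  by (simp add: golden_def golden_conj_def)

lemma golden_conj_square: "golden_conj^2 = golden_conj + 1"
  unfolding golden_conj_eq using golden_square by Groebner_Basis.algebra

text \<open>Both numbers are roots of \<open>x\<^sup>2 = x + 1\<close>, and the real part \<open>2 cos (\<pi> / 5)\<close> of \<open>golden\<close> is positive,
  which excludes \<open>(1 - \<surd>5) / 2\<close>.\<close>

lemma golden_eq_sqrt5: "golden = of_real ((1 + sqrt 5) / 2)"
proof -
  have Re: "Re (\<zeta>^n) = cos (2 * pi * n / 5)" for n
  proof -
    have "\<zeta>^n = exp (of_nat n * (2 * of_real pi * \<i> / 5))"
      unfolding \<zeta>_def by (rule exp_of_nat_mult [symmetric])
    then show ?thesis by (simp add: Re_exp mult_ac)
  qed
  have "cos (2 * pi * 2 / 5) = cos (pi - pi / 5)" "cos (2 * pi * 3 / 5) = cos (pi / 5 + pi)"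
    by (rule arg_cong [where f = cos], simp add: field_simps)+
  then have "Re golden = 2 * cos (pi / 5)"
    unfolding golden_def using Re [of 2] Re [of 3] by (simp only: minus_complex.sel uminus_complex.sel cos_pi_minus cos_periodic_pi) simp
  moreover have "cos (pi / 5) > 0" by (rule cos_gt_zero_pi) (auto simp: field_simps)
  ultimately have pos: "Re golden > 0" by simp
  have s5: "(complex_of_real (sqrt 5))^2 = 5" by (simp flip: of_real_power)
  have "(2 * x - 1 - r) * (2 * x - 1 + r) = 0" if "r^2 = 5" "x^2 = x + 1" for x r :: complex
  proof -
    have "(2 * x - 1 - r) * (2 * x - 1 + r) = 4 * (x^2 - (x + 1)) - (r^2 - 5)"
      by (simp add: power2_eq_square algebra_simps)
    then show ?thesis using that by simp
  qed
  from this [OF s5 golden_square]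
  have "(2 * golden - 1 - of_real (sqrt 5)) * (2 * golden - 1 + of_real (sqrt 5)) = 0" .
  then have "2 * golden - 1 - of_real (sqrt 5) = 0 \<or> 2 * golden - 1 + of_real (sqrt 5) = 0"
    by (simp only: mult_eq_0_iff)
  then show ?thesis
  proof
    assume "2 * golden - 1 - of_real (sqrt 5) = 0"
    then have "2 * golden = of_real (1 + sqrt 5)" by (simp add: algebra_simps)
    then show ?thesis by (simp add: field_simps)
  next
    assume "2 * golden - 1 + of_real (sqrt 5) = 0"
    from arg_cong [OF this, of Re] have "2 * Re golden - 1 + sqrt 5 = 0" by simp
    moreover have "sqrt 5 > 1" by simp
    ultimately show ?thesis using pos by linarith
  qed
qed

lemma golden_plus_2_nonzero:
  fixes j :: complex
  assumes "j^2 = j + 1"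
  shows "j + 2 \<noteq> 0"
proof
  assume "j + 2 = 0"
  then have "(5::complex) = 0" using assms by Groebner_Basis.algebra
  then show False by simp
qed

lemma golden_power5_inj:
  fixes j k :: complex
  assumes j: "j^2 = j + 1" and k: "k^2 = k + 1" and eq: "j^5 = k^5"
  shows "j = k"
proof -
  have "j^5 = 5 * j + 3" using j by Groebner_Basis.algebra
  moreover have "k^5 = 5 * k + 3" using k by Groebner_Basis.algebra
  ultimately have "5 * j + 3 = 5 * k + 3" using eq by metis
  then show ?thesis by simp
qed

lemma golden_power10:
  fixes j :: complex
  assumes j: "j^2 = j + 1"
  shows "j^10 \<noteq> -1"
proof
  assume "j^10 = -1"
  then have "55 * j + 35 = 0" using j by Groebner_Basis.algebra
  then have "(11::complex) * j = -7" by (simp add: add_eq_0_iff2)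
  then have "(5::complex) = 0" using j by Groebner_Basis.algebra
  then show False by simp
qed

lemma golden_ne_conj: "golden \<noteq> golden_conj"
proof
  assume "golden = golden_conj"
  then have "2 * golden = 1" unfolding golden_conj_eq by (simp add: algebra_simps)
  then have "(5::complex) = 0" using golden_square by Groebner_Basis.algebra
  then show False by simp
qed

lemma zeta_power_mod: "\<zeta>^n = \<zeta>^(n mod 5)"
proof -
  have "\<zeta>^n = \<zeta>^(5 * (n div 5) + n mod 5)" by simp
  then show ?thesis by (simp only: power_add power_mult zeta_pow5 power_one mult_1)
qed

lemma zeta_power_cong: "m mod 5 = n mod 5 \<Longrightarrow> \<zeta>^m = \<zeta>^n"
  using zeta_power_mod by metis

lemma zeta_power_vector_root:
  assumes "{a0 mod 5, a1 mod 5, a2 mod 5, a3 mod 5, a4 mod 5} = {0, 1, 2, 3, 4}"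
  shows "vector [\<zeta>^a0, \<zeta>^a1, \<zeta>^a2, \<zeta>^a3, \<zeta>^a4] \<in> root_vectors" (is "?v \<in> _")
proof -
  have five: "{..<5} = {0, 1, 2, 3, 4::nat}" by auto
  have "range (($) ?v) = (\<lambda>n. \<zeta>^n) ` {a0 mod 5, a1 mod 5, a2 mod 5, a3 mod 5, a4 mod 5}"
    unfolding UNIV_5 by (simp add: vector_5 zeta_power_mod [symmetric])
  then have range: "range (($) ?v) = fifth_roots" unfolding assms fifth_roots_eq five .
  then have "inj (($) ?v)" by (intro eq_card_imp_inj_on) (simp_all add: card_fifth_roots)
  then show ?thesis using range unfolding root_vectors_def fifth_roots_def by auto
qed

lemma sum_1_4: "(\<Sum>j=1..4. f j) = f 1 + f 2 + f 3 + (f 4 :: complex)" for f :: "nat \<Rightarrow> complex"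
  by (simp add: eval_nat_numeral)

lemma fourier_quad: "fourier (quad y1 y2 y3 y4) = vector
   [y1 + y2 + y3 + y4,
    y1 * \<zeta>^1 + y2 * \<zeta>^2 + y3 * \<zeta>^3 + y4 * \<zeta>^4,
    y1 * \<zeta>^2 + y2 * \<zeta>^4 + y3 * \<zeta>^6 + y4 * \<zeta>^8,
    y1 * \<zeta>^3 + y2 * \<zeta>^6 + y3 * \<zeta>^9 + y4 * \<zeta>^12,
    y1 * \<zeta>^4 + y2 * \<zeta>^8 + y3 * \<zeta>^12 + y4 * \<zeta>^16]"
  unfolding vec_eq_iff forall_5 fourier_nth vector_5 sum_1_4 by simp

lemma proj_smult_root_vector:
  assumes "c \<noteq> 0" "x \<in> root_vectors"
  shows "proj (c *s x) \<in> zeta_orbit"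
  using assms by (simp add: proj_smult zeta_orbit_def)

lemma corner_image_in_orbit:
  assumes "c \<noteq> 0"
  shows "proj (fourier (quad c 0 0 0)) \<in> zeta_orbit" "proj (fourier (quad 0 c 0 0)) \<in> zeta_orbit"
    "proj (fourier (quad 0 0 c 0)) \<in> zeta_orbit" "proj (fourier (quad 0 0 0 c)) \<in> zeta_orbit"
proof -
  have *: "proj (fourier y) \<in> zeta_orbit"
    if "fourier y = c *s vector [\<zeta>^a0, \<zeta>^a1, \<zeta>^a2, \<zeta>^a3, \<zeta>^a4]"
      "{a0 mod 5, a1 mod 5, a2 mod 5, a3 mod 5, a4 mod 5} = {0, 1, 2, 3, 4}" for y a0 a1 a2 a3 a4
    unfolding that(1) by (rule proj_smult_root_vector [OF assms zeta_power_vector_root [OF that(2)]])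
  show "proj (fourier (quad c 0 0 0)) \<in> zeta_orbit"
    by (rule * [where ?a0.0 = 0 and ?a1.0 = 1 and ?a2.0 = 2 and ?a3.0 = 3 and ?a4.0 = 4])
       (auto simp: fourier_quad vec_eq_iff forall_5 vector_5)
  show "proj (fourier (quad 0 c 0 0)) \<in> zeta_orbit"
    by (rule * [where ?a0.0 = 0 and ?a1.0 = 2 and ?a2.0 = 4 and ?a3.0 = 6 and ?a4.0 = 8])
       (auto simp: fourier_quad vec_eq_iff forall_5 vector_5)
  show "proj (fourier (quad 0 0 c 0)) \<in> zeta_orbit"
    by (rule * [where ?a0.0 = 0 and ?a1.0 = 3 and ?a2.0 = 6 and ?a3.0 = 9 and ?a4.0 = 12])
       (auto simp: fourier_quad vec_eq_iff forall_5 vector_5)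
  show "proj (fourier (quad 0 0 0 c)) \<in> zeta_orbit"
    by (rule * [where ?a0.0 = 0 and ?a1.0 = 4 and ?a2.0 = 8 and ?a3.0 = 12 and ?a4.0 = 16])
       (auto simp: fourier_quad vec_eq_iff forall_5 vector_5)
qed

lemma cube_mod_5_inj:
  fixes a b :: nat
  assumes "a^3 mod 5 = b^3 mod 5"
  shows "a mod 5 = b mod 5"
proof -
  have *: "x = y" if "x^3 mod 5 = y^3 mod 5" "x \<in> {0, 1, 2, 3, 4}" "y \<in> {0, 1, 2, 3, 4}" for x y :: nat
    using that by (elim insertE emptyE) simp_all
  have "(a mod 5)^3 mod 5 = (b mod 5)^3 mod 5" using assms by (simp only: power_mod)
  then show ?thesis by (rule *) auto
qed

text \<open>Cubing is a bijection modulo 5 because \<open>3\<close> is prime to \<open>4\<close>.\<close>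

lemma cubic_permutation:
  assumes "e \<in> {1, 2, 3, 4::nat}"
  shows "(\<lambda>k. (3 * m + e * (k + m)^3) mod 5) ` {0, 1, 2, 3, 4} = {0, 1, 2, 3, 4}"
proof (rule endo_inj_surj)
  have e: "coprime e 5" using prime_imp_coprime [of 5 e] assms by (auto simp: coprime_commute)
  show "(\<lambda>k. (3 * m + e * (k + m)^3) mod 5) ` {0, 1, 2, 3, 4} \<subseteq> {0, 1, 2, 3, 4}"
    by (rule image_subsetI) auto
  show "inj_on (\<lambda>k. (3 * m + e * (k + m)^3) mod 5) {0, 1, 2, 3, 4}"
  proof (rule inj_onI)
    fix k l :: nat assume k: "k \<in> {0, 1, 2, 3, 4}" and l: "l \<in> {0, 1, 2, 3, 4}"
      and eq: "(3 * m + e * (k + m)^3) mod 5 = (3 * m + e * (l + m)^3) mod 5"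
    have shift: "(r + a) mod 5 = (r + b) mod 5 \<Longrightarrow> a mod 5 = b mod 5" for r a b :: nat
      using cong_add_lcancel_nat [of r a b 5] unfolding cong_def by blast
    have scale: "e * a mod 5 = e * b mod 5 \<Longrightarrow> a mod 5 = b mod 5" for a b :: nat
      using cong_mult_lcancel_nat [of e 5 a b] e unfolding cong_def by blast
    have "(m + k) mod 5 = (m + l) mod 5"
      using cube_mod_5_inj [OF scale [OF shift [OF eq]]] by (simp only: add.commute)
    from shift [OF this] show "k = l" using k l by auto
  qed
qed simp
text \<open>Replacing \<open>\<omega> = 1\<close> by \<open>\<omega> = \<zeta>\<^sup>m\<close> shifts the index \<open>k\<close> by \<open>m\<close>, up to the factor \<open>\<zeta>\<^bsup>3m\<^esup>\<close>; so the values
  at \<open>\<omega> = 1\<close>, which the first hypothesis gives, determine all of them.\<close>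

lemma cubic_image_in_orbit:
  assumes f: "\<And>n. n < 5 \<Longrightarrow> y1 * \<zeta>^n + y2 * \<zeta>^(2 * n mod 5) + y3 * \<zeta>^(3 * n mod 5) + y4 * \<zeta>^(4 * n mod 5)
      = d * \<zeta>^(e * n^3 mod 5)"
    and e: "e \<in> {1, 2, 3, 4}" and d: "d \<noteq> 0" and \<omega>: "\<omega>^5 = 1"
  shows "proj (fourier (quad (y1 * \<omega>^4) y2 (y3 * \<omega>) (y4 * \<omega>^2))) \<in> zeta_orbit"
proof -
  obtain m where m: "m < 5" "\<omega> = \<zeta>^m" using \<omega> by (rule fifth_rootE)
  have entry: "y1 * \<omega>^4 * \<zeta>^k + y2 * \<zeta>^(2 * k) + y3 * \<omega> * \<zeta>^(3 * k) + y4 * \<omega>^2 * \<zeta>^(4 * k)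
      = d * \<zeta>^(3 * m + e * (k + m)^3)" for k
  proof -
    define n where "n = (k + m) mod 5"
    have r: "\<zeta>^(3 * m) * \<zeta>^(i * n mod 5) = \<zeta>^(3 * m + i * (k + m))" for i
      unfolding power_add [symmetric] n_def by (rule zeta_power_cong) (simp only: mod_simps)
    have shift: "\<zeta>^a = \<zeta>^b" if "a = b + 5 * c" for a b c
      using that by (simp add: power_add power_mult zeta_pow5)
    have "\<zeta>^(3 * m) * \<zeta>^n = \<zeta>^(3 * m + (k + m))" using r [of 1] by (simp add: n_def)
    also have "\<dots> = \<omega>^4 * \<zeta>^k" unfolding m(2) power_add [symmetric] power_mult [symmetric] by (simp add: algebra_simps)
    finally have p1: "\<omega>^4 * \<zeta>^k = \<zeta>^(3 * m) * \<zeta>^n" ..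
    have p2: "\<zeta>^(2 * k) = \<zeta>^(3 * m) * \<zeta>^(2 * n mod 5)"
      unfolding r by (rule shift [symmetric, of _ _ m]) simp
    have p3: "\<omega> * \<zeta>^(3 * k) = \<zeta>^(3 * m) * \<zeta>^(3 * n mod 5)"
      unfolding r unfolding m(2) power_add [symmetric] by (rule shift [symmetric, of _ _ m]) simp
    have p4: "\<omega>^2 * \<zeta>^(4 * k) = \<zeta>^(3 * m) * \<zeta>^(4 * n mod 5)"
      unfolding r unfolding m(2) power_add [symmetric] power_mult [symmetric] by (rule shift [symmetric, of _ _ m]) simp
    note p = p1 p2 p3 p4
    have q: "\<zeta>^(3 * m + e * (k + m)^3) = \<zeta>^(3 * m) * \<zeta>^(e * n^3 mod 5)"
      unfolding power_add [symmetric] n_def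
      by (rule zeta_power_cong) (metis mod_add_right_eq mod_mult_right_eq power_mod)
    have "y1 * (\<omega>^4 * \<zeta>^k) + y2 * \<zeta>^(2 * k) + y3 * (\<omega> * \<zeta>^(3 * k)) + y4 * (\<omega>^2 * \<zeta>^(4 * k))
      = \<zeta>^(3 * m) * (y1 * \<zeta>^n + y2 * \<zeta>^(2 * n mod 5) + y3 * \<zeta>^(3 * n mod 5) + y4 * \<zeta>^(4 * n mod 5))"
      unfolding p by (simp only: algebra_simps)
    also have "\<dots> = \<zeta>^(3 * m) * (d * \<zeta>^(e * n^3 mod 5))" by (subst f) (simp_all add: n_def)
    finally show ?thesis unfolding q by (simp only: mult_ac)
  qed
  have "fourier (quad (y1 * \<omega>^4) y2 (y3 * \<omega>) (y4 * \<omega>^2)) = d *s vector [\<zeta>^(3 * m + e * (0 + m)^3),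
     \<zeta>^(3 * m + e * (1 + m)^3), \<zeta>^(3 * m + e * (2 + m)^3), \<zeta>^(3 * m + e * (3 + m)^3), \<zeta>^(3 * m + e * (4 + m)^3)]"
    unfolding vec_eq_iff forall_5 fourier_quad vector_5 vector_smult_component
    using entry [of 0] entry [of 1] entry [of 2] entry [of 3] entry [of 4] by simp
  moreover have "vector [\<zeta>^(3 * m + e * (0 + m)^3),
     \<zeta>^(3 * m + e * (1 + m)^3), \<zeta>^(3 * m + e * (2 + m)^3), \<zeta>^(3 * m + e * (3 + m)^3), \<zeta>^(3 * m + e * (4 + m)^3)] \<in> root_vectors"
    using cubic_permutation [OF e] by (intro zeta_power_vector_root) (simp only: image_insert image_empty)
  ultimately show ?thesis using proj_smult_root_vector [OF d] by simp
qed

text \<open>For \<open>\<omega> = 1\<close> the \<open>n\<close>-th coordinate is \<open>(j + 2) \<zeta>\<^bsup>en\<^sup>3\<^esup>\<close>, where \<open>e = 1\<close> for \<open>golden\<close> and \<open>e = 4\<close> for its conjugate.\<close>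

lemma smooth_image_in_orbit:
  assumes j: "j \<in> {golden, golden_conj}" and \<omega>: "\<omega>^5 = 1"
  shows "proj (fourier (quad (j^2 * \<omega>^4) j (- (j * \<omega>)) (\<omega>^2))) \<in> zeta_orbit"
proof -
  have "j^2 = j + 1" using j golden_square golden_conj_square by auto
  then have d: "j + 2 \<noteq> 0" by (rule golden_plus_2_nonzero)
  have split: "n < 5 \<Longrightarrow> n = 0 \<or> n = 1 \<or> n = 2 \<or> n = 3 \<or> n = 4" for n :: nat by auto
  from j consider "j = - (\<zeta>^3) - \<zeta>^2" | "j = \<zeta>^3 + \<zeta>^2 + 1" by (auto simp: golden_def golden_conj_def)
  then show ?thesis
  proof cases
    case 1
    have "j^2 * 1 + j * 1 + - j * 1 + 1 * 1 = (j + 2) * 1"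
      "j^2 * \<zeta> + j * \<zeta>^2 + - j * \<zeta>^3 + 1 * \<zeta>^4 = (j + 2) * \<zeta>"
      "j^2 * \<zeta>^2 + j * \<zeta>^4 + - j * \<zeta> + 1 * \<zeta>^3 = (j + 2) * \<zeta>^3"
      "j^2 * \<zeta>^3 + j * \<zeta> + - j * \<zeta>^4 + 1 * \<zeta>^2 = (j + 2) * \<zeta>^2"
      "j^2 * \<zeta>^4 + j * \<zeta>^3 + - j * \<zeta>^2 + 1 * \<zeta> = (j + 2) * \<zeta>^4"
      unfolding \<open>j = - (\<zeta>^3) - \<zeta>^2\<close> using zeta_cyclotomic by Groebner_Basis.algebra+
    then have "proj (fourier (quad (j^2 * \<omega>^4) (j) (- j * \<omega>) (1 * \<omega>^2))) \<in> zeta_orbit"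
      by (intro cubic_image_in_orbit [where d = "j + 2" and e = 1, OF _ _ d \<omega>])
         (auto dest!: split)
    then show ?thesis by simp
  next
    case 2
    have "j^2 * 1 + j * 1 + - j * 1 + 1 * 1 = (j + 2) * 1"
      "j^2 * \<zeta> + j * \<zeta>^2 + - j * \<zeta>^3 + 1 * \<zeta>^4 = (j + 2) * \<zeta>^4"
      "j^2 * \<zeta>^2 + j * \<zeta>^4 + - j * \<zeta> + 1 * \<zeta>^3 = (j + 2) * \<zeta>^2"
      "j^2 * \<zeta>^3 + j * \<zeta> + - j * \<zeta>^4 + 1 * \<zeta>^2 = (j + 2) * \<zeta>^3"
      "j^2 * \<zeta>^4 + j * \<zeta>^3 + - j * \<zeta>^2 + 1 * \<zeta> = (j + 2) * \<zeta>"
      unfolding \<open>j = \<zeta>^3 + \<zeta>^2 + 1\<close> using zeta_cyclotomic by Groebner_Basis.algebra+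
    then have "proj (fourier (quad (j^2 * \<omega>^4) (j) (- j * \<omega>) (1 * \<omega>^2))) \<in> zeta_orbit"
      by (intro cubic_image_in_orbit [where d = "j + 2" and e = 4, OF _ _ d \<omega>])
         (auto dest!: split)
    then show ?thesis by simp
  qed
qed

text \<open>As for the smooth points, now with \<open>e = 2\<close> for \<open>golden\<close> and \<open>e = 3\<close> for its conjugate.\<close>

lemma node_image_in_orbit:
  assumes j: "j \<in> {golden, golden_conj}" and \<omega>: "\<omega>^5 = 1"
  shows "proj (fourier (quad (j * \<omega>^4) 1 (j^2 * \<omega>) (- (j * \<omega>^2)))) \<in> zeta_orbit"
proof -
  have "j^2 = j + 1" using j golden_square golden_conj_square by auto
  then have d: "j + 2 \<noteq> 0" by (rule golden_plus_2_nonzero)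
  have split: "n < 5 \<Longrightarrow> n = 0 \<or> n = 1 \<or> n = 2 \<or> n = 3 \<or> n = 4" for n :: nat by auto
  from j consider "j = - (\<zeta>^3) - \<zeta>^2" | "j = \<zeta>^3 + \<zeta>^2 + 1" by (auto simp: golden_def golden_conj_def)
  then show ?thesis
  proof cases
    case 1
    have "j * 1 + 1 * 1 + j^2 * 1 + - j * 1 = (j + 2) * 1"
      "j * \<zeta> + 1 * \<zeta>^2 + j^2 * \<zeta>^3 + - j * \<zeta>^4 = (j + 2) * \<zeta>^2"
      "j * \<zeta>^2 + 1 * \<zeta>^4 + j^2 * \<zeta> + - j * \<zeta>^3 = (j + 2) * \<zeta>"
      "j * \<zeta>^3 + 1 * \<zeta> + j^2 * \<zeta>^4 + - j * \<zeta>^2 = (j + 2) * \<zeta>^4"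
      "j * \<zeta>^4 + 1 * \<zeta>^3 + j^2 * \<zeta>^2 + - j * \<zeta> = (j + 2) * \<zeta>^3"
      unfolding \<open>j = - (\<zeta>^3) - \<zeta>^2\<close> using zeta_cyclotomic by Groebner_Basis.algebra+
    then have "proj (fourier (quad (j * \<omega>^4) (1) (j^2 * \<omega>) (- j * \<omega>^2))) \<in> zeta_orbit"
      by (intro cubic_image_in_orbit [where d = "j + 2" and e = 2, OF _ _ d \<omega>])
         (auto dest!: split)
    then show ?thesis by simp
  next
    case 2
    have "j * 1 + 1 * 1 + j^2 * 1 + - j * 1 = (j + 2) * 1"
      "j * \<zeta> + 1 * \<zeta>^2 + j^2 * \<zeta>^3 + - j * \<zeta>^4 = (j + 2) * \<zeta>^3"
      "j * \<zeta>^2 + 1 * \<zeta>^4 + j^2 * \<zeta> + - j * \<zeta>^3 = (j + 2) * \<zeta>^4"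
      "j * \<zeta>^3 + 1 * \<zeta> + j^2 * \<zeta>^4 + - j * \<zeta>^2 = (j + 2) * \<zeta>"
      "j * \<zeta>^4 + 1 * \<zeta>^3 + j^2 * \<zeta>^2 + - j * \<zeta> = (j + 2) * \<zeta>^2"
      unfolding \<open>j = \<zeta>^3 + \<zeta>^2 + 1\<close> using zeta_cyclotomic by Groebner_Basis.algebra+
    then have "proj (fourier (quad (j * \<omega>^4) (1) (j^2 * \<omega>) (- j * \<omega>^2))) \<in> zeta_orbit"
      by (intro cubic_image_in_orbit [where d = "j + 2" and e = 3, OF _ _ d \<omega>])
         (auto dest!: split)
    then show ?thesis by simp
  qed
qed

section \<open>Face-centres and places\<close>

text \<open>The 24 places: \<open>Corner i\<close> maps to the \<open>i\<close>-th unit vector of Fourier coordinates, \<open>Smooth j \<omega>\<close> stands for the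
  listed point \<open>[2j\<omega> : -j\<^sup>2\<omega>\<^sup>2 : 1]\<close>, and \<open>Node j \<omega>\<close> for the branch of slope \<open>-j\<close> over \<open>[\<omega> : \<omega>\<^sup>2 : 1]\<close>.\<close>

datatype face_label = Corner nat | Smooth complex complex | Node complex complex

fun face_coords :: "face_label \<Rightarrow> nat \<Rightarrow> complex" where
  "face_coords (Corner i) = (\<lambda>n. if n = i then 1 else 0)"
| "face_coords (Smooth j \<omega>) = quad (j^2 * \<omega>^4) j (- (j * \<omega>)) (\<omega>^2)"
| "face_coords (Node j \<omega>) = quad (j * \<omega>^4) 1 (j^2 * \<omega>) (- (j * \<omega>^2))"

definition face_labels :: "face_label set" where
  "face_labels = Corner ` {1..4} \<union> case_prod Smooth ` ({golden, golden_conj} \<times> fifth_roots)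
    \<union> case_prod Node ` ({golden, golden_conj} \<times> fifth_roots)"

definition face_point :: "face_label \<Rightarrow> (complex^5) set" where
  "face_point l = proj (fourier (face_coords l))"

lemma card_face_labels: "card face_labels = 24"
proof -
  have "card (Corner ` {1..4}) = 4" by (subst card_image) (auto simp: inj_on_def)
  moreover have "card (case_prod Smooth ` ({golden, golden_conj} \<times> fifth_roots)) = 10"
    "card (case_prod Node ` ({golden, golden_conj} \<times> fifth_roots)) = 10"
    by (subst card_image; auto simp: inj_on_def card_cartesian_product card_fifth_roots golden_ne_conj)+
  ultimately show ?thesis
    unfolding face_labels_def using finite_fifth_roots by (subst card_Un_disjoint; auto)+
qed

lemma fourier_Corner:
  "fourier (face_coords (Corner 1)) = fourier (quad 1 0 0 0)" "fourier (face_coords (Corner 2)) = fourier (quad 0 1 0 0)"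
  "fourier (face_coords (Corner 3)) = fourier (quad 0 0 1 0)" "fourier (face_coords (Corner 4)) = fourier (quad 0 0 0 1)"
  by (rule fourier_quad_eqI; simp)+

lemma face_label_cases:
  assumes "l \<in> face_labels"
  obtains (Corner) i where "l = Corner i" "i = 1 \<or> i = 2 \<or> i = 3 \<or> i = 4"
    | (Smooth) j \<omega> where "l = Smooth j \<omega>" "j \<in> {golden, golden_conj}" "\<omega>^5 = 1"
    | (Node) j \<omega> where "l = Node j \<omega>" "j \<in> {golden, golden_conj}" "\<omega>^5 = 1"
proof -
  have "(\<exists>i\<in>{1..4}. l = Corner i) \<or> (\<exists>j\<in>{golden, golden_conj}. \<exists>\<omega>\<in>fifth_roots. l = Smooth j \<omega>)
      \<or> (\<exists>j\<in>{golden, golden_conj}. \<exists>\<omega>\<in>fifth_roots. l = Node j \<omega>)"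
    using assms unfolding face_labels_def by auto
  then show thesis
  proof (elim disjE bexE)
    fix i :: nat assume "i \<in> {1..4}" "l = Corner i"
    moreover from this have "i = 1 \<or> i = 2 \<or> i = 3 \<or> i = 4" by auto
    ultimately show thesis by (intro that(1))
  qed (rule that(2,3), auto simp: fifth_roots_def)+
qed

lemma face_point_in_orbit:
  assumes "l \<in> face_labels"
  shows "face_point l \<in> zeta_orbit"
  using assms
proof (cases rule: face_label_cases)
  case Corner
  then show ?thesis unfolding face_point_def using corner_image_in_orbit [of 1] fourier_Corner by auto
next
  case Smooth
  then show ?thesis unfolding face_point_def using smooth_image_in_orbit by simp
next
  case Node
  then show ?thesis unfolding face_point_def using node_image_in_orbit by simp
qed

text \<open>The twenty coordinate vectors without zeros are told apart by the ratios of the coordinates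
  \<open>y\<^sub>1, y\<^sub>2, y\<^sub>3\<close>: \<open>(y\<^sub>1 / y\<^sub>2)\<^sup>5 = j\<^sup>5\<close> gives \<open>j\<close>, and \<open>y\<^sub>3 / y\<^sub>2\<close> is \<open>-\<omega>\<close> at a smooth point but \<open>j\<^sup>2\<omega>\<close> at a node.\<close>

definition ratio_factor :: "face_label \<Rightarrow> complex" where
  "ratio_factor l = (case l of Corner i \<Rightarrow> 0 | Smooth j \<omega> \<Rightarrow> -1 | Node j \<omega> \<Rightarrow> j^2)"

lemma full_label_cases:
  assumes "l \<in> face_labels" "\<And>i. l \<noteq> Corner i"
  obtains j \<omega> where "l = Smooth j \<omega> \<or> l = Node j \<omega>" "j^2 = j + 1" "\<omega>^5 = 1"
    "(face_coords l 1)^5 = j^5 * (face_coords l 2)^5" "face_coords l 3 = ratio_factor l * \<omega> * face_coords l 2"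
    "\<And>i. face_coords l i \<noteq> 0"
proof -
  obtain j \<omega> where l: "l = Smooth j \<omega> \<or> l = Node j \<omega>" "j \<in> {golden, golden_conj}" "\<omega>^5 = 1"
    using assms by (cases rule: face_label_cases) metis+
  have j: "j^2 = j + 1" using l(2) golden_square golden_conj_square by auto
  have nz: "j \<noteq> 0" "\<omega> \<noteq> 0" using j l(3) by auto
  have w20: "\<omega>^20 = 1" using power_mult [of \<omega> 5 4] l(3) by simp
  have j10: "(j^2)^5 = j^5 * j^5" by (simp add: power_mult [symmetric] power_add [symmetric])
  show thesis
  proof (rule that [OF l(1) j l(3)])
    show "(face_coords l 1)^5 = j^5 * (face_coords l 2)^5"
      using l(1) by (auto simp: power_mult_distrib w20 j10)
    show "face_coords l 3 = ratio_factor l * \<omega> * face_coords l 2"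
      using l(1) by (auto simp: ratio_factor_def)
    show "face_coords l i \<noteq> 0" for i
      using l(1) nz by (auto simp: quad_def split: if_splits)
  qed
qed

lemma face_point_inj: "inj_on face_point face_labels"
proof (rule inj_onI)
  fix l l' assume l: "l \<in> face_labels" and l': "l' \<in> face_labels" and eq: "face_point l = face_point l'"
  obtain k where k: "k \<noteq> 0" "fourier (face_coords l') = k *s fourier (face_coords l)"
    using eq proj_eq_iff unfolding face_point_def by metis
  have y: "face_coords l' i = k * face_coords l i" if "i \<in> {1..4}" for i
    using fourier_inj [OF k(2) that] .
  have corner: "i \<in> {1..4}" if "Corner i \<in> face_labels" for i
    using that unfolding face_labels_def by auto
  have other: "\<exists>n\<in>{1..4}. n \<noteq> i" for i :: nat by (rule bexI [of _ "if i = 1 then 2 else 1"]) auto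
  show "l = l'"
  proof (cases "\<exists>i. l = Corner i")
    case True
    then obtain i where i: "l = Corner i" by blast
    show ?thesis
    proof (cases "\<exists>i'. l' = Corner i'")
      case True
      then obtain i' where i': "l' = Corner i'" by blast
      have "face_coords l' i' = k * face_coords l i'" using corner l' i' by (intro y) simp
      then show ?thesis using i i' by (auto split: if_splits)
    next
      case False
      obtain n where n: "n \<in> {1..4}" "n \<noteq> i" using other by blast
      have "face_coords l' n = 0" using y [OF n(1)] n(2) i by simp
      moreover have "face_coords l' n \<noteq> 0" using full_label_cases [OF l'] False by metis
      ultimately show ?thesis by blast
    qed
  next
    case False
    show ?thesis
    proof (cases "\<exists>i'. l' = Corner i'")
      case True
      then obtain i' where i': "l' = Corner i'" by blast
      obtain n where n: "n \<in> {1..4}" "n \<noteq> i'" using other by blast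
      have "face_coords l n = 0" using y [OF n(1)] n(2) i' k(1) by simp
      moreover have "face_coords l n \<noteq> 0" using full_label_cases [OF l] False by metis
      ultimately show ?thesis by blast
    next
      case False': False
      obtain j \<omega> where 1: "l = Smooth j \<omega> \<or> l = Node j \<omega>" "j^2 = j + 1" "\<omega>^5 = 1"
        "(face_coords l 1)^5 = j^5 * (face_coords l 2)^5" "face_coords l 3 = ratio_factor l * \<omega> * face_coords l 2"
        "\<And>i. face_coords l i \<noteq> 0"
        by (rule full_label_cases [OF l]) (use False in blast)+
      obtain j' \<omega>' where 2: "l' = Smooth j' \<omega>' \<or> l' = Node j' \<omega>'" "j'^2 = j' + 1" "\<omega>'^5 = 1"
        "(face_coords l' 1)^5 = j'^5 * (face_coords l' 2)^5" "face_coords l' 3 = ratio_factor l' * \<omega>' * face_coords l' 2"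
        "\<And>i. face_coords l' i \<noteq> 0"
        by (rule full_label_cases [OF l']) (use False' in blast)+
      have y1: "face_coords l' 1 = k * face_coords l 1" and y2: "face_coords l' 2 = k * face_coords l 2"
        and y3: "face_coords l' 3 = k * face_coords l 3" by (rule y; simp)+
      have "k^5 * (j^5 * (face_coords l 2)^5) = j'^5 * (k * face_coords l 2)^5"
        using 2(4) unfolding y1 y2 power_mult_distrib 1(4) .
      then have "j^5 = j'^5" using k(1) 1(6) [of 2] by (simp add: power_mult_distrib)
      then have jj: "j = j'" using 1(2) 2(2) by (rule golden_power5_inj [rotated 2])
      have "k * (ratio_factor l * \<omega> * face_coords l 2) = ratio_factor l' * \<omega>' * (k * face_coords l 2)"
        using 2(5) unfolding y2 y3 1(5) .
      then have rw: "ratio_factor l * \<omega> = ratio_factor l' * \<omega>'" using k(1) 1(6) [of 2] by simp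
      then have "(ratio_factor l * \<omega>)^5 = (ratio_factor l' * \<omega>')^5" by simp
      then have r5: "(ratio_factor l)^5 = (ratio_factor l')^5" by (simp add: power_mult_distrib 1(3) 2(3))
      have "(j^2)^5 \<noteq> -1" using golden_power10 [OF 1(2)] by (simp add: power_mult [symmetric])
      moreover have "j \<noteq> 0" using 1(2) by auto
      ultimately show ?thesis
        using 1(1) 2(1) r5 rw jj by (auto simp: ratio_factor_def)
    qed
  qed
qed

text \<open>Twenty-four distinct images in an orbit of size 24.\<close>

lemma face_point_bij: "bij_betw face_point face_labels zeta_orbit"
proof -
  have fin: "finite zeta_orbit" using card_zeta_orbit by (metis card.infinite zero_neq_numeral)
  have "face_point ` face_labels = zeta_orbit"
  proof (rule card_subset_eq [OF fin])
    show "face_point ` face_labels \<subseteq> zeta_orbit" using face_point_in_orbit by blast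
    show "card (face_point ` face_labels) = card zeta_orbit"
      by (simp add: card_image [OF face_point_inj] card_face_labels card_zeta_orbit)
  qed
  then show ?thesis using face_point_inj by (simp add: bij_betw_def)
qed

definition smooth_point :: "complex \<Rightarrow> complex \<Rightarrow> complex^3" where
  "smooth_point j \<omega> = vector [2 * j * \<omega>, - (j^2 * \<omega>^2), 1]"

lemma hc_listed_points_eq: "hc_listed_points = map (\<lambda>(j, m). smooth_point j (\<zeta>^m))
   [(golden, 0), (golden_conj, 4), (golden, 4), (golden, 2), (golden_conj, 1), (golden_conj, 3),
    (golden_conj, 2), (golden_conj, 0), (golden, 1), (golden, 3)]"
proof -
  have v: "vector [a, b, 1] = smooth_point j \<omega>" if "a = 2 * j * \<omega>" "b = - (j^2 * \<omega>^2)" for a b j \<omega>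
    using that by (simp add: smooth_point_def)
  have
    "vector [- 2*\<zeta>^3 - 2*\<zeta>^2, \<zeta>^3 + \<zeta>^2 - 1, 1] = smooth_point golden 1"
    "vector [2*\<zeta>^3 + 2*\<zeta>^2 + 2, - (\<zeta>^3) - \<zeta>^2 - 2, 1] = smooth_point golden_conj 1"
    by (rule v; simp add: golden_square golden_conj_square; simp add: golden_def golden_conj_def)+
  moreover have
    "vector [- 2*\<zeta>^3 - 2, - 2*\<zeta>^3 - \<zeta> - 1, 1] = smooth_point golden_conj (\<zeta>^4)"
    "vector [- 2*\<zeta>^2 - 2*\<zeta>, - (\<zeta>^3) + \<zeta> + 1, 1] = smooth_point golden (\<zeta>^4)"
    "vector [2*\<zeta>^3 + 2*\<zeta>^2 + 2*\<zeta>, \<zeta>^3 + 2*\<zeta>^2 + 2*\<zeta> + 1, 1] = smooth_point golden (\<zeta>^2)"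
    "vector [- 2*\<zeta>^2 - 2, \<zeta>^3 - \<zeta>^2 + \<zeta>, 1] = smooth_point golden_conj \<zeta>"
    "vector [2*\<zeta>^3 + 2*\<zeta> + 2, \<zeta>^2 - \<zeta> + 1, 1] = smooth_point golden_conj (\<zeta>^3)"
    "vector [- 2*\<zeta>^3 - 2*\<zeta>, 2*\<zeta>^3 + \<zeta>^2 + \<zeta> + 2, 1] = smooth_point golden_conj (\<zeta>^2)"
    "vector [2*\<zeta>^2 + 2*\<zeta> + 2, - (\<zeta>^3) - 2*\<zeta>^2 - \<zeta>, 1] = smooth_point golden \<zeta>"
    "vector [- 2*\<zeta> - 2, - (\<zeta>^2) - 2*\<zeta> - 1, 1] = smooth_point golden (\<zeta>^3)"
    by (rule v; use zeta_cyclotomic in \<open>unfold golden_def golden_conj_def, Groebner_Basis.algebra\<close>)+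
  ultimately show ?thesis unfolding hc_listed_points_def by (simp only: list.map prod.case power_0 power_one_right)
qed

lemma smooth_point_inj:
  assumes j: "j^2 = j + 1" "k^2 = k + 1" and \<omega>: "\<omega>^5 = 1" "\<rho>^5 = 1"
    and eq: "proj (smooth_point j \<omega>) = proj (smooth_point k \<rho>)"
  shows "j = k \<and> \<omega> = \<rho>"
proof -
  have X: "j * \<omega> = k * \<rho>" using eq unfolding smooth_point_def proj_vector_3_eq_iff by auto
  then have "(j * \<omega>)^5 = (k * \<rho>)^5" by simp
  then have "j^5 = k^5" by (simp add: power_mult_distrib \<omega>)
  then have "j = k" using j by (rule golden_power5_inj [rotated 2])
  moreover have "j \<noteq> 0" using j(1) by auto
  ultimately show ?thesis using X by simp
qed

lemma set_hc_listed_points: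
  "set hc_listed_points = case_prod smooth_point ` ({golden, golden_conj} \<times> fifth_roots)"
proof -
  have five: "{..<5} = {0, 1, 2, 3, 4::nat}" by auto
  show ?thesis unfolding hc_listed_points_eq fifth_roots_eq five by auto
qed

lemma distinct_hc_listed_points: "distinct (map proj hc_listed_points)"
proof -
  let ?L = "[(golden, 0), (golden_conj, 4), (golden, 4), (golden, 2), (golden_conj, 1), (golden_conj, 3),
    (golden_conj, 2), (golden_conj, 0), (golden, 1), (golden, 3::nat)]"
  have "inj_on (\<lambda>(j, m). proj (smooth_point j (\<zeta>^m))) (set ?L)"
  proof (rule inj_onI, clarify)
    fix j m k n assume mem: "(j, m) \<in> set ?L" "(k, n) \<in> set ?L"
      and eq: "proj (smooth_point j (\<zeta>^m)) = proj (smooth_point k (\<zeta>^n))"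
    have 1: "a^2 = a + 1 \<and> i < 5" if "(a, i) \<in> set ?L" for a i
      using that golden_square golden_conj_square by auto
    have 2: "(\<zeta>^i)^5 = 1" for i by (simp add: power_mult [symmetric] mult.commute [of _ 5]) (simp add: power_mult zeta_pow5)
    show "j = k \<and> m = n"
      using smooth_point_inj [OF _ _ 2 2 eq] 1 [OF mem(1)] 1 [OF mem(2)] zeta_power_inj by auto
  qed
  moreover have "distinct ?L" using golden_ne_conj by auto
  ultimately have "distinct (map (\<lambda>(j, m). proj (smooth_point j (\<zeta>^m))) ?L)" by (simp only: distinct_map)
  moreover have "map proj hc_listed_points = map (\<lambda>(j, m). proj (smooth_point j (\<zeta>^m))) ?L"
    unfolding hc_listed_points_eq by simp
  ultimately show ?thesis by (simp only:)
qed

lemma hc_node_eq: "k < 5 \<Longrightarrow> hc_node k = vector [\<zeta>^k, (\<zeta>^k)^2, 1]"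
  by (simp add: hc_node_def power_mult [symmetric] mult.commute)

lemma hc_face_places:
  "\<exists>a b c d.
          {P \<in> places hc. has_expansion P (\<lambda>t. vector [2 * t^3, t, 1])} = {a}
        \<and> {P \<in> places hc. has_expansion P (\<lambda>t. vector [2 * t^2, 1 / t, 1])} = {b}
        \<and> {P \<in> places hc. has_expansion P (\<lambda>t. vector [1, t, t^4])} = {c}
        \<and> {P \<in> places hc. has_expansion P (\<lambda>t. vector [1, t^4, t])} = {d}
        \<and> a \<in> places_over hc (proj (vector [0, 0, 1]))
        \<and> b \<in> places_over hc (proj (vector [0, 1, 0]))
        \<and> c \<noteq> d \<and> places_over hc (proj (hc_node 5)) = {c, d}
        \<and> (\<forall>k<5. card (places_over hc (proj (hc_node k))) = 2)
        \<and> distinct (map proj hc_listed_points)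
        \<and> (\<forall>q \<in> set hc_listed_points. card (places_over hc (proj q)) = 1)
        \<and> bij_betw hc_place_to_bring
            ((\<Union>k<5. places_over hc (proj (hc_node k))) \<union> {a, b, c, d}
              \<union> (\<Union>q \<in> set hc_listed_points. places_over hc (proj q)))
            face_centres"
proof -
  obtain a b where a: "places_over hc (proj (vector [0, 0, 1])) = {a}"
      "hc_place_to_bring a = proj (fourier (quad 0 (-1) 0 0))"
      "{P \<in> places hc. has_expansion P (\<lambda>t. vector [2 * t^3, t, 1])} = {a}"
    and b: "places_over hc (proj (vector [0, 1, 0])) = {b}" "hc_place_to_bring b = proj (fourier (quad 0 0 1 0))"
      "{P \<in> places hc. has_expansion P (\<lambda>t. vector [2 * t^2, 1 / t, 1])} = {b}"
    by (rule corner_places)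
  obtain c d where cd: "places_over hc (proj (vector [1, 0, 0])) = {c, d}"
    and c: "hc_place_to_bring c = proj (fourier (quad (-1) 0 0 0))"
      "{P \<in> places hc. has_expansion P (\<lambda>t. vector [1, t, t^4])} = {c}"
    and d: "hc_place_to_bring d = proj (fourier (quad 0 0 0 1))"
      "{P \<in> places hc. has_expansion P (\<lambda>t. vector [1, t^4, t])} = {d}"
    by (rule node_at_infinity_places)
  have "\<exists>P. j^2 = j + 1 \<and> \<omega>^5 = 1 \<longrightarrow> places_over hc (proj (smooth_point j \<omega>)) = {P} \<and>
      hc_place_to_bring P = face_point (Smooth j \<omega>)" for j \<omega>
    unfolding smooth_point_def face_point_def face_coords.simps by (metis hc_listed_place)
  then obtain S where S: "places_over hc (proj (smooth_point j \<omega>)) = {S j \<omega>}"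
      "hc_place_to_bring (S j \<omega>) = face_point (Smooth j \<omega>)" if "j^2 = j + 1" "\<omega>^5 = 1" for j \<omega>
    by metis
  have "\<exists>P Q. \<omega>^5 = 1 \<longrightarrow> places_over hc (proj (vector [\<omega>, \<omega>^2, 1])) = {P, Q} \<and>
      hc_place_to_bring P = face_point (Node golden \<omega>) \<and> hc_place_to_bring Q = face_point (Node golden_conj \<omega>)" for \<omega>
    using hc_node_places [OF _ golden_square, of \<omega>]
    unfolding face_point_def face_coords.simps golden_conj_eq by metis
  then obtain N N' where N: "places_over hc (proj (vector [\<omega>, \<omega>^2, 1])) = {N \<omega>, N' \<omega>}"
      "hc_place_to_bring (N \<omega>) = face_point (Node golden \<omega>)"
      "hc_place_to_bring (N' \<omega>) = face_point (Node golden_conj \<omega>)" if "\<omega>^5 = 1" for \<omega>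
    by metis
  have minus: "proj (fourier (quad (- w) (- x) (- y) (- z))) = proj (fourier (quad w x y z))" for w x y z
    using smult_quad [of "-1" w x y z] proj_smult [of "-1" "fourier (quad w x y z)"] by simp
  have corners: "hc_place_to_bring c = face_point (Corner 1)" "hc_place_to_bring a = face_point (Corner 2)"
    "hc_place_to_bring b = face_point (Corner 3)" "hc_place_to_bring d = face_point (Corner 4)"
    unfolding face_point_def fourier_Corner a(2) b(2) c(1) d(1)
    using minus [of 1 0 0 0] minus [of 0 1 0 0] by simp_all
  define pl where "pl l = (case l of Corner i \<Rightarrow> if i = 1 then c else if i = 2 then a else if i = 3 then b else d
    | Smooth j \<omega> \<Rightarrow> S j \<omega> | Node j \<omega> \<Rightarrow> if j = golden then N \<omega> else N' \<omega>)" for l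
  have img: "hc_place_to_bring (pl l) = face_point l" if "l \<in> face_labels" for l
  proof -
    from that show ?thesis
    proof (cases rule: face_label_cases)
      case (Corner i)
      then show ?thesis using corners by (auto simp: pl_def)
    next
      case (Smooth j \<omega>)
      then have "j^2 = j + 1" using golden_square golden_conj_square by auto
      then show ?thesis using Smooth S(2) by (simp add: pl_def)
    next
      case (Node j \<omega>)
      then show ?thesis using N(2,3) golden_ne_conj by (auto simp: pl_def)
    qed
  qed
  have label_mem: "Corner i \<in> face_labels" if "i \<in> {1..4}" for i using that unfolding face_labels_def by blast
  have node_mem: "Node golden \<omega> \<in> face_labels" "Node golden_conj \<omega> \<in> face_labels" if "\<omega>^5 = 1" for \<omega>
    using that unfolding face_labels_def fifth_roots_def by blast+
  have zeta5: "(\<zeta>^k)^5 = 1" for k by (simp add: power_mult [symmetric] mult.commute [of _ 5]) (simp add: power_mult zeta_pow5)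
  have N_ne: "N \<omega> \<noteq> N' \<omega>" if "\<omega>^5 = 1" for \<omega>
    using N(2,3) [OF that] inj_onD [OF face_point_inj _ node_mem [OF that]] golden_ne_conj by auto
  have "c \<noteq> d"
    using corners(1,4) inj_onD [OF face_point_inj _ label_mem label_mem, of 1 4] by auto
  moreover have "places_over hc (proj (hc_node 5)) = {c, d}" using cd by (simp add: hc_node_def)
  moreover have "\<forall>k<5. card (places_over hc (proj (hc_node k))) = 2"
    using N(1) [OF zeta5] N_ne [OF zeta5] by (simp add: hc_node_eq)
  moreover have listed: "places_over hc (proj (smooth_point j \<omega>)) = {S j \<omega>}"
    if "j \<in> {golden, golden_conj}" "\<omega> \<in> fifth_roots" for j \<omega>
    using that S(1) golden_square golden_conj_square unfolding fifth_roots_def by blast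
  then have "\<forall>q \<in> set hc_listed_points. card (places_over hc (proj q)) = 1"
    unfolding set_hc_listed_points by auto
  moreover have "bij_betw hc_place_to_bring
            ((\<Union>k<5. places_over hc (proj (hc_node k))) \<union> {a, b, c, d}
              \<union> (\<Union>q \<in> set hc_listed_points. places_over hc (proj q))) face_centres"
  proof -
    have "(\<Union>k<5. places_over hc (proj (hc_node k))) = (\<Union>k<5. {N (\<zeta>^k), N' (\<zeta>^k)})"
      using N(1) [OF zeta5] by (simp add: hc_node_eq)
    also have "\<dots> = (\<Union>\<omega>\<in>fifth_roots. {N \<omega>, N' \<omega>})" unfolding fifth_roots_eq by simp
    also have "\<dots> = pl ` case_prod Node ` ({golden, golden_conj} \<times> fifth_roots)"
      using golden_ne_conj by (auto simp: pl_def image_iff)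
    finally have nodes: "(\<Union>k<5. places_over hc (proj (hc_node k))) = pl ` case_prod Node ` ({golden, golden_conj} \<times> fifth_roots)" .
    have "(\<Union>q \<in> set hc_listed_points. places_over hc (proj q)) = (\<Union>(j, \<omega>)\<in>{golden, golden_conj} \<times> fifth_roots. {S j \<omega>})"
      unfolding set_hc_listed_points using listed by auto
    also have "\<dots> = pl ` case_prod Smooth ` ({golden, golden_conj} \<times> fifth_roots)"
      by (auto simp: pl_def image_iff)
    finally have smooth: "(\<Union>q \<in> set hc_listed_points. places_over hc (proj q)) = pl ` case_prod Smooth ` ({golden, golden_conj} \<times> fifth_roots)" .
    have "{1..4} = {1, 2, 3, 4::nat}" by auto
    then have "{a, b, c, d} = pl ` Corner ` {1..4}" by (simp add: pl_def) blast
    then have dom: "(\<Union>k<5. places_over hc (proj (hc_node k))) \<union> {a, b, c, d}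
        \<union> (\<Union>q \<in> set hc_listed_points. places_over hc (proj q)) = pl ` face_labels"
      unfolding nodes smooth face_labels_def by (simp only: image_Un Un_ac)
    have "inj_on hc_place_to_bring (pl ` face_labels)"
      using face_point_inj img by (auto simp: inj_on_def)
    moreover have "hc_place_to_bring ` pl ` face_labels = zeta_orbit"
      using face_point_bij img unfolding bij_betw_def by (simp add: image_image)
    ultimately show ?thesis unfolding dom face_centres_eq bij_betw_def by blast
  qed
  ultimately show ?thesis
    using a(1,3) b(1,3) c(2) d(2) distinct_hc_listed_points
    by (intro exI [of _ a] exI [of _ b] exI [of _ c] exI [of _ d] conjI) simp_all
qed

lemma listed_points_golden:
  "proj (hc_listed_points ! 0) = proj (vector [2 * golden, golden_conj - 2, 1])"
  "proj (hc_listed_points ! 7) = proj (vector [2 * golden_conj, golden - 2, 1])"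
  by (simp_all add: hc_listed_points_def golden_def golden_conj_def algebra_simps)

lemma listed_points_sqrt5:
  "proj (hc_listed_points ! 0)
        = proj (vector [of_real (sqrt 5 + 1), of_real (- sqrt 5 / 2 - 3 / 2), 1])"
  "proj (hc_listed_points ! 7)
        = proj (vector [of_real (- sqrt 5 + 1), of_real (sqrt 5 / 2 - 3 / 2), 1])"
proof -
  have "2 * golden = of_real (sqrt 5 + 1)" "golden_conj - 2 = of_real (- sqrt 5 / 2 - 3 / 2)"
    "2 * golden_conj = of_real (- sqrt 5 + 1)" "golden - 2 = of_real (sqrt 5 / 2 - 3 / 2)"
    unfolding golden_conj_eq golden_eq_sqrt5 by (simp_all add: field_simps)
  then show "proj (hc_listed_points ! 0)
        = proj (vector [of_real (sqrt 5 + 1), of_real (- sqrt 5 / 2 - 3 / 2), 1])"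
    "proj (hc_listed_points ! 7)
        = proj (vector [of_real (- sqrt 5 + 1), of_real (sqrt 5 / 2 - 3 / 2), 1])"
    unfolding listed_points_golden by (simp_all only:)
qed

section \<open>Face-centres of Bring's curve in the HC-model\<close>

theorem proposition3p8:
  shows "(\<exists>!S. S \<in> orbits bring_aut bring (\<lambda>g. g) \<and> card S = 24)
    \<and> face_centres = {P \<in> bring. \<exists>g \<in> carrier bring_aut. group.ord bring_aut g = 5 \<and> g P = P}
    \<and> face_centres =
        {proj (permute_coords \<sigma> (vector [1, \<zeta>, \<zeta>^2, \<zeta>^3, \<zeta>^4])) | \<sigma>. bij \<sigma>}
    \<and> (\<exists>a b c d.
          {P \<in> places hc. has_expansion P (\<lambda>t. vector [2 * t^3, t, 1])} = {a}
        \<and> {P \<in> places hc. has_expansion P (\<lambda>t. vector [2 * t^2, 1 / t, 1])} = {b}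
        \<and> {P \<in> places hc. has_expansion P (\<lambda>t. vector [1, t, t^4])} = {c}
        \<and> {P \<in> places hc. has_expansion P (\<lambda>t. vector [1, t^4, t])} = {d}
        \<and> a \<in> places_over hc (proj (vector [0, 0, 1]))
        \<and> b \<in> places_over hc (proj (vector [0, 1, 0]))
        \<and> c \<noteq> d \<and> places_over hc (proj (hc_node 5)) = {c, d}
        \<and> (\<forall>k<5. card (places_over hc (proj (hc_node k))) = 2)
        \<and> distinct (map proj hc_listed_points)
        \<and> (\<forall>q \<in> set hc_listed_points. card (places_over hc (proj q)) = 1)
        \<and> bij_betw hc_place_to_bring
            ((\<Union>k<5. places_over hc (proj (hc_node k))) \<union> {a, b, c, d}
              \<union> (\<Union>q \<in> set hc_listed_points. places_over hc (proj q)))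
            face_centres)
    \<and> proj (hc_listed_points ! 0)
        = proj (vector [of_real (sqrt 5 + 1), of_real (- sqrt 5 / 2 - 3 / 2), 1])
    \<and> proj (hc_listed_points ! 0) = proj (vector [2 * golden, golden_conj - 2, 1])
    \<and> proj (hc_listed_points ! 7)
        = proj (vector [of_real (- sqrt 5 + 1), of_real (sqrt 5 / 2 - 3 / 2), 1])
    \<and> proj (hc_listed_points ! 7) = proj (vector [2 * golden_conj, golden - 2, 1])"
proof (intro conjI)
  show "\<exists>!S. S \<in> orbits bring_aut bring (\<lambda>g. g) \<and> card S = 24" by (rule unique_orbit_24)
  show "face_centres = {P \<in> bring. \<exists>g \<in> carrier bring_aut. group.ord bring_aut g = 5 \<and> g P = P}"
    by (rule face_centres_fixed_points)
  show "face_centres =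
        {proj (permute_coords \<sigma> (vector [1, \<zeta>, \<zeta>^2, \<zeta>^3, \<zeta>^4])) | \<sigma>. bij \<sigma>}"
    unfolding face_centres_eq zeta_orbit_permutations zeta_vector_def by (rule refl)
qed (rule hc_face_places listed_points_golden listed_points_sqrt5)+

end
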